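(* Let $0\le\theta<\pi/2$, $A,B\in\mathcal S_\theta$ with $0<mI\le\Re A,\ \Re B\le MI$ ($0<m\le M$), $v\in[0,1]$, and $f:(0,\infty)\to(0,\infty)$ operator monotone with $f(1)=1$. Then for every positive unital linear map $\Phi$ and all operator means $\sigma_1,\sigma_2$ with $!_v\le\sigma_1,\sigma_2\le\nabla_v$, $$\Re\Big(f(\Phi(A))\,\sigma_1\,f(\Phi(B))\Big)\le K\sec^4\theta\,\Re f\big(\Phi(A\sigma_2B)\big),$$ where $K=\frac{(M+m)^2}{4mM}$.
   Context: $\Re X=\frac{X+X^*}{2}$; for Hermitian $X,Y$, $X\le Y$ means $Y-X$ is positive semidefinite. $\mathcal S_\theta$ ($0\le\theta<\pi/2$) is the set of $A\in\mathbb M_n$ whose numerical range lies in $\{z:\Re z>0,\ |\Im z|\le(\Re z)\tan\theta\}$. For accretive $X$ ($\Re X>0$), $f(X)$ is defined by the holomorphic functional calculus. An operator mean $\sigma$ has an operator monotone representing function $g:(0,\infty)\to(0,\infty)$, $g(1)=1$, and $A\sigma B=A^{1/2}g(A^{-1/2}BA^{-1/2})A^{1/2}$ (also used for accretive $A,B$). $A\nabla_vB=vA+(1-v)B$, $A!_vB=(vA^{-1}+(1-v)B^{-1})^{-1}$. For means with representing functions $g_1,g_2$, $\tau_1\le\tau_2$ means $g_1\le g_2$ on $(0,\infty)$. $\Phi$ positive: maps positive semidefinite to positive semidefinite; unital: $\Phi(I)=I$. *)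

theory Defs
  imports "Jordan_Normal_Form.Schur_Decomposition" "HOL-Complex_Analysis.Complex_Analysis"
begin

definition ReM :: "complex mat \<Rightarrow> complex mat" where
  "ReM X = (1/2 :: complex) \<cdot>\<^sub>m (X + mat_adjoint X)"

definition psd :: "complex mat \<Rightarrow> bool" where
  "psd X \<longleftrightarrow> X \<in> carrier_mat (dim_row X) (dim_row X) \<and> mat_adjoint X = X \<and>
     (\<forall>v \<in> carrier_vec (dim_row X). Re (conjugate v \<bullet> (X *\<^sub>v v)) \<ge> 0)"

definition pd :: "complex mat \<Rightarrow> bool" where
  "pd X \<longleftrightarrow> X \<in> carrier_mat (dim_row X) (dim_row X) \<and> mat_adjoint X = X \<and>
     (\<forall>v \<in> carrier_vec (dim_row X). v \<noteq> 0\<^sub>v (dim_row X) \<longrightarrow> Re (conjugate v \<bullet> (X *\<^sub>v v)) > 0)"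

definition loewner_le :: "complex mat \<Rightarrow> complex mat \<Rightarrow> bool" where
  "loewner_le X Y \<longleftrightarrow> dim_row X = dim_row Y \<and> dim_col X = dim_col Y \<and> psd (Y - X)"

definition minv :: "complex mat \<Rightarrow> complex mat" where
  "minv X = (SOME Y. Y \<in> carrier_mat (dim_row X) (dim_row X) \<and>
                     X * Y = 1\<^sub>m (dim_row X) \<and> Y * X = 1\<^sub>m (dim_row X))"

definition spec :: "complex mat \<Rightarrow> complex set" where
  "spec X = {z. Determinant.det (z \<cdot>\<^sub>m 1\<^sub>m (dim_row X) - X) = 0}"

definition numrange :: "complex mat \<Rightarrow> complex set" where
  "numrange X = {conjugate v \<bullet> (X *\<^sub>v v) | v. v \<in> carrier_vec (dim_row X) \<and> conjugate v \<bullet> v = 1}"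

definition sector :: "real \<Rightarrow> complex mat \<Rightarrow> bool" where
  "sector \<theta> X \<longleftrightarrow> X \<in> carrier_mat (dim_row X) (dim_row X) \<and>
     numrange X \<subseteq> {z. Re z > 0 \<and> \<bar>Im z\<bar> \<le> Re z * tan \<theta>}"

text \<open>The slit plane C minus (-infinity,0], where operator monotone functions
  (and the principal square root) are holomorphic.\<close>
definition slit :: "complex set" where
  "slit = - {z. Im z = 0 \<and> Re z \<le> 0}"

text \<open>Riesz--Dunford integral: f(X) = (1/(2 pi i)) \<integral>_\<gamma> f(z) (zI - X)^{-1} dz,
  for a closed contour \<gamma> in the (simply connected) slit plane winding once
  around every eigenvalue of X.\<close>
definition mfun :: "(complex \<Rightarrow> complex) \<Rightarrow> complex mat \<Rightarrow> complex mat" where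
  "mfun f X =
    (let n = dim_row X;
         \<gamma> = (SOME \<gamma>. valid_path \<gamma> \<and> pathfinish \<gamma> = pathstart \<gamma> \<and>
                     path_image \<gamma> \<subseteq> slit - spec X \<and>
                     (\<forall>z \<in> spec X. winding_number \<gamma> z = 1))
     in Matrix.mat n n (\<lambda>(i,j). contour_integral \<gamma> (\<lambda>z. f z * minv (z \<cdot>\<^sub>m 1\<^sub>m n - X) $$ (i,j))
                         / (2 * complex_of_real pi * \<i>)))"

text \<open>Operator monotone on (0,infinity) (matrices of every size); f is given through its
  holomorphic extension to the slit plane, which is what the functional calculus uses.\<close>
definition op_monotone :: "(complex \<Rightarrow> complex) \<Rightarrow> bool" where
  "op_monotone f \<longleftrightarrow> (\<forall>n X Y. X \<in> carrier_mat n n \<longrightarrow> Y \<in> carrier_mat n n \<longrightarrow>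
       pd X \<longrightarrow> loewner_le X Y \<longrightarrow> loewner_le (mfun f X) (mfun f Y))"

definition rep_fun :: "(complex \<Rightarrow> complex) \<Rightarrow> bool" where
  "rep_fun g \<longleftrightarrow> g holomorphic_on slit \<and>
     (\<forall>x::real. x > 0 \<longrightarrow> g (complex_of_real x) \<in> \<real> \<and> Re (g (complex_of_real x)) > 0) \<and>
     g 1 = 1 \<and> op_monotone g"

definition mmean :: "(complex \<Rightarrow> complex) \<Rightarrow> complex mat \<Rightarrow> complex mat \<Rightarrow> complex mat" where
  "mmean g A B =
    (let S = mfun csqrt A; Si = minv S in S * mfun g (Si * B * Si) * S)"

definition pos_unital_linear :: "nat \<Rightarrow> nat \<Rightarrow> (complex mat \<Rightarrow> complex mat) \<Rightarrow> bool" where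
  "pos_unital_linear n k \<Phi> \<longleftrightarrow>
     (\<forall>X \<in> carrier_mat n n. \<Phi> X \<in> carrier_mat k k) \<and>
     (\<forall>X \<in> carrier_mat n n. \<forall>Y \<in> carrier_mat n n. \<Phi> (X + Y) = \<Phi> X + \<Phi> Y) \<and>
     (\<forall>c. \<forall>X \<in> carrier_mat n n. \<Phi> (c \<cdot>\<^sub>m X) = c \<cdot>\<^sub>m \<Phi> X) \<and>
     (\<forall>X \<in> carrier_mat n n. psd X \<longrightarrow> psd (\<Phi> X)) \<and>
     \<Phi> (1\<^sub>m n) = 1\<^sub>m k"

end

theory Submission
  imports Defs
begin

text \<open>
  The weighted harmonic means $h_s(z) = z / (s z + 1 - s)$, $0 \<le> s \<le> 1$, generate everything: a
  representing function is a limit, uniform on compact subsets of the slit plane, of positive combinations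
  $\<Sum> w_j h_{s_j}$. Indeed, comparing matrices that differ by a small Householder rotation, operator monotonicity
  gives positivity of the kernel $(b f(a^2) + a f(b^2)) / (a + b)$ on the positive reals. With
  $w = (1 - \<zeta>) / (1 + \<zeta>)$ this makes the Taylor coefficients of $f(w^2)/w$ a positive Toeplitz sequence, and the
  Fejer means of that sequence, sampled at roots of unity, are the weights $w_j$.

  All the inequalities involved are linear in the representing function, so it suffices to prove them for $h_s$. There
  the mean $H$ of $A$ and $B$ is $(s A^{-1} + (1 - s) B^{-1})^{-1}$ and is described without inverses: every $u$ splits as
  $u = s a + (1 - s) b$ with $A a = B b = H u$, so that $\<langle>u, H u\<rangle> = s \<langle>a, A a\<rangle> + (1 - s) \<langle>b, B b\<rangle>$. Up to the
  factor $sec^2 \<theta>$ this is the least real value over all such splittings (sectoriality), and it is at least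
  $4 m M / (M + m)^2$ times the arithmetic mean (Kantorovich). Finally, a function squeezed between the weighted harmonic
  and arithmetic means has derivative $1 - v$ at 1, so the weighted averages of the parameters $s_j$ tend to $v$.
\<close>

section \<open>Contours in the slit plane and the resolvent\<close>

text \<open>The matrices are not normal, so their functions cannot be handled by diagonalization:
  every inequality must be read off quadratic forms, and the h_s are functions whose values at a
  matrix allow this. Finite sums and locally uniform limits stand in for Loewner's integral
  representation, so no representing measure is constructed. Even the identity (X^{1/2})^2 = X
  behind \<open>mmean\<close> is inherited from the h_s, by approximating the square root. The
  factors of the final constant arise at separate places. The Kantorovich factor is paid once, when
  A \<sigma>_2 B is bounded below by a multiple of the arithmetic mean, before \<Phi> is applied.
  One factor sec^2 is paid when the \<sigma>_1 mean is bounded above by the arithmetic mean of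
  f(\<Phi>(A)) and f(\<Phi>(B)). The other is paid inside f: the splitting that belongs to \<Phi>(A
  \<sigma>_2 B) serves as a trial splitting for \<Phi>(A) and for \<Phi>(B), three matrices linked
  only by an inequality between their real parts.\<close>

lemma slit_eq: "slit = - complex_of_real ` {..0}"
  by (force simp: slit_def complex_eq_iff image_iff)

lemma open_slit [simp, intro]: "open slit"
proof -
  have "closed {z. Im z = 0 \<and> Re z \<le> 0}"
    by (intro closed_Collect_conj closed_Collect_eq closed_Collect_le continuous_intros)
  thus ?thesis unfolding slit_def by (rule open_Compl)
qed

lemma starlike_slit: "starlike slit"
  unfolding slit_eq by (rule starlike_slotted_complex_plane_left)

lemma simply_connected_slit: "simply_connected slit"
  by (rule starlike_imp_simply_connected[OF starlike_slit])

lemma slit_nonpos_Reals: "slit = - \<real>\<^sub>\<le>\<^sub>0"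
  by (auto simp: slit_def complex_nonpos_Reals_iff)

lemma of_real_in_slit [simp]: "complex_of_real x \<in> slit \<longleftrightarrow> x > 0"
  by (auto simp: slit_def)

lemma Re_pos_in_slit: "Re z > 0 \<Longrightarrow> z \<in> slit"
  by (auto simp: slit_def)

lemma square_in_slit: "Re w > 0 \<Longrightarrow> w\<^sup>2 \<in> slit"
  by (auto simp: slit_def power2_eq_square) (metis mult_pos_pos not_le)

lemma Re_csqrt_pos: "z \<in> slit \<Longrightarrow> Re (csqrt z) > 0"
proof -
  assume z: "z \<in> slit"
  have "Re (csqrt z) \<noteq> 0"
  proof
    assume 0: "Re (csqrt z) = 0"
    have "(csqrt z)\<^sup>2 = z" by simp
    hence "Im z = 0 \<and> Re z \<le> 0"
      using 0 by (metis Im_power2 Re_power2 diff_0 mult_zero_left mult_zero_right neg_le_0_iff_le power_zero_numeral zero_le_power2)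
    with z show False by (auto simp: slit_def)
  qed
  moreover have "Re (csqrt z) \<ge> 0" by (rule Re_csqrt)
  ultimately show ?thesis by linarith
qed

lemma csqrt_holomorphic_slit: "csqrt holomorphic_on slit"
  unfolding slit_nonpos_Reals
  by (auto intro!: holomorphic_on_subset[OF holomorphic_on_csqrt])

lemma winding_slit_outside:
  assumes "valid_path \<gamma>" "pathfinish \<gamma> = pathstart \<gamma>" "path_image \<gamma> \<subseteq> slit" "z \<notin> slit"
  shows "winding_number \<gamma> z = 0"
  using simply_connected_imp_winding_number_zero[OF simply_connected_slit] assms valid_path_imp_path
  by blast

text \<open>The squaring map carries the right half-plane onto the slit plane, so the contour can be
  taken as the square of a large circle.\<close>
lemma contour_exists:
  assumes C: "compact C" "C \<subseteq> slit"
  obtains \<gamma> where "valid_path \<gamma>" "pathfinish \<gamma> = pathstart \<gamma>" "path_image \<gamma> \<subseteq> slit - C"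
    "\<And>z. z \<in> C \<Longrightarrow> winding_number \<gamma> z = 1"
proof -
  define D where "D = csqrt ` C"
  have cont: "continuous_on C csqrt"
    using csqrt_holomorphic_slit C(2) holomorphic_on_imp_continuous_on holomorphic_on_subset by blast
  have D: "compact D" unfolding D_def by (rule compact_continuous_image[OF cont C(1)])
  have Dpos: "Re w > 0" if "w \<in> D" for w using that Re_csqrt_pos C(2) unfolding D_def by auto
  obtain e where e: "e > 0" "\<And>w. w \<in> D \<Longrightarrow> Re w \<ge> e"
  proof (cases "D = {}")
    case True thus ?thesis using that[of 1] by auto
  next
    case False
    have "continuous_on D Re" by (intro continuous_intros)
    from continuous_attains_inf[OF D False this] obtain x where "x \<in> D" "\<forall>y\<in>D. Re x \<le> Re y" by blast
    thus ?thesis using that[of "Re x"] Dpos by auto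
  qed
  obtain b where b: "b > 0" "\<And>w. w \<in> D \<Longrightarrow> cmod w \<le> b"
    using compact_imp_bounded[OF D] bounded_pos by metis
  \<comment> \<open>Points w of \<open>D\<close> satisfy Re w \<ge> e and |w| \<le> b. The circle
    about \<open>R\<close> of radius \<open>R - e/2\<close> stays at distance e/2 from the imaginary
    axis, and |w - R|^2 \<le> b^2 - 2 R e + R^2 is below r^2 = R^2 - R e + e^2/4 once b^2 \<le> R e;
    this dictates \<open>R\<close>.\<close>
  define R where "R = b\<^sup>2 / e + e"
  define r where "r = R - e / 2"
  have R: "R > e" "r > 0" "r < R" using e b by (auto simp: R_def r_def divide_pos_pos add_pos_pos)
  have near: "cmod (w - of_real R) < r" if w: "w \<in> D" for w
  proof -
    have "(cmod (w - of_real R))\<^sup>2 = (cmod w)\<^sup>2 - 2 * R * Re w + R\<^sup>2"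
      unfolding cmod_power2 by (simp add: power2_eq_square algebra_simps)
    also have "\<dots> \<le> b\<^sup>2 - 2 * R * e + R\<^sup>2"
      using b(2)[OF w] e(2)[OF w] R e by (intro add_mono diff_mono mult_left_mono power_mono) auto
    also have "b\<^sup>2 \<le> R * e" using e(1) by (simp add: R_def field_simps)
    also have "R * e - 2 * R * e + R\<^sup>2 < r\<^sup>2" using e(1) by (simp add: r_def power2_eq_square field_simps)
    finally show ?thesis using R(2) by (simp add: power2_less_imp_less)
  qed
  define \<gamma> where "\<gamma> = (\<lambda>w. w\<^sup>2) \<circ> circlepath (of_real R) r"
  have sph: "Re w > 0" if "w \<in> sphere (of_real R) r" for w
  proof -
    have "R - Re w \<le> cmod (of_real R - w)" using complex_Re_le_cmod[of "of_real R - w"] by simp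
    also have "\<dots> = r" using that by (simp add: dist_norm)
    finally show ?thesis using R by linarith
  qed
  have an: "(\<lambda>w::complex. w\<^sup>2) analytic_on UNIV" by (intro analytic_intros)
  have vp: "valid_path \<gamma>" unfolding \<gamma>_def
    by (rule valid_path_compose_holomorphic[where S=UNIV]) (auto intro!: holomorphic_intros)
  have pi: "path_image \<gamma> = (\<lambda>w. w\<^sup>2) ` sphere (of_real R) r"
    unfolding \<gamma>_def path_image_compose using R by simp
  have sub: "path_image \<gamma> \<subseteq> slit - C"
  proof
    fix z assume "z \<in> path_image \<gamma>"
    then obtain w where w: "w \<in> sphere (of_real R) r" "z = w\<^sup>2" unfolding pi by blast
    have "z \<in> slit" using w sph square_in_slit by blast
    moreover have "z \<notin> C"
    proof
      assume "z \<in> C"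
      hence "csqrt z \<in> D" unfolding D_def by blast
      moreover have "csqrt z = w" using w sph by (simp add: csqrt_square)
      ultimately have "cmod (w - of_real R) < r" using near by blast
      thus False using w(1) by (simp add: dist_norm norm_minus_commute)
    qed
    ultimately show "z \<in> slit - C" by blast
  qed
  show ?thesis
  proof (rule that[OF vp _ sub])
    show "pathfinish \<gamma> = pathstart \<gamma>" unfolding \<gamma>_def by (simp add: pathfinish_compose pathstart_compose)
    fix z assume z: "z \<in> C"
    define s where "s = csqrt z"
    have s: "s \<in> D" "s\<^sup>2 = z" using z unfolding s_def D_def by auto
    have s3: "Re s > 0" by (rule Dpos[OF s(1)])
    have ins: "s \<notin> path_image (circlepath (of_real R) r)" using near[OF s(1)] R
      by (simp add: dist_norm norm_minus_commute)
    \<comment> \<open>The other square root -s lies in the left half-plane, outside the disc. Pulled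
      back by squaring, dw/(w - z) becomes 2w/(w^2 - z) = 1/(w - s) + 1/(w + s), and only the pole s
      is enclosed, once.\<close>
    have ms: "- s \<notin> cball (of_real R) r"
    proof
      assume "- s \<in> cball (of_real R) r"
      hence "cmod (of_real R + s) \<le> r" by (simp add: dist_norm)
      moreover have "R + Re s \<le> cmod (of_real R + s)" using complex_Re_le_cmod[of "of_real R + s"] by simp
      ultimately show False using s3 R by linarith
    qed
    hence ms': "- s \<notin> path_image (circlepath (of_real R) r)" using R sphere_cball by auto
    have w0: "winding_number (circlepath (of_real R) r) (- s) = 0"
      using ms R by (intro winding_number_zero_outside[of _ "cball (of_real R) r"]) auto
    have w1: "winding_number (circlepath (of_real R) r) s = 1"
      using near[OF s(1)] by (intro winding_number_circlepath) auto
    have i1: "((\<lambda>w. 1 / (w - s)) has_contour_integral complex_of_real (2 * pi) * \<i>) (circlepath (of_real R) r)"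
      using has_contour_integral_winding_number[OF _ ins] w1 by simp
    have i2: "((\<lambda>w. 1 / (w - (- s))) has_contour_integral 0) (circlepath (of_real R) r)"
      using has_contour_integral_winding_number[OF _ ms'] w0 by simp
    have "contour_integral \<gamma> (\<lambda>w. 1 / (w - z)) =
       contour_integral (circlepath (of_real R) r) (\<lambda>w. deriv (\<lambda>w. w\<^sup>2) w * (1 / (w\<^sup>2 - z)))"
      unfolding \<gamma>_def by (rule contour_integral_comp_analyticW[OF an]) auto
    also have "\<dots> = contour_integral (circlepath (of_real R) r) (\<lambda>w. 1 / (w - s) + 1 / (w - (- s)))"
    proof (rule contour_integral_eq)
      fix w assume w: "w \<in> path_image (circlepath (of_real R) r)"
      hence "w - s \<noteq> 0" "w + s \<noteq> 0" using ins ms' by (auto simp: add_eq_0_iff2)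
      moreover have "deriv (\<lambda>w::complex. w\<^sup>2) w = 2 * w"
        by (rule DERIV_imp_deriv) (auto intro!: derivative_eq_intros)
      moreover have "w\<^sup>2 - z = (w - s) * (w + s)" using s(2) by (simp add: power2_eq_square algebra_simps)
      ultimately show "deriv (\<lambda>w. w\<^sup>2) w * (1 / (w\<^sup>2 - z)) = 1 / (w - s) + 1 / (w - (- s))"
        by (simp add: divide_simps)
    qed
    also have "\<dots> = complex_of_real (2 * pi) * \<i>"
      using contour_integral_unique[OF has_contour_integral_add[OF i1 i2]] by simp
    finally show "winding_number \<gamma> z = 1"
      using winding_number_valid_path[OF vp, of z] sub z by auto
  qed
qed

section \<open>Inverses and resolvents as functions of a parameter\<close>

lemma minv_unique:
  assumes "X \<in> carrier_mat n n" "Y \<in> carrier_mat n n" "X * Y = 1\<^sub>m n" "Y * X = 1\<^sub>m n"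
  shows "minv X = Y"
  unfolding minv_def
proof (rule some_equality)
  show "Y \<in> carrier_mat (dim_row X) (dim_row X) \<and> X * Y = 1\<^sub>m (dim_row X) \<and> Y * X = 1\<^sub>m (dim_row X)"
    using assms by auto
  fix Z assume Z: "Z \<in> carrier_mat (dim_row X) (dim_row X) \<and> X * Z = 1\<^sub>m (dim_row X) \<and> Z * X = 1\<^sub>m (dim_row X)"
  hence Z': "Z \<in> carrier_mat n n" "X * Z = 1\<^sub>m n" using assms by auto
  have "Z = (Y * X) * Z" using Z' assms by simp
  also have "\<dots> = Y * (X * Z)" by (rule assoc_mult_mat[OF assms(2,1) Z'(1)])
  also have "\<dots> = Y" using Z' assms by simp
  finally show "Z = Y" .
qed

text \<open>Cramer's rule replaces the choice operator in \<open>minv\<close> by a quotient of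
  polynomials in the entries. Regularity of the resolvent in any parameter then reduces to
  regularity of determinants.\<close>

lemma minv_adj_mat:
  assumes X: "X \<in> carrier_mat n n" and d: "Determinant.det X \<noteq> 0"
  shows "minv X = (1 / Determinant.det X) \<cdot>\<^sub>m adj_mat X" "minv X \<in> carrier_mat n n"
    "X * minv X = 1\<^sub>m n" "minv X * X = 1\<^sub>m n"
proof -
  note a = adj_mat[OF X]
  let ?Y = "(1 / Determinant.det X) \<cdot>\<^sub>m adj_mat X"
  have 1: "?Y \<in> carrier_mat n n" using a by simp
  have 2: "X * ?Y = 1\<^sub>m n"
  proof -
    have "X * ?Y = (1 / Determinant.det X) \<cdot>\<^sub>m (X * adj_mat X)" by (rule mult_smult_distrib[OF X a(1)])
    also have "\<dots> = 1\<^sub>m n" unfolding a(2) using d by (auto intro!: eq_matI)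
    finally show ?thesis .
  qed
  have 3: "?Y * X = 1\<^sub>m n"
  proof -
    have "?Y * X = (1 / Determinant.det X) \<cdot>\<^sub>m (adj_mat X * X)" by (rule mult_smult_assoc_mat[OF a(1) X])
    also have "\<dots> = 1\<^sub>m n" unfolding a(3) using d by (auto intro!: eq_matI)
    finally show ?thesis .
  qed
  show e: "minv X = ?Y" by (rule minv_unique[OF X 1 2 3])
  show "minv X \<in> carrier_mat n n" "X * minv X = 1\<^sub>m n" "minv X * X = 1\<^sub>m n" unfolding e by fact+
qed

definition resolv :: "complex mat \<Rightarrow> complex \<Rightarrow> complex mat" where
  "resolv X z = minv (z \<cdot>\<^sub>m 1\<^sub>m (dim_row X) - X)"

lemma resolv_props:
  assumes X: "X \<in> carrier_mat n n" and z: "z \<notin> spec X"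
  shows "resolv X z \<in> carrier_mat n n" "(z \<cdot>\<^sub>m 1\<^sub>m n - X) * resolv X z = 1\<^sub>m n"
    "resolv X z * (z \<cdot>\<^sub>m 1\<^sub>m n - X) = 1\<^sub>m n"
proof -
  have c: "z \<cdot>\<^sub>m 1\<^sub>m n - X \<in> carrier_mat n n" by (rule minus_carrier_mat[OF X])
  have d: "Determinant.det (z \<cdot>\<^sub>m 1\<^sub>m n - X) \<noteq> 0" using z X by (simp add: spec_def)
  have r: "resolv X z = minv (z \<cdot>\<^sub>m 1\<^sub>m n - X)" using X by (simp add: resolv_def)
  show "resolv X z \<in> carrier_mat n n" "(z \<cdot>\<^sub>m 1\<^sub>m n - X) * resolv X z = 1\<^sub>m n"
    "resolv X z * (z \<cdot>\<^sub>m 1\<^sub>m n - X) = 1\<^sub>m n" unfolding r by (rule minv_adj_mat[OF c d])+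
qed

lemma spec_eigenvalue:
  assumes X: "X \<in> carrier_mat n n"
  shows "z \<in> spec X \<longleftrightarrow> (\<exists>v \<in> carrier_vec n. v \<noteq> 0\<^sub>v n \<and> X *\<^sub>v v = z \<cdot>\<^sub>v v)"
proof -
  have "z \<in> spec X \<longleftrightarrow> eigenvalue X z"
  proof -
    have c: "z \<cdot>\<^sub>m 1\<^sub>m n - X \<in> carrier_mat n n" by (rule minus_carrier_mat[OF X])
    have "z \<in> spec X \<longleftrightarrow> (\<exists>v. v \<in> carrier_vec n \<and> v \<noteq> 0\<^sub>v n \<and> (z \<cdot>\<^sub>m 1\<^sub>m n - X) *\<^sub>v v = 0\<^sub>v n)"
      using X det_0_iff_vec_prod_zero[OF c] by (simp add: spec_def)
    also have "\<dots> \<longleftrightarrow> eigenvalue X z"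
    proof -
      have "(z \<cdot>\<^sub>m 1\<^sub>m n - X) *\<^sub>v v = 0\<^sub>v n \<longleftrightarrow> X *\<^sub>v v = z \<cdot>\<^sub>v v" if v: "v \<in> carrier_vec n" for v
      proof -
        have "(z \<cdot>\<^sub>m 1\<^sub>m n) *\<^sub>v v = z \<cdot>\<^sub>v v"
          using v by (auto simp: vec_eq_iff)
        hence "(z \<cdot>\<^sub>m 1\<^sub>m n - X) *\<^sub>v v = z \<cdot>\<^sub>v v - X *\<^sub>v v"
          using X v by (simp add: minus_mult_distrib_mat_vec[of _ n n])
        moreover have "z \<cdot>\<^sub>v v - X *\<^sub>v v = 0\<^sub>v n \<longleftrightarrow> X *\<^sub>v v = z \<cdot>\<^sub>v v"
        proof
          assume 0: "z \<cdot>\<^sub>v v - X *\<^sub>v v = 0\<^sub>v n"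
          show "X *\<^sub>v v = z \<cdot>\<^sub>v v"
          proof (rule eq_vecI)
            fix i assume i: "i < dim_vec (z \<cdot>\<^sub>v v)"
            have "(z \<cdot>\<^sub>v v - X *\<^sub>v v) $ i = 0\<^sub>v n $ i" by (simp only: 0)
            thus "(X *\<^sub>v v) $ i = (z \<cdot>\<^sub>v v) $ i" using i v X by simp
          qed (use X v in auto)
        qed (use X v in auto)
        ultimately show ?thesis by simp
      qed
      thus ?thesis using X unfolding eigenvalue_def eigenvector_def by auto
    qed
    finally show ?thesis .
  qed
  thus ?thesis using X unfolding eigenvalue_def eigenvector_def by auto
qed

lemma finite_spec:
  assumes X: "X \<in> carrier_mat n n" shows "finite (spec X)"
proof -
  have "spec X \<subseteq> {z. poly (char_poly X) z = 0}"
    using eigenvalue_root_char_poly[OF X] spec_eigenvalue[OF X] X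
    unfolding eigenvalue_def eigenvector_def by (metis (mono_tags, lifting) carrier_matD(1) mem_Collect_eq subsetI)
  moreover have "char_poly X \<noteq> 0" using degree_monic_char_poly[OF X] by auto
  ultimately show ?thesis using poly_roots_finite finite_subset by blast
qed

lemma det_holomorphic_on:
  assumes c: "\<And>z. A z \<in> carrier_mat n n"
    and h: "\<And>i j. i < n \<Longrightarrow> j < n \<Longrightarrow> (\<lambda>z. A z $$ (i,j)) holomorphic_on S"
  shows "(\<lambda>z. Determinant.det (A z)) holomorphic_on S"
proof -
  have e: "Determinant.det (A z) = (\<Sum>p | p permutes {0..<n}. of_int (sign p) * (\<Prod>i = 0..<n. A z $$ (i, p i)))" for z
    by (rule det_def'[OF c])
  show ?thesis unfolding e
    by (intro holomorphic_intros h) (auto dest: permutes_in_image)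
qed

lemma det_continuous_on:
  fixes A :: "'a::topological_space \<Rightarrow> complex mat"
  assumes c: "\<And>z. A z \<in> carrier_mat n n"
    and h: "\<And>i j. i < n \<Longrightarrow> j < n \<Longrightarrow> continuous_on S (\<lambda>z. A z $$ (i,j))"
  shows "continuous_on S (\<lambda>z. Determinant.det (A z))"
proof -
  have e: "Determinant.det (A z) = (\<Sum>p | p permutes {0..<n}. of_int (sign p) * (\<Prod>i = 0..<n. A z $$ (i, p i)))" for z
    by (rule det_def'[OF c])
  show ?thesis unfolding e
    by (intro continuous_intros h) (auto dest: permutes_in_image)
qed

lemma minv_holomorphic_on:
  assumes c: "\<And>z. A z \<in> carrier_mat n n"
    and h: "\<And>i j. i < n \<Longrightarrow> j < n \<Longrightarrow> (\<lambda>z. A z $$ (i,j)) holomorphic_on S"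
    and d: "\<And>z. z \<in> S \<Longrightarrow> Determinant.det (A z) \<noteq> 0" and ij: "i < n" "j < n"
  shows "(\<lambda>z. minv (A z) $$ (i,j)) holomorphic_on S"
proof -
  have 1: "mat_delete (A z) j i \<in> carrier_mat (n - 1) (n - 1)" for z using c by (metis mat_delete_carrier)
  have "(\<lambda>z. Determinant.det (mat_delete (A z) j i)) holomorphic_on S"
  proof (rule det_holomorphic_on[OF 1])
    fix k l assume kl: "k < n - 1" "l < n - 1"
    have "mat_delete (A z) j i $$ (k,l) = A z $$ (if k < j then k else Suc k, if l < i then l else Suc l)" for z
      unfolding mat_delete_def using kl c[of z] by auto
    thus "(\<lambda>z. mat_delete (A z) j i $$ (k,l)) holomorphic_on S" using h kl by simp
  qed
  hence "(\<lambda>z. 1 / Determinant.det (A z) * cofactor (A z) j i) holomorphic_on S"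
    unfolding cofactor_def by (intro holomorphic_intros det_holomorphic_on[OF c h]) (use d in auto)
  moreover have "minv (A z) $$ (i,j) = 1 / Determinant.det (A z) * cofactor (A z) j i" if "z \<in> S" for z
    using minv_adj_mat(1)[OF c d[OF that]] ij c[of z] by (simp add: adj_mat_def)
  ultimately show ?thesis using holomorphic_cong by (metis (no_types, lifting))
qed

text \<open>The parameter space is arbitrary because the perturbation argument needs joint
  continuity of the resolvent in the pair (t, z), which holomorphy in z for each fixed t does not
  give.\<close>

lemma minv_continuous_on:
  fixes A :: "'a::topological_space \<Rightarrow> complex mat"
  assumes c: "\<And>z. A z \<in> carrier_mat n n"
    and h: "\<And>i j. i < n \<Longrightarrow> j < n \<Longrightarrow> continuous_on S (\<lambda>z. A z $$ (i,j))"
    and d: "\<And>z. z \<in> S \<Longrightarrow> Determinant.det (A z) \<noteq> 0" and ij: "i < n" "j < n"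
  shows "continuous_on S (\<lambda>z. minv (A z) $$ (i,j))"
proof -
  have 1: "mat_delete (A z) j i \<in> carrier_mat (n - 1) (n - 1)" for z using c by (metis mat_delete_carrier)
  have "continuous_on S (\<lambda>z. Determinant.det (mat_delete (A z) j i))"
  proof (rule det_continuous_on[OF 1])
    fix k l assume kl: "k < n - 1" "l < n - 1"
    have "mat_delete (A z) j i $$ (k,l) = A z $$ (if k < j then k else Suc k, if l < i then l else Suc l)" for z
      unfolding mat_delete_def using kl c[of z] by auto
    thus "continuous_on S (\<lambda>z. mat_delete (A z) j i $$ (k,l))" using h kl by simp
  qed
  hence "continuous_on S (\<lambda>z. 1 / Determinant.det (A z) * cofactor (A z) j i)"
    unfolding cofactor_def by (intro continuous_intros det_continuous_on[OF c h]) (use d in auto)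
  moreover have "minv (A z) $$ (i,j) = 1 / Determinant.det (A z) * cofactor (A z) j i" if "z \<in> S" for z
    using minv_adj_mat(1)[OF c d[OF that]] ij c[of z] by (simp add: adj_mat_def)
  ultimately show ?thesis using continuous_on_cong by (metis (no_types, lifting))
qed

lemma resolv_holomorphic_on:
  assumes X: "X \<in> carrier_mat n n" and S: "S \<inter> spec X = {}" and ij: "i < n" "j < n"
  shows "(\<lambda>z. resolv X z $$ (i,j)) holomorphic_on S"
proof -
  have "(\<lambda>z. minv (z \<cdot>\<^sub>m 1\<^sub>m n - X) $$ (i,j)) holomorphic_on S"
  proof (rule minv_holomorphic_on[OF _ _ _ ij])
    fix i j assume ij: "i < n" "j < n"
    have "(z \<cdot>\<^sub>m 1\<^sub>m n - X) $$ (i,j) = (if i = j then z else 0) - X $$ (i,j)" for z using X ij by auto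
    thus "(\<lambda>z. (z \<cdot>\<^sub>m 1\<^sub>m n - X) $$ (i,j)) holomorphic_on S" by (cases "i = j") (auto intro!: holomorphic_intros)
  qed (use X S in \<open>auto simp: spec_def\<close>)
  thus ?thesis using X by (simp add: resolv_def)
qed

section \<open>Independence of the functional calculus from the contour\<close>

definition encloses :: "(real \<Rightarrow> complex) \<Rightarrow> complex mat \<Rightarrow> bool" where
  "encloses \<gamma> X \<longleftrightarrow> valid_path \<gamma> \<and> pathfinish \<gamma> = pathstart \<gamma> \<and>
     path_image \<gamma> \<subseteq> slit - spec X \<and> (\<forall>z \<in> spec X. winding_number \<gamma> z = 1)"

lemma encloses_exists:
  assumes "X \<in> carrier_mat n n" "spec X \<subseteq> slit"
  obtains \<gamma> where "encloses \<gamma> X"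
proof -
  have "compact (spec X)" using finite_spec[OF assms(1)] by (rule finite_imp_compact)
  from contour_exists[OF this assms(2)] show ?thesis using that unfolding encloses_def by metis
qed

text \<open>All winding numbers about the spectrum are 1, so the right-hand side no longer mentions
  \<gamma>. Hence the contour chosen inside \<open>mfun\<close> may be exchanged for any other
  enclosing one.\<close>

lemma contour_integral_residues:
  assumes X: "X \<in> carrier_mat n n" "spec X \<subseteq> slit" and \<gamma>: "encloses \<gamma> X"
    and F: "F holomorphic_on slit - spec X"
  shows "contour_integral \<gamma> F = 2 * pi * \<i> * (\<Sum>p\<in>spec X. residue F p)"
proof -
  have "contour_integral \<gamma> F = 2 * pi * \<i> * (\<Sum>p\<in>spec X. winding_number \<gamma> p * residue F p)"
    using \<gamma> F winding_slit_outside X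
    by (intro Residue_theorem[of slit]) (auto simp: encloses_def finite_spec starlike_slit starlike_imp_connected)
  also have "(\<Sum>p\<in>spec X. winding_number \<gamma> p * residue F p) = (\<Sum>p\<in>spec X. residue F p)"
    using \<gamma> by (intro sum.cong) (auto simp: encloses_def)
  finally show ?thesis .
qed

lemma mfun_entry:
  assumes X: "X \<in> carrier_mat n n" "spec X \<subseteq> slit" and \<gamma>: "encloses \<gamma> X"
    and f: "f holomorphic_on slit" and ij: "i < n" "j < n"
  shows "mfun f X $$ (i,j) = contour_integral \<gamma> (\<lambda>z. f z * resolv X z $$ (i,j)) / (2 * pi * \<i>)"
proof -
  define \<gamma>' where "\<gamma>' = (SOME \<gamma>. valid_path \<gamma> \<and> pathfinish \<gamma> = pathstart \<gamma> \<and>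
                     path_image \<gamma> \<subseteq> slit - spec X \<and>
                     (\<forall>z \<in> spec X. winding_number \<gamma> z = 1))"
  have e: "\<gamma>' = (SOME \<gamma>. encloses \<gamma> X)" unfolding \<gamma>'_def encloses_def ..
  have \<gamma>': "encloses \<gamma>' X" unfolding e by (rule someI[of "\<lambda>\<gamma>. encloses \<gamma> X", OF \<gamma>])
  have F: "(\<lambda>z. f z * resolv X z $$ (i,j)) holomorphic_on slit - spec X"
    by (intro holomorphic_intros resolv_holomorphic_on[OF X(1) _ ij] holomorphic_on_subset[OF f]) auto
  have "mfun f X $$ (i,j) = contour_integral \<gamma>' (\<lambda>z. f z * resolv X z $$ (i,j)) / (2 * pi * \<i>)"
    using X ij unfolding mfun_def Let_def resolv_def \<gamma>'_def by simp
  thus ?thesis unfolding contour_integral_residues[OF X \<gamma>' F] contour_integral_residues[OF X \<gamma> F] .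
qed

lemma mfun_carrier [simp]: "X \<in> carrier_mat n n \<Longrightarrow> mfun f X \<in> carrier_mat n n"
  unfolding mfun_def Let_def by auto

section \<open>The holomorphic functional calculus\<close>

lemma mfun_dim [simp]: "dim_row (mfun f X) = dim_row X" "dim_col (mfun f X) = dim_row X"
  unfolding mfun_def Let_def by auto

text \<open>The length-type bound on the contour integral refers to the supremum over an open set
  containing the path. Thickening the path by small closed balls gives a compact set inside
  \<open>U\<close> with such an open set in it, and uniform convergence there is enough.\<close>

lemma contour_integral_locally_uniform_limit:
  assumes U: "open U" and \<gamma>: "valid_path \<gamma>" "path_image \<gamma> \<subseteq> U"
    and F: "\<And>N. F N holomorphic_on U" "G holomorphic_on U"
    and lim: "\<And>K. compact K \<Longrightarrow> K \<subseteq> U \<Longrightarrow> uniform_limit K F G sequentially"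
  shows "(\<lambda>N. contour_integral \<gamma> (F N)) \<longlonglongrightarrow> contour_integral \<gamma> G"
proof -
  obtain e where e: "e > 0" "(\<Union>x\<in>path_image \<gamma>. cball x e) \<subseteq> U"
    using compact_subset_open_imp_cball_epsilon_subset[OF compact_valid_path_image[OF \<gamma>(1)] U \<gamma>(2)] by blast
  define K where "K = (\<Union>x\<in>path_image \<gamma>. cball x e)"
  define S where "S = (\<Union>x\<in>path_image \<gamma>. ball x e)"
  have K: "compact K" unfolding K_def
    by (rule compact_minkowski_sum_cball[OF compact_valid_path_image[OF \<gamma>(1)]])
  have S: "open S" "S \<subseteq> K" "path_image \<gamma> \<subseteq> S" using e unfolding S_def K_def by auto
  obtain L where L: "L > 0"
    "\<forall>f B. f holomorphic_on S \<and> (\<forall>z\<in>S. cmod (f z) \<le> B) \<longrightarrow> cmod (contour_integral \<gamma> f) \<le> L * B"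
    using contour_integral_bound_exists[OF S(1) \<gamma>(1) S(3)] by (elim exE conjE)
  have int: "H contour_integrable_on \<gamma>" if "H holomorphic_on U" for H
    by (rule contour_integrable_holomorphic_simple[OF that U \<gamma>])
  have KU: "K \<subseteq> U" using e(2) unfolding K_def .
  show ?thesis
  proof (rule LIMSEQ_I)
    fix r :: real assume r: "r > 0"
    have "\<forall>\<^sub>F N in sequentially. \<forall>x\<in>K. dist (F N x) (G x) < r / (2 * L)"
      using uniform_limitD[OF lim[OF K KU]] r L(1) by simp
    then obtain N0 where N0: "\<And>N x. N \<ge> N0 \<Longrightarrow> x \<in> K \<Longrightarrow> dist (F N x) (G x) < r / (2 * L)"
      unfolding eventually_sequentially by blast
    show "\<exists>no. \<forall>n\<ge>no. norm (contour_integral \<gamma> (F n) - contour_integral \<gamma> G) < r"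
    proof (intro exI allI impI)
      fix N assume N: "N \<ge> N0"
      have "contour_integral \<gamma> (F N) - contour_integral \<gamma> G = contour_integral \<gamma> (\<lambda>z. F N z - G z)"
        by (rule contour_integral_diff[symmetric]) (intro int F)+
      also have "cmod \<dots> \<le> L * (r / (2 * L))"
      proof -
        have SU: "S \<subseteq> U" using S KU by blast
        have "(\<lambda>z. F N z - G z) holomorphic_on S"
          by (intro holomorphic_intros holomorphic_on_subset[OF F(1) SU] holomorphic_on_subset[OF F(2) SU])
        moreover have "\<forall>z\<in>S. cmod (F N z - G z) \<le> r / (2 * L)"
        proof
          fix z assume "z \<in> S"
          hence "z \<in> K" using S(2) by blast
          from N0[OF N this] show "cmod (F N z - G z) \<le> r / (2 * L)" by (simp add: dist_norm)
        qed
        ultimately show ?thesis using L(2) by blast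
      qed
      also have "\<dots> < r" using r L(1) by simp
      finally show "norm (contour_integral \<gamma> (F N) - contour_integral \<gamma> G) < r" .
    qed
  qed
qed

lemma uniform_limit_mult_right_compact:
  fixes F :: "nat \<Rightarrow> complex \<Rightarrow> complex"
  assumes "uniform_limit K F f sequentially" "compact K" "continuous_on K f" "continuous_on K g"
  shows "uniform_limit K (\<lambda>N z. F N z * g z) (\<lambda>z. f z * g z) sequentially"
proof (rule uniform_lim_mult[OF assms(1) uniform_limit_const])
  show "bounded (f ` K)" "bounded (g ` K)"
    by (intro compact_imp_bounded compact_continuous_image assms)+
qed

context
  fixes X :: "complex mat" and n :: nat
  assumes X: "X \<in> carrier_mat n n" and sX: "spec X \<subseteq> slit"
begin

lemma resolv_hol_slit: "i < n \<Longrightarrow> j < n \<Longrightarrow> (\<lambda>z. resolv X z $$ (i,j)) holomorphic_on slit - spec X"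
  by (rule resolv_holomorphic_on[OF X]) auto

lemma open_slit_spec: "open (slit - spec X)"
  using finite_spec[OF X] by (intro open_Diff open_slit finite_imp_closed)

lemma integrable_slit_spec:
  "encloses \<gamma> X \<Longrightarrow> F holomorphic_on slit - spec X \<Longrightarrow> F contour_integrable_on \<gamma>"
  using contour_integrable_holomorphic_simple[OF _ open_slit_spec] by (auto simp: encloses_def)

lemma mfun_integrand_hol:
  "f holomorphic_on slit \<Longrightarrow> i < n \<Longrightarrow> j < n \<Longrightarrow> (\<lambda>z. f z * resolv X z $$ (i,j)) holomorphic_on slit - spec X"
  by (intro holomorphic_intros resolv_hol_slit) (auto intro: holomorphic_on_subset)

text \<open>An enclosing contour runs inside the slit plane, so only the values of f there can
  enter.\<close>

lemma mfun_cong: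
  assumes "\<And>z. z \<in> slit \<Longrightarrow> f z = g z" "f holomorphic_on slit"
  shows "mfun f X = mfun g X"
proof -
  obtain \<gamma> where \<gamma>: "encloses \<gamma> X" using encloses_exists[OF X sX] .
  have g: "g holomorphic_on slit" using assms holomorphic_cong by blast
  show ?thesis
  proof (rule eq_matI)
    fix i j assume "i < dim_row (mfun g X)" "j < dim_col (mfun g X)"
    hence ij: "i < n" "j < n" using mfun_carrier[OF X, of g] by auto
    show "mfun f X $$ (i,j) = mfun g X $$ (i,j)"
      unfolding mfun_entry[OF X sX \<gamma> g ij] mfun_entry[OF X sX \<gamma> assms(2) ij]
      using \<gamma> assms(1) by (intro arg_cong2[of _ _ _ _ "(/)"] contour_integral_eq) (auto simp: encloses_def)
  qed (use mfun_carrier[OF X, of f] mfun_carrier[OF X, of g] in auto)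
qed

lemma mfun_sum:
  assumes h: "\<And>k. k \<in> J \<Longrightarrow> h k holomorphic_on slit" and J: "finite J" and ij: "i < n" "j < n"
  shows "mfun (\<lambda>z. \<Sum>k\<in>J. w k * h k z) X $$ (i,j) = (\<Sum>k\<in>J. w k * mfun (h k) X $$ (i,j))"
proof -
  obtain \<gamma> where \<gamma>: "encloses \<gamma> X" using encloses_exists[OF X sX] .
  have 1: "(\<lambda>z. \<Sum>k\<in>J. w k * h k z) holomorphic_on slit" by (intro holomorphic_intros h)
  have i: "(\<lambda>z. h k z * resolv X z $$ (i,j)) contour_integrable_on \<gamma>" if "k \<in> J" for k
    by (rule integrable_slit_spec[OF \<gamma> mfun_integrand_hol[OF h[OF that] ij]])
  have "contour_integral \<gamma> (\<lambda>z. (\<Sum>k\<in>J. w k * h k z) * resolv X z $$ (i,j)) =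
      contour_integral \<gamma> (\<lambda>z. \<Sum>k\<in>J. w k * (h k z * resolv X z $$ (i,j)))"
    by (simp add: sum_distrib_right mult.assoc)
  also have "\<dots> = (\<Sum>k\<in>J. contour_integral \<gamma> (\<lambda>z. w k * (h k z * resolv X z $$ (i,j))))"
    using i by (intro contour_integral_sum J contour_integrable_lmul)
  also have "\<dots> = (\<Sum>k\<in>J. w k * contour_integral \<gamma> (\<lambda>z. h k z * resolv X z $$ (i,j)))"
    using i by (intro sum.cong contour_integral_lmul) auto
  finally show ?thesis unfolding mfun_entry[OF X sX \<gamma> 1 ij]
    by (simp add: mfun_entry[OF X sX \<gamma> h ij] sum_divide_distrib)
qed

lemma mfun_limit:
  assumes F: "\<And>N. F N holomorphic_on slit" "f holomorphic_on slit"
    and lim: "\<And>K. compact K \<Longrightarrow> K \<subseteq> slit \<Longrightarrow> uniform_limit K F f sequentially"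
    and ij: "i < n" "j < n"
  shows "(\<lambda>N. mfun (F N) X $$ (i,j)) \<longlonglongrightarrow> mfun f X $$ (i,j)"
proof -
  obtain \<gamma> where \<gamma>: "encloses \<gamma> X" using encloses_exists[OF X sX] .
  show ?thesis unfolding mfun_entry[OF X sX \<gamma> F(1) ij] mfun_entry[OF X sX \<gamma> F(2) ij]
  proof (intro tendsto_divide tendsto_const contour_integral_locally_uniform_limit[OF open_slit_spec])
    show "valid_path \<gamma>" "path_image \<gamma> \<subseteq> slit - spec X" using \<gamma> by (auto simp: encloses_def)
    show "(\<lambda>z. F N z * resolv X z $$ (i,j)) holomorphic_on slit - spec X" for N
      by (rule mfun_integrand_hol[OF F(1) ij])
    show "(\<lambda>z. f z * resolv X z $$ (i,j)) holomorphic_on slit - spec X"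
      by (rule mfun_integrand_hol[OF F(2) ij])
    fix K assume K: "compact K" "K \<subseteq> slit - spec X"
    have cf: "continuous_on K f" using F(2) K holomorphic_on_imp_continuous_on holomorphic_on_subset by blast
    have cr: "continuous_on K (\<lambda>z. resolv X z $$ (i,j))"
      using resolv_hol_slit[OF ij] K holomorphic_on_imp_continuous_on holomorphic_on_subset by blast
    show "uniform_limit K (\<lambda>N z. F N z * resolv X z $$ (i,j)) (\<lambda>z. f z * resolv X z $$ (i,j)) sequentially"
      by (rule uniform_limit_mult_right_compact[OF lim K(1) cf cr]) (use K in auto)
  qed simp
qed

text \<open>The identity z R(z) = 1 + X R(z) in entries. It serves to pull a factor z out of the
  calculus and to control the resolvent at infinity.\<close>

lemma resolv_times_var:
  assumes z: "z \<notin> spec X" and ij: "i < n" "j < n"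
  shows "z * resolv X z $$ (i,j) = (if i = j then 1 else 0) + (\<Sum>k<n. X $$ (i,k) * resolv X z $$ (k,j))"
proof -
  note r = resolv_props[OF X z]
  have e: "(z \<cdot>\<^sub>m 1\<^sub>m n - X) * resolv X z = z \<cdot>\<^sub>m resolv X z - X * resolv X z"
  proof -
    have "(z \<cdot>\<^sub>m 1\<^sub>m n - X) * resolv X z = (z \<cdot>\<^sub>m 1\<^sub>m n) * resolv X z - X * resolv X z"
      by (rule minus_mult_distrib_mat[OF _ X r(1)]) simp
    also have "(z \<cdot>\<^sub>m 1\<^sub>m n) * resolv X z = z \<cdot>\<^sub>m (1\<^sub>m n * resolv X z)"
      by (rule mult_smult_assoc_mat[OF one_carrier_mat r(1)])
    finally show ?thesis using r(1) by simp
  qed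
  have "(z \<cdot>\<^sub>m resolv X z - X * resolv X z) $$ (i,j) = 1\<^sub>m n $$ (i,j)" using r(2) unfolding e by simp
  moreover have "(X * resolv X z) $$ (i,j) = (\<Sum>k<n. X $$ (i,k) * resolv X z $$ (k,j))"
    using X r(1) ij by (simp add: scalar_prod_def lessThan_atLeast0)
  ultimately have "z * resolv X z $$ (i,j) - (\<Sum>k<n. X $$ (i,k) * resolv X z $$ (k,j)) = (if i = j then 1 else 0)"
    using X r(1) ij by simp
  thus ?thesis by (simp only: diff_eq_eq)
qed

text \<open>Substituting z R(z) = 1 + X R(z) under the integral leaves X f(X) plus the integral of f
  itself, which vanishes by Cauchy's theorem in the starlike slit plane.\<close>

lemma mfun_times_var:
  assumes f: "f holomorphic_on slit"
  shows "mfun (\<lambda>z. z * f z) X = X * mfun f X"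
proof -
  obtain \<gamma> where \<gamma>: "encloses \<gamma> X" using encloses_exists[OF X sX] .
  have f1: "(\<lambda>z. z * f z) holomorphic_on slit" by (intro holomorphic_intros f)
  note c = mfun_carrier[OF X]
  have 0: "(f has_contour_integral 0) \<gamma>"
    using \<gamma> by (intro Cauchy_theorem_starlike_simple[OF open_slit starlike_slit f]) (auto simp: encloses_def)
  show ?thesis
  proof (rule eq_matI)
    fix i j assume "i < dim_row (X * mfun f X)" "j < dim_col (X * mfun f X)"
    hence ij: "i < n" "j < n" using c[of f] X by auto
    have int: "(\<lambda>z. X $$ (i,k) * (f z * resolv X z $$ (k,j))) contour_integrable_on \<gamma>" if "k < n" for k
      by (intro contour_integrable_lmul integrable_slit_spec[OF \<gamma>] mfun_integrand_hol f ij that)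
    have "contour_integral \<gamma> (\<lambda>z. z * f z * resolv X z $$ (i,j)) =
       contour_integral \<gamma> (\<lambda>z. (if i = j then 1 else 0) * f z + (\<Sum>k<n. X $$ (i,k) * (f z * resolv X z $$ (k,j))))"
    proof (rule contour_integral_eq)
      fix z assume "z \<in> path_image \<gamma>"
      hence z: "z \<notin> spec X" using \<gamma> by (auto simp: encloses_def)
      have "z * f z * resolv X z $$ (i,j) = f z * (z * resolv X z $$ (i,j))" by simp
      also have "\<dots> = (if i = j then 1 else 0) * f z + (\<Sum>k<n. X $$ (i,k) * (f z * resolv X z $$ (k,j)))"
        unfolding resolv_times_var[OF z ij] by (simp add: algebra_simps sum_distrib_left)
      finally show "z * f z * resolv X z $$ (i,j) = \<dots>" .
    qed
    also have "\<dots> = contour_integral \<gamma> (\<lambda>z. (if i = j then 1 else 0) * f z) +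
        contour_integral \<gamma> (\<lambda>z. \<Sum>k<n. X $$ (i,k) * (f z * resolv X z $$ (k,j)))"
      by (intro contour_integral_add contour_integrable_sum int contour_integrable_lmul
          has_contour_integral_integrable[OF 0]) auto
    also have "contour_integral \<gamma> (\<lambda>z. (if i = j then 1 else 0) * f z) = 0"
      using contour_integral_unique[OF 0] by simp
    also have "contour_integral \<gamma> (\<lambda>z. \<Sum>k<n. X $$ (i,k) * (f z * resolv X z $$ (k,j))) =
        (\<Sum>k<n. X $$ (i,k) * contour_integral \<gamma> (\<lambda>z. f z * resolv X z $$ (k,j)))"
    proof -
      have "contour_integral \<gamma> (\<lambda>z. \<Sum>k<n. X $$ (i,k) * (f z * resolv X z $$ (k,j))) =
         (\<Sum>k<n. contour_integral \<gamma> (\<lambda>z. X $$ (i,k) * (f z * resolv X z $$ (k,j))))"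
        by (intro contour_integral_sum int) auto
      also have "\<dots> = (\<Sum>k<n. X $$ (i,k) * contour_integral \<gamma> (\<lambda>z. f z * resolv X z $$ (k,j)))"
      proof (rule sum.cong[OF refl])
        fix k assume "k \<in> {..<n}"
        hence k: "k < n" by simp
        show "contour_integral \<gamma> (\<lambda>z. X $$ (i,k) * (f z * resolv X z $$ (k,j))) =
          X $$ (i,k) * contour_integral \<gamma> (\<lambda>z. f z * resolv X z $$ (k,j))"
          by (rule contour_integral_lmul[OF integrable_slit_spec[OF \<gamma> mfun_integrand_hol[OF f k ij(2)]]])
      qed
      finally show ?thesis .
    qed
    finally have e: "contour_integral \<gamma> (\<lambda>z. z * f z * resolv X z $$ (i,j)) =
        (\<Sum>k<n. X $$ (i,k) * contour_integral \<gamma> (\<lambda>z. f z * resolv X z $$ (k,j)))" by simp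
    have "(X * mfun f X) $$ (i,j) = (\<Sum>k<n. X $$ (i,k) * mfun f X $$ (k,j))"
      using X c[of f] ij by (simp add: scalar_prod_def lessThan_atLeast0)
    also have "\<dots> = (\<Sum>k<n. X $$ (i,k) * (contour_integral \<gamma> (\<lambda>z. f z * resolv X z $$ (k,j)) / (2 * pi * \<i>)))"
      by (intro sum.cong) (auto simp: mfun_entry[OF X sX \<gamma> f _ ij(2)])
    also have "\<dots> = mfun (\<lambda>z. z * f z) X $$ (i,j)"
      unfolding mfun_entry[OF X sX \<gamma> f1 ij] e by (simp add: sum_divide_distrib)
    finally show "mfun (\<lambda>z. z * f z) X $$ (i,j) = (X * mfun f X) $$ (i,j)" ..
  qed (use X in auto)
qed

text \<open>Summing |z R(z)| = |1 + X R(z)| down a column gives |z| \<rho> \<le> n + n b \<rho> for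
  the column sum \<rho>. For |z| \<ge> 2 n b the last term is absorbed into half of the left-hand
  side.\<close>

lemma resolv_entry_bound:
  "\<exists>R0>0. \<exists>c>0. \<forall>z i j. cmod z \<ge> R0 \<longrightarrow> z \<notin> spec X \<longrightarrow> i < n \<longrightarrow> j < n \<longrightarrow> cmod (resolv X z $$ (i,j)) \<le> c / cmod z"
proof -
  define b where "b = (\<Sum>i<n. \<Sum>k<n. cmod (X $$ (i,k)))"
  have b0: "b \<ge> 0" unfolding b_def by (intro sum_nonneg) auto
  have Xb: "cmod (X $$ (i,k)) \<le> b" if "i < n" "k < n" for i k
  proof -
    have "cmod (X $$ (i,k)) \<le> (\<Sum>k<n. cmod (X $$ (i,k)))" using that by (intro member_le_sum) auto
    also have "\<dots> \<le> b" unfolding b_def using that by (intro member_le_sum[of i "{..<n}" "\<lambda>i. \<Sum>k<n. cmod (X $$ (i,k))"] sum_nonneg) auto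
    finally show ?thesis .
  qed
  define R0 where "R0 = 2 * real n * b + 1"
  have R0: "R0 > 0" unfolding R0_def using b0 by (simp add: add_nonneg_pos)
  have "cmod (resolv X z $$ (i,j)) \<le> (2 * real n + 1) / cmod z"
    if z: "cmod z \<ge> R0" "z \<notin> spec X" and ij: "i < n" "j < n" for z i j
  proof -
    define \<rho> where "\<rho> = (\<Sum>i<n. cmod (resolv X z $$ (i,j)))"
    have \<rho>0: "\<rho> \<ge> 0" unfolding \<rho>_def by (intro sum_nonneg) auto
    have "cmod z * \<rho> = (\<Sum>i<n. cmod (z * resolv X z $$ (i,j)))"
      by (simp add: \<rho>_def sum_distrib_left norm_mult)
    also have "\<dots> \<le> (\<Sum>i<n. 1 + b * \<rho>)"
    proof (rule sum_mono)
      fix i assume "i \<in> {..<n}"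
      hence i: "i < n" by simp
      have "cmod (z * resolv X z $$ (i,j)) \<le> cmod (if i = j then 1 else 0) + cmod (\<Sum>k<n. X $$ (i,k) * resolv X z $$ (k,j))"
        unfolding resolv_times_var[OF z(2) i ij(2)] by (rule norm_triangle_ineq)
      also have "\<dots> \<le> 1 + (\<Sum>k<n. b * cmod (resolv X z $$ (k,j)))"
        by (intro add_mono sum_norm_le) (auto simp: norm_mult intro!: mult_right_mono Xb i)
      also have "\<dots> = 1 + b * \<rho>" by (simp add: \<rho>_def sum_distrib_left)
      finally show "cmod (z * resolv X z $$ (i,j)) \<le> 1 + b * \<rho>" .
    qed
    also have "\<dots> = n + n * b * \<rho>" by (simp add: algebra_simps)
    finally have "cmod z * \<rho> \<le> n + n * b * \<rho>" .
    moreover have "n * b * \<rho> \<le> (cmod z / 2) * \<rho>" using z(1) b0 \<rho>0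
      by (intro mult_right_mono) (auto simp: R0_def)
    ultimately have "cmod z * \<rho> \<le> 2 * n" by linarith
    moreover have "cmod z > 0" using z(1) R0 by linarith
    ultimately have "\<rho> \<le> 2 * n / cmod z" by (simp add: field_simps)
    moreover have "cmod (resolv X z $$ (i,j)) \<le> \<rho>" unfolding \<rho>_def using ij
      by (intro member_le_sum[of i "{..<n}" "\<lambda>i. cmod (resolv X z $$ (i,j))"]) auto
    moreover have "2 * n / cmod z \<le> (2 * real n + 1) / cmod z" by (intro divide_right_mono) auto
    ultimately show ?thesis by linarith
  qed
  \<comment> \<open>The summand 1 keeps the constant positive when n = 0; the same holds for
    \<open>R0\<close>.\<close>
  moreover have "2 * real n + 1 > 0" by simp
  ultimately show ?thesis using R0 by blast
qed

text \<open>The contour is blown up to a large circle, where the resolvent is close to the inverse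
  of the variable.\<close>
lemma mfun_one: "mfun (\<lambda>_. 1) X = 1\<^sub>m n"
proof (rule eq_matI)
  fix i j assume "i < dim_row (1\<^sub>m n)" "j < dim_col (1\<^sub>m n)"
  hence ij: "i < n" "j < n" by auto
  obtain \<gamma> where \<gamma>: "encloses \<gamma> X" using encloses_exists[OF X sX] .
  have hol: "(\<lambda>z. resolv X z $$ (i,j)) holomorphic_on slit - spec X" by (rule resolv_hol_slit[OF ij])
  define I where "I = (\<Sum>p\<in>spec X. residue (\<lambda>z. resolv X z $$ (i,j)) p)"
  define d :: complex where "d = (if i = j then 1 else 0)"
  have e1: "mfun (\<lambda>_. 1) X $$ (i,j) = I"
    using contour_integral_residues[OF X sX \<gamma> hol]
    by (subst mfun_entry[OF X sX \<gamma> _ ij]) (auto simp: I_def)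
  obtain R0 c where R0: "R0 > 0" "c > 0"
    "\<And>z i j. cmod z \<ge> R0 \<Longrightarrow> z \<notin> spec X \<Longrightarrow> i < n \<Longrightarrow> j < n \<Longrightarrow> cmod (resolv X z $$ (i,j)) \<le> c / cmod z"
    using resolv_entry_bound by blast
  obtain b where b: "b > 0" "\<And>z. z \<in> spec X \<Longrightarrow> cmod z \<le> b"
    using finite_imp_bounded[OF finite_spec[OF X]] unfolding bounded_pos by blast
  define C where "C = (\<Sum>k<n. cmod (X $$ (i,k)) * c)"
  have C0: "C \<ge> 0" unfolding C_def using R0 by (intro sum_nonneg) auto
  have bd: "cmod (I - d) \<le> C / R" if R: "R > R0" "R > b" for R
  proof -
    have R': "R > 0" using R R0 by linarith
    have sph: "z \<notin> spec X" if "cmod z = R" for z using that b(2)[of z] R by auto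
    have ci: "contour_integral (circlepath 0 R) (\<lambda>z. resolv X z $$ (i,j)) =
       2 * pi * \<i> * (\<Sum>p\<in>spec X. winding_number (circlepath 0 R) p * residue (\<lambda>z. resolv X z $$ (i,j)) p)"
      using finite_spec[OF X] resolv_holomorphic_on[OF X _ ij, of "UNIV - spec X"] sph R'
      by (intro Residue_theorem[of UNIV]) auto
    have "winding_number (circlepath 0 R) p = 1" if "p \<in> spec X" for p
      using b(2)[OF that] R by (intro winding_number_circlepath) auto
    hence ci: "contour_integral (circlepath 0 R) (\<lambda>z. resolv X z $$ (i,j)) = 2 * pi * \<i> * I"
      unfolding ci I_def by (auto intro!: sum.cong)
    \<comment> \<open>The origin is removed too, since the resolvent entry is going to be compared
      with d / z.\<close>
    define U where "U = - spec X - {0 :: complex}"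
    have U: "open U" unfolding U_def using finite_spec[OF X] by (intro open_Diff open_Compl finite_imp_closed) auto
    have pU: "path_image (circlepath 0 R) \<subseteq> U" using sph R' by (auto simp: U_def)
    have h: "(\<lambda>z. resolv X z $$ (i,j)) holomorphic_on U" unfolding U_def
      by (rule resolv_holomorphic_on[OF X _ ij]) auto
    have i1: "((\<lambda>z. resolv X z $$ (i,j)) has_contour_integral 2 * pi * \<i> * I) (circlepath 0 R)"
      using has_contour_integral_integral[OF contour_integrable_holomorphic_simple[OF h U _ pU]] ci by simp
    have i2: "((\<lambda>z. d / z) has_contour_integral 2 * pi * \<i> * d) (circlepath 0 R)"
      using Cauchy_integral_circlepath_simple[of "\<lambda>_. d" 0 R 0] R' by simp
    have "cmod (2 * pi * \<i> * I - 2 * pi * \<i> * d) \<le> (C / R / R) * (2 * pi * R)"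
    proof (rule has_contour_integral_bound_circlepath[OF has_contour_integral_diff[OF i1 i2]])
      show "0 \<le> C / R / R" using C0 R' by simp
      fix z assume "cmod (z - 0) = R"
      hence z: "cmod z = R" "z \<noteq> 0" using R' by auto
      \<comment> \<open>Multiplied by z, the difference equals an entry of X R(z), which is O(1/R).
        The integrand is thus O(1/R^2) on a circle of length 2 \<pi> R, and the integral is O(1/R)
        while \<open>I - d\<close> does not depend on R.\<close>
      have "z * (resolv X z $$ (i,j) - d / z) = (\<Sum>k<n. X $$ (i,k) * resolv X z $$ (k,j))"
        using resolv_times_var[OF sph[OF z(1)] ij] z(2) by (simp add: d_def algebra_simps)
      hence "R * cmod (resolv X z $$ (i,j) - d / z) = cmod (\<Sum>k<n. X $$ (i,k) * resolv X z $$ (k,j))"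
        using z(1) by (metis norm_mult)
      also have "\<dots> \<le> (\<Sum>k<n. cmod (X $$ (i,k)) * (c / R))"
        unfolding z(1)[symmetric] using R z(1) R0(3)[OF _ sph[OF z(1)] _ ij(2)]
        by (intro sum_norm_le) (auto simp: norm_mult simp flip: times_divide_eq_right intro!: mult_left_mono)
      also have "\<dots> = C / R" by (simp add: C_def sum_divide_distrib)
      finally show "cmod (resolv X z $$ (i,j) - d / z) \<le> C / R / R"
        using R' by (simp add: field_simps)
    qed (use R' in auto)
    also have "2 * pi * \<i> * I - 2 * pi * \<i> * d = (2 * pi * \<i>) * (I - d)" by (simp add: algebra_simps)
    finally have "2 * pi * cmod (I - d) \<le> (C / R / R) * (2 * pi * R)" by (simp add: norm_mult)
    thus ?thesis using R' by (simp add: field_simps)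
  qed
  have "I - d = 0"
  proof (rule ccontr)
    assume ne: "I - d \<noteq> 0"
    define R where "R = max R0 b + 1 + C / cmod (I - d)"
    have p: "C / cmod (I - d) \<ge> 0" using C0 by simp
    have R: "R > R0" "R > b" "R > C / cmod (I - d)" using p R0 unfolding R_def by (auto simp: max_def)
    have "cmod (I - d) \<le> C / R" by (rule bd[OF R(1,2)])
    hence "R * cmod (I - d) \<le> C" using R R0 by (simp add: field_simps)
    moreover have "R * cmod (I - d) > C" using R(3) ne by (simp add: field_simps)
    ultimately show False by linarith
  qed
  thus "mfun (\<lambda>_. 1) X $$ (i,j) = 1\<^sub>m n $$ (i,j)" using e1 ij by (simp add: d_def)
qed (use X in auto)

end

section \<open>Weighted harmonic means of 1 and z\<close>

lemma mfun_lincomb: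
  assumes X: "X \<in> carrier_mat n n" "spec X \<subseteq> slit"
    and fg: "f holomorphic_on slit" "g holomorphic_on slit"
  shows "mfun (\<lambda>z. a * f z + b * g z) X = a \<cdot>\<^sub>m mfun f X + b \<cdot>\<^sub>m mfun g X"
proof (rule eq_matI)
  fix i j assume "i < dim_row (a \<cdot>\<^sub>m mfun f X + b \<cdot>\<^sub>m mfun g X)" "j < dim_col (a \<cdot>\<^sub>m mfun f X + b \<cdot>\<^sub>m mfun g X)"
  hence ij: "i < n" "j < n" using X by auto
  define h where "h = (\<lambda>k::bool. if k then f else g)"
  define w where "w = (\<lambda>k::bool. if k then a else b)"
  have "mfun (\<lambda>z. \<Sum>k\<in>UNIV. w k * h k z) X $$ (i,j) = (\<Sum>k\<in>UNIV. w k * mfun (h k) X $$ (i,j))"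
    by (rule mfun_sum[OF X _ _ ij]) (auto simp: h_def fg)
  thus "mfun (\<lambda>z. a * f z + b * g z) X $$ (i,j) = (a \<cdot>\<^sub>m mfun f X + b \<cdot>\<^sub>m mfun g X) $$ (i,j)"
    using ij X by (simp add: UNIV_bool h_def w_def add.commute)
qed (use X in auto)

lemma mult_mat_entry:
  assumes "A \<in> carrier_mat l m" "B \<in> carrier_mat m p" "i < l" "j < p"
  shows "(A * B) $$ (i,j) = (\<Sum>k<m. A $$ (i,k) * B $$ (k,j))"
  using assms by (simp add: scalar_prod_def lessThan_atLeast0)

text \<open>Representing function of the harmonic mean, with \<open>s\<close> the weight of the
  first argument: \<open>s = 1\<close> gives the constant 1 and \<open>s = 0\<close> gives
  z.\<close>

definition wharm :: "real \<Rightarrow> complex \<Rightarrow> complex" where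
  "wharm s z = z / (of_real s * z + of_real (1 - s))"

lemma harm_denom_nonzero:
  assumes "z \<in> slit" "0 \<le> s" "s \<le> 1" shows "of_real s * z + of_real (1 - s) \<noteq> (0::complex)"
proof
  assume e: "of_real s * z + of_real (1 - s) = (0::complex)"
  show False
  proof (cases "s = 0")
    case False
    hence "z = of_real (- (1 - s) / s)" using e by (simp add: field_simps add_eq_0_iff2)
    moreover have "- (1 - s) / s \<le> 0" using assms by (simp add: divide_nonpos_nonneg)
    ultimately show False using assms(1) by (simp del: of_real_divide of_real_minus of_real_diff)
  qed (use e in auto)
qed

lemma holomorphic_harm_recip:
  "0 \<le> s \<Longrightarrow> s \<le> 1 \<Longrightarrow> (\<lambda>z. 1 / (of_real s * z + of_real (1 - s))) holomorphic_on slit"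
  using harm_denom_nonzero by (intro holomorphic_intros) auto

lemma holomorphic_harm: "0 \<le> s \<Longrightarrow> s \<le> 1 \<Longrightarrow> wharm s holomorphic_on slit"
  unfolding wharm_def[abs_def] using harm_denom_nonzero by (intro holomorphic_intros) auto

text \<open>At this stage the calculus is known to be linear, to send 1 to the identity and to turn
  a factor z into X. This suffices to invert s X + (1 - s): its inverse is the value at X of 1/(s z
  + 1 - s), because (s z + 1 - s) times that function is 1.\<close>

lemma mfun_harm:
  assumes X: "X \<in> carrier_mat n n" "spec X \<subseteq> slit" and s: "0 \<le> s" "s \<le> 1"
  obtains V where "V \<in> carrier_mat n n"
    "(of_real s \<cdot>\<^sub>m X + of_real (1 - s) \<cdot>\<^sub>m 1\<^sub>m n) * V = 1\<^sub>m n"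
    "V * (of_real s \<cdot>\<^sub>m X + of_real (1 - s) \<cdot>\<^sub>m 1\<^sub>m n) = 1\<^sub>m n"
    "mfun (wharm s) X = X * V"
proof -
  define g where "g = (\<lambda>z. 1 / (of_real s * z + of_real (1 - s)) :: complex)"
  have g: "g holomorphic_on slit" unfolding g_def by (rule holomorphic_harm_recip[OF s])
  have zg: "(\<lambda>z. z * g z) holomorphic_on slit" by (intro holomorphic_intros g)
  define V where "V = mfun g X"
  let ?L = "of_real s \<cdot>\<^sub>m X + of_real (1 - s) \<cdot>\<^sub>m 1\<^sub>m n :: complex mat"
  have V: "V \<in> carrier_mat n n" unfolding V_def using X(1) by simp
  have L: "?L \<in> carrier_mat n n" using X(1) by simp
  have "mfun (\<lambda>z. of_real s * (z * g z) + of_real (1 - s) * g z) X = of_real s \<cdot>\<^sub>m (X * V) + of_real (1 - s) \<cdot>\<^sub>m V"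
    unfolding mfun_lincomb[OF X zg g] mfun_times_var[OF X g] V_def ..
  moreover have "mfun (\<lambda>z. of_real s * (z * g z) + of_real (1 - s) * g z) X = mfun (\<lambda>_. 1) X"
  proof (rule mfun_cong[OF X])
    fix z assume z: "z \<in> slit"
    have d: "of_real s * z + of_real (1 - s) \<noteq> (0::complex)" by (rule harm_denom_nonzero[OF z s])
    have "of_real s * (z * g z) + of_real (1 - s) * g z = (of_real s * z + of_real (1 - s)) * g z" by (simp add: algebra_simps)
    also have "\<dots> = 1" unfolding g_def using d by simp
    finally show "of_real s * (z * g z) + of_real (1 - s) * g z = 1" .
  qed (intro holomorphic_intros g)
  ultimately have e: "of_real s \<cdot>\<^sub>m (X * V) + of_real (1 - s) \<cdot>\<^sub>m V = 1\<^sub>m n" using mfun_one[OF X] by simp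
  have "?L * V = (of_real s \<cdot>\<^sub>m X) * V + (of_real (1 - s) \<cdot>\<^sub>m 1\<^sub>m n) * V"
    by (rule add_mult_distrib_mat[of _ n n]) (use X V in auto)
  also have "(of_real s \<cdot>\<^sub>m X) * V = of_real s \<cdot>\<^sub>m (X * V)" by (rule mult_smult_assoc_mat[OF X(1) V])
  also have "(of_real (1 - s) \<cdot>\<^sub>m 1\<^sub>m n) * V = of_real (1 - s) \<cdot>\<^sub>m (1\<^sub>m n * V)" by (rule mult_smult_assoc_mat[OF one_carrier_mat V])
  also have "1\<^sub>m n * V = V" using V by simp
  finally have LV: "?L * V = 1\<^sub>m n" using e by simp
  show ?thesis
  proof (rule that[OF V LV mat_mult_left_right_inverse[OF L V LV]])
    have "wharm s = (\<lambda>z. z * g z)" by (auto simp: wharm_def g_def)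
    thus "mfun (wharm s) X = X * V" using mfun_times_var[OF X g] V_def by simp
  qed
qed

lemma mult_affine_mat:
  fixes X :: "complex mat"
  assumes "X \<in> carrier_mat n n" "Q \<in> carrier_mat n n"
  shows "(a \<cdot>\<^sub>m X + b \<cdot>\<^sub>m 1\<^sub>m n) * Q = a \<cdot>\<^sub>m (X * Q) + b \<cdot>\<^sub>m Q"
proof -
  have "(a \<cdot>\<^sub>m X + b \<cdot>\<^sub>m 1\<^sub>m n) * Q = (a \<cdot>\<^sub>m X) * Q + (b \<cdot>\<^sub>m 1\<^sub>m n) * Q"
    by (rule add_mult_distrib_mat[of _ n n]) (use assms in auto)
  also have "(a \<cdot>\<^sub>m X) * Q = a \<cdot>\<^sub>m (X * Q)" by (rule mult_smult_assoc_mat[OF assms])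
  also have "(b \<cdot>\<^sub>m 1\<^sub>m n) * Q = b \<cdot>\<^sub>m (1\<^sub>m n * Q)" by (rule mult_smult_assoc_mat[OF one_carrier_mat assms(2)])
  also have "1\<^sub>m n * Q = Q" using assms by simp
  finally show ?thesis .
qed

lemma affine_mult_comm:
  fixes X :: "complex mat"
  assumes X: "X \<in> carrier_mat n n"
  shows "(a \<cdot>\<^sub>m X + b \<cdot>\<^sub>m 1\<^sub>m n) * X = X * (a \<cdot>\<^sub>m X + b \<cdot>\<^sub>m 1\<^sub>m n)"
proof -
  have "X * (a \<cdot>\<^sub>m X + b \<cdot>\<^sub>m 1\<^sub>m n) = X * (a \<cdot>\<^sub>m X) + X * (b \<cdot>\<^sub>m 1\<^sub>m n)"
    by (rule mult_add_distrib_mat[of _ n n]) (use X in auto)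
  also have "X * (a \<cdot>\<^sub>m X) = a \<cdot>\<^sub>m (X * X)" by (rule mult_smult_distrib[OF X X])
  also have "X * (b \<cdot>\<^sub>m 1\<^sub>m n) = b \<cdot>\<^sub>m (X * 1\<^sub>m n)" by (rule mult_smult_distrib[OF X one_carrier_mat])
  also have "X * 1\<^sub>m n = X" using X by simp
  finally show ?thesis using mult_affine_mat[OF X X] by simp
qed

text \<open>Multiplying through by the denominator turns h_s g into z g, which the previous rules
  evaluate; left multiplication by \<open>V\<close> then removes the denominator again.
  \<open>V\<close> commutes with \<open>X\<close>, being the inverse of an affine function of
  it.\<close>

lemma mfun_harm_mult:
  assumes X: "X \<in> carrier_mat n n" "spec X \<subseteq> slit" and s: "0 \<le> s" "s \<le> 1"
    and g: "g holomorphic_on slit"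
  shows "mfun (\<lambda>z. wharm s z * g z) X = mfun (wharm s) X * mfun g X"
proof -
  let ?L = "of_real s \<cdot>\<^sub>m X + of_real (1 - s) \<cdot>\<^sub>m 1\<^sub>m n :: complex mat"
  obtain V where V: "V \<in> carrier_mat n n" "?L * V = 1\<^sub>m n" "V * ?L = 1\<^sub>m n" "mfun (wharm s) X = X * V"
    by (rule mfun_harm[OF X s])
  have L: "?L \<in> carrier_mat n n" using X(1) by simp
  define P where "P = mfun (\<lambda>z. wharm s z * g z) X"
  define Q where "Q = mfun g X"
  have P: "P \<in> carrier_mat n n" "Q \<in> carrier_mat n n" unfolding P_def Q_def using X by auto
  have hg: "(\<lambda>z. wharm s z * g z) holomorphic_on slit" by (intro holomorphic_intros g holomorphic_harm s)
  have zhg: "(\<lambda>z. z * (wharm s z * g z)) holomorphic_on slit" by (intro holomorphic_intros hg)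
  have "?L * P = of_real s \<cdot>\<^sub>m (X * P) + of_real (1 - s) \<cdot>\<^sub>m P" by (rule mult_affine_mat[OF X(1) P(1)])
  also have "\<dots> = mfun (\<lambda>z. of_real s * (z * (wharm s z * g z)) + of_real (1 - s) * (wharm s z * g z)) X"
    unfolding mfun_lincomb[OF X zhg hg] mfun_times_var[OF X hg] P_def ..
  also have "\<dots> = mfun (\<lambda>z. z * g z) X"
  proof (rule mfun_cong[OF X])
    fix z assume z: "z \<in> slit"
    have d: "of_real s * z + of_real (1 - s) \<noteq> (0::complex)" by (rule harm_denom_nonzero[OF z s])
    have "of_real s * (z * (wharm s z * g z)) + of_real (1 - s) * (wharm s z * g z) =
        (of_real s * z + of_real (1 - s)) * wharm s z * g z" by (simp add: algebra_simps)
    also have "(of_real s * z + of_real (1 - s)) * wharm s z = z" unfolding wharm_def using d by simp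
    finally show "of_real s * (z * (wharm s z * g z)) + of_real (1 - s) * (wharm s z * g z) = z * g z" .
  qed (intro holomorphic_intros g holomorphic_harm s)
  also have "\<dots> = X * Q" unfolding Q_def by (rule mfun_times_var[OF X g])
  finally have LP: "?L * P = X * Q" .
  have "P = (V * ?L) * P" using V P by simp
  also have "\<dots> = V * (X * Q)" unfolding assoc_mult_mat[OF V(1) L P(1)] LP ..
  also have "\<dots> = (V * X) * Q" by (rule assoc_mult_mat[symmetric, OF V(1) X(1) P(2)])
  also have "V * X = X * V"
  proof -
    have VX: "V * X \<in> carrier_mat n n" using V X by simp
    have "V * X = (V * X) * (?L * V)" unfolding V(2) right_mult_one_mat[OF VX] ..
    also have "\<dots> = ((V * X) * ?L) * V" by (rule assoc_mult_mat[symmetric, OF VX L V(1)])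
    also have "(V * X) * ?L = V * (X * ?L)" by (rule assoc_mult_mat[OF V(1) X(1) L])
    also have "X * ?L = ?L * X" by (rule affine_mult_comm[OF X(1), symmetric])
    also have "V * (?L * X) = (V * ?L) * X" by (rule assoc_mult_mat[symmetric, OF V(1) L X(1)])
    also have "(V * ?L) * X = X" using V X by simp
    finally show ?thesis .
  qed
  finally show ?thesis unfolding V(4) P_def Q_def .
qed

text \<open>A discretised Loewner representation: stage N is a positive combination of
  \<open>J N\<close> generators, the atoms of an approximate representing measure on [0, 1].
  Convergence on compact subsets of the slit plane is the mode under which \<open>mfun\<close> is
  continuous.\<close>

definition harm_approx :: "(nat \<Rightarrow> nat \<Rightarrow> real) \<Rightarrow> (nat \<Rightarrow> nat \<Rightarrow> real) \<Rightarrow> (nat \<Rightarrow> nat) \<Rightarrow> (complex \<Rightarrow> complex) \<Rightarrow> bool" where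
  "harm_approx w s J f \<longleftrightarrow> (\<forall>N j. 0 \<le> w N j \<and> 0 \<le> s N j \<and> s N j \<le> 1) \<and> f holomorphic_on slit \<and>
     (\<forall>K. compact K \<longrightarrow> K \<subseteq> slit \<longrightarrow>
        uniform_limit K (\<lambda>N z. \<Sum>j<J N. of_real (w N j) * wharm (s N j) z) f sequentially)"

lemma harm_approxD:
  assumes "harm_approx w s J f"
  shows "0 \<le> w N j" "0 \<le> s N j" "s N j \<le> 1" "f holomorphic_on slit"
    "compact K \<Longrightarrow> K \<subseteq> slit \<Longrightarrow> uniform_limit K (\<lambda>N z. \<Sum>j<J N. of_real (w N j) * wharm (s N j) z) f sequentially"
  using assms unfolding harm_approx_def by auto

lemma harm_approx_mfun:
  assumes h: "harm_approx w s J f" and X: "X \<in> carrier_mat n n" "spec X \<subseteq> slit" and ij: "i < n" "j < n"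
  shows "(\<lambda>N. \<Sum>k<J N. of_real (w N k) * mfun (wharm (s N k)) X $$ (i,j)) \<longlonglongrightarrow> mfun f X $$ (i,j)"
proof -
  note d = harm_approxD[OF h]
  have "(\<lambda>N. mfun (\<lambda>z. \<Sum>k<J N. of_real (w N k) * wharm (s N k) z) X $$ (i,j)) \<longlonglongrightarrow> mfun f X $$ (i,j)"
    by (rule mfun_limit[OF X _ d(4,5) ij]) (intro holomorphic_intros holomorphic_harm d)
  moreover have "mfun (\<lambda>z. \<Sum>k<J N. of_real (w N k) * wharm (s N k) z) X $$ (i,j) =
      (\<Sum>k<J N. of_real (w N k) * mfun (wharm (s N k)) X $$ (i,j))" for N
    by (rule mfun_sum[OF X _ _ ij]) (auto intro: holomorphic_harm d)
  ultimately show ?thesis by simp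
qed

text \<open>Multiplicativity in the first factor is known for each h_s, is linear in that factor,
  and survives locally uniform limits. Taking both factors to be the square root gives (X^{1/2})^2 =
  X.\<close>

lemma harm_approx_mfun_mult:
  assumes h: "harm_approx w s J f" and X: "X \<in> carrier_mat n n" "spec X \<subseteq> slit"
    and g: "g holomorphic_on slit"
  shows "mfun (\<lambda>z. f z * g z) X = mfun f X * mfun g X"
proof (rule eq_matI)
  note d = harm_approxD[OF h]
  fix i j assume "i < dim_row (mfun f X * mfun g X)" "j < dim_col (mfun f X * mfun g X)"
  hence ij: "i < n" "j < n" using X by auto
  have entry: "(P * mfun g X) $$ (i,j) = (\<Sum>k<n. P $$ (i,k) * mfun g X $$ (k,j))" if "P \<in> carrier_mat n n" for P
    using that ij X by (simp add: scalar_prod_def lessThan_atLeast0)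
  have 1: "(\<lambda>N. mfun (\<lambda>z. (\<Sum>k<J N. of_real (w N k) * wharm (s N k) z) * g z) X $$ (i,j)) \<longlonglongrightarrow>
      mfun (\<lambda>z. f z * g z) X $$ (i,j)"
  proof (rule mfun_limit[OF X _ _ _ ij])
    show "(\<lambda>z. f z * g z) holomorphic_on slit" by (intro holomorphic_intros g d)
    show "(\<lambda>z. (\<Sum>k<J N. of_real (w N k) * wharm (s N k) z) * g z) holomorphic_on slit" for N
      by (intro holomorphic_intros holomorphic_harm d g)
    fix K assume K: "compact K" "K \<subseteq> slit"
    show "uniform_limit K (\<lambda>N z. (\<Sum>k<J N. of_real (w N k) * wharm (s N k) z) * g z) (\<lambda>z. f z * g z) sequentially"
      by (intro uniform_limit_mult_right_compact d K holomorphic_on_imp_continuous_on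
           holomorphic_on_subset[OF d(4)] holomorphic_on_subset[OF g])
  qed
  have "mfun (\<lambda>z. (\<Sum>k<J N. of_real (w N k) * wharm (s N k) z) * g z) X $$ (i,j) =
     (\<Sum>l<n. (\<Sum>k<J N. of_real (w N k) * mfun (wharm (s N k)) X $$ (i,l)) * mfun g X $$ (l,j))" for N
  proof -
    have "mfun (\<lambda>z. (\<Sum>k<J N. of_real (w N k) * wharm (s N k) z) * g z) X $$ (i,j) =
       mfun (\<lambda>z. \<Sum>k<J N. of_real (w N k) * (wharm (s N k) z * g z)) X $$ (i,j)"
      by (simp add: sum_distrib_right mult.assoc)
    also have "\<dots> = (\<Sum>k<J N. of_real (w N k) * mfun (\<lambda>z. wharm (s N k) z * g z) X $$ (i,j))"
      by (rule mfun_sum[OF X _ _ ij]) (auto intro!: holomorphic_harm d holomorphic_intros g)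
    also have "\<dots> = (\<Sum>k<J N. of_real (w N k) * (\<Sum>l<n. mfun (wharm (s N k)) X $$ (i,l) * mfun g X $$ (l,j)))"
      using X by (simp add: mfun_harm_mult[OF X d(2,3) g] entry)
    also have "\<dots> = (\<Sum>l<n. \<Sum>k<J N. of_real (w N k) * (mfun (wharm (s N k)) X $$ (i,l) * mfun g X $$ (l,j)))"
      unfolding sum_distrib_left by (rule sum.swap)
    also have "\<dots> = (\<Sum>l<n. (\<Sum>k<J N. of_real (w N k) * mfun (wharm (s N k)) X $$ (i,l)) * mfun g X $$ (l,j))"
      by (simp add: sum_distrib_right mult.assoc)
    finally show ?thesis .
  qed
  moreover have "(\<lambda>N. \<Sum>l<n. (\<Sum>k<J N. of_real (w N k) * mfun (wharm (s N k)) X $$ (i,l)) * mfun g X $$ (l,j))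
     \<longlonglongrightarrow> (\<Sum>l<n. mfun f X $$ (i,l) * mfun g X $$ (l,j))"
    by (intro tendsto_sum tendsto_mult tendsto_const harm_approx_mfun[OF h X ij(1)]) auto
  ultimately show "mfun (\<lambda>z. f z * g z) X $$ (i,j) = (mfun f X * mfun g X) $$ (i,j)"
    using LIMSEQ_unique[OF 1] X by (simp add: entry)
qed (use X in auto)

lemma mfun_csqrt_square:
  assumes h: "harm_approx w s J csqrt" and X: "X \<in> carrier_mat n n" "spec X \<subseteq> slit"
  shows "mfun csqrt X * mfun csqrt X = X"
proof -
  have "mfun csqrt X * mfun csqrt X = mfun (\<lambda>z. csqrt z * csqrt z) X"
    by (rule harm_approx_mfun_mult[OF h X csqrt_holomorphic_slit, symmetric])
  also have "\<dots> = mfun (\<lambda>z. z * 1) X"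
    by (rule mfun_cong[OF X]) (auto simp: power2_eq_square[symmetric] intro!: holomorphic_intros csqrt_holomorphic_slit)
  also have "\<dots> = X * mfun (\<lambda>_. 1) X" by (rule mfun_times_var[OF X]) auto
  also have "\<dots> = X" using mfun_one[OF X] X by simp
  finally show ?thesis .
qed

text \<open>Conjugation by U acts on the resolvent for every z outside the spectrum of Y, so a
  contour for Y also encloses the spectrum of U Y V, and conjugation passes through the integral
  entry by entry.\<close>

lemma mfun_similar:
  assumes U: "U \<in> carrier_mat n n" "V \<in> carrier_mat n n" "U * V = 1\<^sub>m n"
    and Y: "Y \<in> carrier_mat n n" "spec Y \<subseteq> slit" and f: "f holomorphic_on slit"
  shows "spec (U * Y * V) \<subseteq> spec Y" "mfun f (U * Y * V) = U * mfun f Y * V"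
proof -
  define X where "X = U * Y * V"
  have X: "X \<in> carrier_mat n n" unfolding X_def using U Y by simp
  have VU: "V * U = 1\<^sub>m n" by (rule mat_mult_left_right_inverse[OF U])
  have inv: "z \<notin> spec X \<and> resolv X z = U * resolv Y z * V" if z: "z \<notin> spec Y" for z
  proof -
    let ?Q = "z \<cdot>\<^sub>m 1\<^sub>m n - Y" and ?R = "resolv Y z"
    have Q: "?Q \<in> carrier_mat n n" by (rule minus_carrier_mat[OF Y(1)])
    note r = resolv_props[OF Y(1) z]
    have e: "z \<cdot>\<^sub>m 1\<^sub>m n - X = U * ?Q * V"
    proof -
      have "U * ?Q = U * (z \<cdot>\<^sub>m 1\<^sub>m n) - U * Y" by (rule mult_minus_distrib_mat[of _ n n]) (use U Y in auto)
      also have "U * (z \<cdot>\<^sub>m 1\<^sub>m n) = z \<cdot>\<^sub>m (U * 1\<^sub>m n)" by (rule mult_smult_distrib[OF U(1) one_carrier_mat])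
      also have "U * 1\<^sub>m n = U" using U by simp
      finally have "U * ?Q * V = (z \<cdot>\<^sub>m U - U * Y) * V" by simp
      also have "\<dots> = (z \<cdot>\<^sub>m U) * V - U * Y * V" by (rule minus_mult_distrib_mat[of _ n n]) (use U Y in auto)
      also have "(z \<cdot>\<^sub>m U) * V = z \<cdot>\<^sub>m 1\<^sub>m n" using mult_smult_assoc_mat[OF U(1,2)] U(3) by simp
      finally show ?thesis unfolding X_def by simp
    qed
    have c: "z \<cdot>\<^sub>m 1\<^sub>m n - X \<in> carrier_mat n n" "U * ?R * V \<in> carrier_mat n n" "U * ?Q \<in> carrier_mat n n"
      "U * ?R \<in> carrier_mat n n" "?R * V \<in> carrier_mat n n"
      using U r Q unfolding e by auto
    have p: "(z \<cdot>\<^sub>m 1\<^sub>m n - X) * (U * ?R * V) = 1\<^sub>m n"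
    proof -
      have "(z \<cdot>\<^sub>m 1\<^sub>m n - X) * (U * ?R * V) = U * ?Q * (V * (U * ?R * V))"
        unfolding e by (rule assoc_mult_mat[OF c(3) U(2) c(2)])
      also have "V * (U * ?R * V) = V * (U * (?R * V))" using assoc_mult_mat[OF U(1) r(1) U(2)] by simp
      also have "\<dots> = (V * U) * (?R * V)" by (rule assoc_mult_mat[symmetric, OF U(2,1) c(5)])
      also have "\<dots> = ?R * V" unfolding VU left_mult_one_mat[OF c(5)] ..
      also have "U * ?Q * (?R * V) = U * (?Q * (?R * V))" by (rule assoc_mult_mat[OF U(1) Q c(5)])
      also have "?Q * (?R * V) = (?Q * ?R) * V" by (rule assoc_mult_mat[symmetric, OF Q r(1) U(2)])
      also have "\<dots> = V" using r U by simp
      finally show ?thesis using U by simp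
    qed
    have p': "(U * ?R * V) * (z \<cdot>\<^sub>m 1\<^sub>m n - X) = 1\<^sub>m n" by (rule mat_mult_left_right_inverse[OF c(1,2) p])
    have "Determinant.det (z \<cdot>\<^sub>m 1\<^sub>m n - X) * Determinant.det (U * ?R * V) = 1"
      using det_mult[OF c(1,2)] p by simp
    hence "z \<notin> spec X" using X by (auto simp: spec_def)
    moreover have "resolv X z = U * ?R * V" using minv_unique[OF c(1,2) p p'] X by (simp add: resolv_def)
    ultimately show ?thesis by blast
  qed
  show sub: "spec (U * Y * V) \<subseteq> spec Y" using inv unfolding X_def by blast
  obtain \<gamma> where \<gamma>: "encloses \<gamma> Y" using encloses_exists[OF Y] .
  have \<gamma>X: "encloses \<gamma> X" using \<gamma> sub unfolding encloses_def X_def by blast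
  have sX: "spec X \<subseteq> slit" using sub Y(2) unfolding X_def by blast
  have entry: "(U * R * V) $$ (i,j) = (\<Sum>k<n. \<Sum>l<n. (U $$ (i,k) * V $$ (l,j)) * R $$ (k,l))"
    if "R \<in> carrier_mat n n" "i < n" "j < n" for R i j
  proof -
    have "(U * R * V) $$ (i,j) = (\<Sum>l<n. (U * R) $$ (i,l) * V $$ (l,j))"
      by (rule mult_mat_entry[of _ n n _ n]) (use that U in auto)
    also have "\<dots> = (\<Sum>l<n. (\<Sum>k<n. U $$ (i,k) * R $$ (k,l)) * V $$ (l,j))"
      using that U by (intro sum.cong) (auto simp: scalar_prod_def lessThan_atLeast0)
    also have "\<dots> = (\<Sum>l<n. \<Sum>k<n. (U $$ (i,k) * V $$ (l,j)) * R $$ (k,l))"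
      unfolding sum_distrib_right by (simp add: mult_ac)
    also have "\<dots> = (\<Sum>k<n. \<Sum>l<n. (U $$ (i,k) * V $$ (l,j)) * R $$ (k,l))" by (rule sum.swap)
    finally show ?thesis .
  qed
  have "mfun f X = U * mfun f Y * V"
  proof (rule eq_matI)
    fix i j assume "i < dim_row (U * mfun f Y * V)" "j < dim_col (U * mfun f Y * V)"
    hence ij: "i < n" "j < n" using U by auto
    have int: "(\<lambda>z. (U $$ (i,k) * V $$ (l,j)) * (f z * resolv Y z $$ (k,l))) contour_integrable_on \<gamma>"
      if "k < n" "l < n" for k l
      by (rule contour_integrable_lmul[OF integrable_slit_spec[OF Y \<gamma> mfun_integrand_hol[OF Y f that]]])
    have "contour_integral \<gamma> (\<lambda>z. f z * resolv X z $$ (i,j)) =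
      contour_integral \<gamma> (\<lambda>z. \<Sum>k<n. \<Sum>l<n. (U $$ (i,k) * V $$ (l,j)) * (f z * resolv Y z $$ (k,l)))"
    proof (rule contour_integral_eq)
      fix z assume "z \<in> path_image \<gamma>"
      hence z: "z \<notin> spec Y" using \<gamma> by (auto simp: encloses_def)
      show "f z * resolv X z $$ (i,j) = (\<Sum>k<n. \<Sum>l<n. (U $$ (i,k) * V $$ (l,j)) * (f z * resolv Y z $$ (k,l)))"
        using inv[OF z] entry[OF resolv_props(1)[OF Y(1) z] ij] by (simp add: sum_distrib_left mult_ac)
    qed
    also have "\<dots> = (\<Sum>k<n. contour_integral \<gamma> (\<lambda>z. \<Sum>l<n. (U $$ (i,k) * V $$ (l,j)) * (f z * resolv Y z $$ (k,l))))"
      by (intro contour_integral_sum contour_integrable_sum int) auto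
    also have "\<dots> = (\<Sum>k<n. \<Sum>l<n. contour_integral \<gamma> (\<lambda>z. (U $$ (i,k) * V $$ (l,j)) * (f z * resolv Y z $$ (k,l))))"
      by (intro sum.cong refl contour_integral_sum int) auto
    also have "\<dots> = (\<Sum>k<n. \<Sum>l<n. (U $$ (i,k) * V $$ (l,j)) * contour_integral \<gamma> (\<lambda>z. f z * resolv Y z $$ (k,l)))"
      by (intro sum.cong refl contour_integral_lmul integrable_slit_spec[OF Y \<gamma>] mfun_integrand_hol[OF Y f]) auto
    finally have e: "contour_integral \<gamma> (\<lambda>z. f z * resolv X z $$ (i,j)) =
      (\<Sum>k<n. \<Sum>l<n. (U $$ (i,k) * V $$ (l,j)) * contour_integral \<gamma> (\<lambda>z. f z * resolv Y z $$ (k,l)))" .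
    have "(U * mfun f Y * V) $$ (i,j) = (\<Sum>k<n. \<Sum>l<n. (U $$ (i,k) * V $$ (l,j)) * mfun f Y $$ (k,l))"
      using entry[OF _ ij] Y by simp
    also have "\<dots> = (\<Sum>k<n. \<Sum>l<n. (U $$ (i,k) * V $$ (l,j)) *
        (contour_integral \<gamma> (\<lambda>z. f z * resolv Y z $$ (k,l)) / (2 * pi * \<i>)))"
      by (intro sum.cong refl arg_cong2[of _ _ _ _ "(*)"] mfun_entry[OF Y \<gamma> f]) auto
    also have "\<dots> = mfun f X $$ (i,j)"
      unfolding mfun_entry[OF X sX \<gamma>X f ij] e by (simp add: sum_divide_distrib)
    finally show "mfun f X $$ (i,j) = (U * mfun f Y * V) $$ (i,j)" ..
  qed (use X U in auto)
  thus "mfun f (U * Y * V) = U * mfun f Y * V" unfolding X_def .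
qed

definition diagm :: "nat \<Rightarrow> (nat \<Rightarrow> complex) \<Rightarrow> complex mat" where
  "diagm n d = Matrix.mat n n (\<lambda>(i,j). if i = j then d i else 0)"

lemma diagm_carrier [simp]: "diagm n d \<in> carrier_mat n n" "dim_row (diagm n d) = n" "dim_col (diagm n d) = n"
  by (auto simp: diagm_def)

lemma diagm_index [simp]: "i < n \<Longrightarrow> j < n \<Longrightarrow> diagm n d $$ (i,j) = (if i = j then d i else 0)"
  by (auto simp: diagm_def)

lemma diagm_mult: "diagm n d * diagm n e = diagm n (\<lambda>i. d i * e i)"
proof (rule eq_matI)
  fix i j assume "i < dim_row (diagm n (\<lambda>i. d i * e i))" "j < dim_col (diagm n (\<lambda>i. d i * e i))"
  hence ij: "i < n" "j < n" by auto
  have "(diagm n d * diagm n e) $$ (i,j) = (\<Sum>k\<in>{0..<n}. diagm n d $$ (i,k) * diagm n e $$ (k,j))"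
    using ij by (simp add: scalar_prod_def)
  also have "\<dots> = (\<Sum>k\<in>{0..<n}. if k = i then d i * (if i = j then e i else 0) else 0)"
    using ij by (intro sum.cong) auto
  also have "\<dots> = d i * (if i = j then e i else 0)" using ij by simp
  finally show "(diagm n d * diagm n e) $$ (i,j) = diagm n (\<lambda>i. d i * e i) $$ (i,j)" using ij by simp
qed auto

lemma spec_diagm: "spec (diagm n d) = d ` {..<n}"
proof -
  have "z \<cdot>\<^sub>m 1\<^sub>m n - diagm n d = diagm n (\<lambda>i. z - d i)" for z by (rule eq_matI) auto
  moreover have "Determinant.det (diagm n e) = (\<Prod>i<n. e i)" for e
  proof -
    have "upper_triangular (diagm n e)" by (auto simp: diagm_def)
    from det_upper_triangular[OF this diagm_carrier(1)] have "Determinant.det (diagm n e) = prod_list (diag_mat (diagm n e))" .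
    also have "diag_mat (diagm n e) = map e [0..<n]" unfolding diag_mat_def by auto
    also have "prod_list \<dots> = (\<Prod>i<n. e i)" by (simp add: prod.list_conv_set_nth lessThan_atLeast0)
    finally show ?thesis .
  qed
  ultimately show ?thesis unfolding spec_def by auto
qed

lemma resolv_diagm:
  assumes "z \<notin> d ` {..<n}" shows "resolv (diagm n d) z = diagm n (\<lambda>i. 1 / (z - d i))"
proof -
  have e: "z \<cdot>\<^sub>m 1\<^sub>m n - diagm n d = diagm n (\<lambda>i. z - d i)" by (rule eq_matI) auto
  have 1: "diagm n (\<lambda>i. z - d i) * diagm n (\<lambda>i. 1 / (z - d i)) = 1\<^sub>m n"
    unfolding diagm_mult using assms by (intro eq_matI) auto
  show ?thesis unfolding resolv_def using minv_unique[OF _ _ 1 mat_mult_left_right_inverse[OF _ _ 1]] e by simp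
qed

lemma mfun_diagm:
  assumes d: "\<And>i. i < n \<Longrightarrow> d i \<in> slit" and f: "f holomorphic_on slit"
  shows "mfun f (diagm n d) = diagm n (\<lambda>i. f (d i))"
proof (rule eq_matI)
  fix i j assume "i < dim_row (diagm n (\<lambda>i. f (d i)))" "j < dim_col (diagm n (\<lambda>i. f (d i)))"
  hence ij: "i < n" "j < n" by auto
  have s: "spec (diagm n d) \<subseteq> slit" unfolding spec_diagm using d by auto
  obtain \<gamma> where \<gamma>: "encloses \<gamma> (diagm n d)" using encloses_exists[OF diagm_carrier(1) s] .
  have sp: "d i \<in> spec (diagm n d)" unfolding spec_diagm using ij by auto
  have "((\<lambda>w. f w / (w - d i)) has_contour_integral (2 * pi * \<i> * winding_number \<gamma> (d i) * f (d i))) \<gamma>"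
    using \<gamma> f d ij winding_slit_outside sp by (intro Cauchy_integral_formula_global[of slit]) (auto simp: encloses_def)
  moreover have "winding_number \<gamma> (d i) = 1" using \<gamma> sp by (auto simp: encloses_def)
  ultimately have ci: "contour_integral \<gamma> (\<lambda>w. f w / (w - d i)) = 2 * pi * \<i> * f (d i)"
    by (simp add: contour_integral_unique)
  have "contour_integral \<gamma> (\<lambda>z. f z * resolv (diagm n d) z $$ (i,j)) =
     contour_integral \<gamma> (\<lambda>z. (if i = j then 1 else 0) * (f z / (z - d i)))"
    using \<gamma> ij unfolding encloses_def spec_diagm
    by (intro contour_integral_eq) (auto simp: resolv_diagm subset_iff)
  also have "\<dots> = (if i = j then 2 * pi * \<i> * f (d i) else 0)" using ci by (cases "i = j") auto
  finally show "mfun f (diagm n d) $$ (i,j) = diagm n (\<lambda>i. f (d i)) $$ (i,j)"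
    unfolding mfun_entry[OF diagm_carrier(1) s \<gamma> f ij] using ij by simp
qed auto

section \<open>Positive Toeplitz forms\<close>

text \<open>Finds weights on given nodes with prescribed moments p_0, ..., p_{N-1}. Multiplying the
  weights by x_k - x_N kills the last node and changes the moments to p_{j+1} - x_N p_j, which is a
  problem with one node less.\<close>

lemma vandermonde_solve:
  fixes x :: "nat \<Rightarrow> real"
  assumes "inj_on x {..<N}"
  shows "\<exists>u. \<forall>j<N. (\<Sum>k<N. u k * x k ^ j) = p j"
  using assms
proof (induction N arbitrary: p)
  case (Suc N)
  have "inj_on x {..<N}" using Suc.prems by (rule inj_on_subset) auto
  from Suc.IH[OF this, of "\<lambda>j. p (Suc j) - x N * p j"] obtain v
    where v: "\<And>j. j < N \<Longrightarrow> (\<Sum>k<N. v k * x k ^ j) = p (Suc j) - x N * p j" by blast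
  have ne: "x k - x N \<noteq> 0" if "k < N" for k
    using that Suc.prems unfolding inj_on_def by fastforce
  \<comment> \<open>The weight of the last node is free in the reduced problem; it is fixed by the
    zeroth moment.\<close>
  define u where "u k = (if k < N then v k / (x k - x N) else p 0 - (\<Sum>k<N. v k / (x k - x N)))" for k
  have "(\<Sum>k<Suc N. u k * x k ^ j) = p j" if "j < Suc N" for j
    using that
  proof (induction j)
    case 0
    show ?case by (simp add: u_def)
  next
    case (Suc j)
    have "(\<Sum>k<Suc N. u k * x k ^ Suc j) = (\<Sum>k<Suc N. u k * (x k - x N) * x k ^ j) + x N * (\<Sum>k<Suc N. u k * x k ^ j)"
      unfolding sum_distrib_left sum.distrib[symmetric] by (intro sum.cong) (auto simp: algebra_simps)
    also have "(\<Sum>k<Suc N. u k * (x k - x N) * x k ^ j) = (\<Sum>k<N. v k * x k ^ j)"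
      using ne by (simp add: u_def)
    also have "\<dots> = p (Suc j) - x N * p j" using Suc.prems by (intro v) simp
    also have "(\<Sum>k<Suc N. u k * x k ^ j) = p j" using Suc by simp
    finally show ?case by simp
  qed
  thus ?case by blast
qed simp

text \<open>Expanding 1/(1 - x y) and g in power series writes the kernel form as twice the sum of
  B_m c_n B_{m+n}, where B_m is the m-th moment of the weights u on the nodes x. With nodes
  shrinking to 0 and weights blowing up suitably, B_m tends to p_m for m < N and to 0 beyond, so the
  limit is the Toeplitz form at p, with diagonal 2 c_0, halved.\<close>

lemma toeplitz_nonneg:
  fixes c p :: "nat \<Rightarrow> real" and g :: "real \<Rightarrow> real"
  assumes c: "\<And>n. \<bar>c n\<bar> \<le> C * 2 ^ n"
    and g: "\<And>x. 0 < x \<Longrightarrow> x < 1/2 \<Longrightarrow> (\<lambda>n. c n * x ^ n) sums g x"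
    and ker: "\<And>x u. inj_on x {..<N} \<Longrightarrow> (\<And>k. k < N \<Longrightarrow> 0 < x k \<and> x k < 1/2) \<Longrightarrow>
        0 \<le> (\<Sum>k<N. \<Sum>l<N. u k * u l * ((g (x k) + g (x l)) / (1 - x k * x l)))"
  shows "0 \<le> (\<Sum>m<N. p m * (\<Sum>n<N-m. c n * p (m + n)))"
proof -
  define y where "y k = real (k + 1) / real N" for k
  have y: "0 < y k" "y k \<le> 1" if "k < N" for k using that by (auto simp: y_def)
  have injy: "inj_on y {..<N}" by (auto simp: y_def inj_on_def)
  have "\<exists>U. \<forall>i. \<forall>j<N. (\<Sum>k<N. U i k * y k ^ j) = (if j = i then 1 else 0)"
    using vandermonde_solve[OF injy] by (intro choice allI) auto
  then obtain U where U: "\<And>i j. j < N \<Longrightarrow> (\<Sum>k<N. U i k * y k ^ j) = (if j = i then 1 else 0)" by blast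
  define V where "V i m = (\<Sum>k<N. U i k * y k ^ m)" for i m
  define W where "W i = (\<Sum>k<N. \<bar>U i k\<bar>)" for i
  have VW: "\<bar>V i m\<bar> \<le> W i" for i m
    unfolding V_def W_def
  proof (intro order_trans[OF sum_abs] sum_mono)
    fix k assume "k \<in> {..<N}"
    hence "y k ^ m \<le> 1" "0 \<le> y k ^ m" using y[of k] by (auto intro!: power_le_one)
    thus "\<bar>U i k * y k ^ m\<bar> \<le> \<bar>U i k\<bar>" by (simp add: abs_mult mult_left_le)
  qed
  have W0: "W i \<ge> 0" for i unfolding W_def by (intro sum_nonneg) auto
  define D where "D = (\<Sum>i<N. \<bar>p i\<bar> * 4 ^ i * W i)"
  have D0: "D \<ge> 0" unfolding D_def using W0 by (intro sum_nonneg) auto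
  have C0: "C \<ge> 0" 
  proof -
    have "\<bar>c 0\<bar> \<le> C" using c[of 0] by simp
    thus ?thesis by linarith
  qed
  \<comment> \<open>\<open>U i\<close> has moments \<delta>_ij on the nodes y. Scaling the nodes by
    \<epsilon> multiplies the i-th moment by \<epsilon>^i, which the factor (1/\<epsilon>)^i undoes;
    this is a discrete i-th derivative at 0.\<close>
  define u where "u \<epsilon> k = (\<Sum>i<N. p i * (1/\<epsilon>) ^ i * U i k)" for \<epsilon> k
  define B where "B \<epsilon> m = (\<Sum>k<N. u \<epsilon> k * (\<epsilon> * y k) ^ m)" for \<epsilon> m
  have BV: "B \<epsilon> m = (\<Sum>i<N. p i * ((1/\<epsilon>) ^ i * \<epsilon> ^ m) * V i m)" for \<epsilon> m
  proof -
    have "B \<epsilon> m = (\<Sum>k<N. \<Sum>i<N. p i * ((1/\<epsilon>) ^ i * \<epsilon> ^ m) * (U i k * y k ^ m))"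
      unfolding B_def u_def sum_distrib_right by (simp add: power_mult_distrib mult_ac)
    also have "\<dots> = (\<Sum>i<N. \<Sum>k<N. p i * ((1/\<epsilon>) ^ i * \<epsilon> ^ m) * (U i k * y k ^ m))" by (rule sum.swap)
    finally show ?thesis unfolding V_def sum_distrib_left .
  qed
  define b where "b m = (if m < N then p m else 0)" for m
  \<comment> \<open>Only nonnegative powers \<epsilon>^(m-i) survive, since \<open>V i m\<close>
    vanishes for m < i. With \<epsilon> < 1/4 the moments decay like 4^(-m), which beats the growth
    2^n allowed for c; all limits below can therefore be taken under the sum by domination.\<close>
  have ineq: "\<bar>p i * ((1/\<epsilon>) ^ i * \<epsilon> ^ m) * V i m\<bar> \<le> \<bar>p i\<bar> * 4 ^ i * W i * (1/4) ^ m"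
    if e: "0 < \<epsilon>" "\<epsilon> < 1/4" and i: "i < N" for \<epsilon> i m
  proof (cases "m < i")
    case True
    hence "V i m = 0" unfolding V_def using U[of m i] i by simp
    thus ?thesis using W0 by simp
  next
    case False
    hence "\<epsilon> ^ m = \<epsilon> ^ i * \<epsilon> ^ (m - i)" by (simp flip: power_add)
    hence 1: "(1/\<epsilon>) ^ i * \<epsilon> ^ m = \<epsilon> ^ (m - i)" using e by (simp add: power_divide)
    have "\<epsilon> ^ (m - i) \<le> (1/4) ^ (m - i)" using e by (intro power_mono) auto
    also have "\<dots> = 4 ^ i * (1/4) ^ m" using False by (simp add: power_divide power_diff)
    finally have 2: "\<epsilon> ^ (m - i) \<le> 4 ^ i * (1/4) ^ m" .
    have "\<bar>p i * ((1/\<epsilon>) ^ i * \<epsilon> ^ m) * V i m\<bar> = \<bar>p i\<bar> * \<epsilon> ^ (m - i) * \<bar>V i m\<bar>"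
      unfolding 1 using e by (simp add: abs_mult)
    also have "\<dots> \<le> \<bar>p i\<bar> * (4 ^ i * (1/4) ^ m) * W i"
      using 2 VW e W0 by (intro mult_mono) auto
    finally show ?thesis by (simp add: mult_ac)
  qed
  have Bb: "\<bar>B \<epsilon> m\<bar> \<le> D * (1/4) ^ m" if e: "0 < \<epsilon>" "\<epsilon> < 1/4" for \<epsilon> m
    unfolding BV D_def sum_distrib_right using ineq[OF e]
    by (intro order_trans[OF sum_abs] sum_mono) auto
  have ev: "\<forall>\<^sub>F \<epsilon> in at_right (0::real). 0 < \<epsilon> \<and> \<epsilon> < 1/4"
    using eventually_at_right[of 0 "1/4::real"] by (auto intro!: exI[of _ "1/4"])
  have Blim: "((\<lambda>\<epsilon>. B \<epsilon> m) \<longlongrightarrow> b m) (at_right 0)" for m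
  proof -
    have "((\<lambda>\<epsilon>. \<Sum>i<N. p i * ((1/\<epsilon>) ^ i * \<epsilon> ^ m) * V i m) \<longlongrightarrow> (\<Sum>i<N. if i = m then p i else 0)) (at_right 0)"
    proof (rule tendsto_sum)
      fix i assume "i \<in> {..<N}"
      hence i: "i < N" by simp
      consider "m < i" | "m = i" | "m > i" by linarith
      thus "((\<lambda>\<epsilon>. p i * ((1/\<epsilon>) ^ i * \<epsilon> ^ m) * V i m) \<longlongrightarrow> (if i = m then p i else 0)) (at_right 0)"
      proof cases
        case 1
        hence "V i m = 0" unfolding V_def using U[of m i] i by simp
        thus ?thesis using 1 by simp
      next
        case 2
        hence "V i m = 1" unfolding V_def using U[of m i] i by simp
        moreover have "\<forall>\<^sub>F \<epsilon> in at_right (0::real). p i = p i * ((1/\<epsilon>) ^ i * \<epsilon> ^ m)"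
          using ev by eventually_elim (use 2 in \<open>simp flip: power_mult_distrib\<close>)
        ultimately show ?thesis using 2 by (auto intro: Lim_transform_eventually[OF tendsto_const])
      next
        case 3
        have ev2: "\<forall>\<^sub>F \<epsilon> in at_right (0::real). p i * \<epsilon> ^ (m - i) * V i m = p i * ((1/\<epsilon>) ^ i * \<epsilon> ^ m) * V i m"
          using ev
        proof eventually_elim
          case (elim \<epsilon>)
          have "\<epsilon> ^ m = \<epsilon> ^ i * \<epsilon> ^ (m - i)" using 3 by (simp flip: power_add)
          hence "(1/\<epsilon>) ^ i * \<epsilon> ^ m = \<epsilon> ^ (m - i)" using elim by (simp add: power_divide)
          thus ?case by simp
        qed
        have "((\<lambda>\<epsilon>. p i * \<epsilon> ^ (m - i) * V i m) \<longlongrightarrow> p i * 0 ^ (m - i) * V i m) (at_right 0)"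
          by (intro tendsto_intros)
        moreover have "p i * 0 ^ (m - i) * V i m = (if i = m then p i else 0)" using 3 by simp
        ultimately have "((\<lambda>\<epsilon>. p i * \<epsilon> ^ (m - i) * V i m) \<longlongrightarrow> (if i = m then p i else 0)) (at_right 0)"
          by (simp only:)
        from Lim_transform_eventually[OF this ev2] show ?thesis .
      qed
    qed
    moreover have "(\<Sum>i<N. if i = m then p i else 0) = b m" by (simp add: b_def)
    ultimately show ?thesis unfolding BV by simp
  qed
  define A where "A \<epsilon> m = (\<Sum>n. c n * B \<epsilon> (m + n))" for \<epsilon> m
  define a where "a m = (\<Sum>n. c n * b (m + n))" for m
  have cB: "\<bar>c n * B \<epsilon> (m + n)\<bar> \<le> C * D * (1/4) ^ m * (1/2) ^ n" if e: "0 < \<epsilon>" "\<epsilon> < 1/4" for \<epsilon> m n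
  proof -
    have "\<bar>c n * B \<epsilon> (m + n)\<bar> \<le> (C * 2 ^ n) * (D * (1/4) ^ (m + n))"
      unfolding abs_mult by (intro mult_mono c Bb[OF e]) (use C0 in auto)
    also have "\<dots> = C * D * (1/4) ^ m * (2 * (1/4)) ^ n"
      unfolding power_mult_distrib power_add by (simp only: mult_ac)
    finally show ?thesis by simp
  qed
  have sumM: "summable (\<lambda>n. C * D * (1/4) ^ m * (1/2) ^ n)" for m
    by (intro summable_mult) (simp add: summable_geometric)
  have evp: "\<forall>\<^sub>F (n, \<epsilon>) in (at_top :: nat filter) \<times>\<^sub>F at_right (0::real). 0 < \<epsilon> \<and> \<epsilon> < 1/4"
    using eventually_prodI[OF always_eventually[of "\<lambda>_. True" "at_top :: nat filter"] ev]
    by (simp add: case_prod_unfold)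
  have Alim: "((\<lambda>\<epsilon>. A \<epsilon> m) \<longlongrightarrow> a m) (at_right 0)" for m
  proof -
    have "((\<lambda>\<epsilon>. suminf (\<lambda>n. c n * B \<epsilon> (m + n))) \<longlongrightarrow> suminf (\<lambda>n. c n * b (m + n))) (at_right 0)"
    proof (intro conjunct2[OF conjunct2[OF tannerys_theorem[OF _ _ sumM[of m]]]])
      show "((\<lambda>\<epsilon>. c n * B \<epsilon> (m + n)) \<longlongrightarrow> c n * b (m + n)) (at_right 0)" for n by (intro tendsto_intros Blim)
      show "\<forall>\<^sub>F (n, \<epsilon>) in at_top \<times>\<^sub>F at_right 0. norm (c n * B \<epsilon> (m + n)) \<le> C * D * (1/4) ^ m * (1/2) ^ n"
        using evp by eventually_elim (use cB in auto)
    qed auto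
    thus ?thesis unfolding A_def a_def .
  qed
  have Ab: "\<bar>A \<epsilon> m\<bar> \<le> 2 * C * D * (1/4) ^ m" if e: "0 < \<epsilon>" "\<epsilon> < 1/4" for \<epsilon> m
  proof -
    have "norm (A \<epsilon> m) \<le> (\<Sum>n. C * D * (1/4) ^ m * (1/2) ^ n)"
      unfolding A_def by (intro norm_suminf_le sumM) (use cB[OF e] in auto)
    also have "\<dots> = C * D * (1/4) ^ m * 2"
      by (subst suminf_mult) (auto simp: suminf_geometric summable_geometric)
    finally show ?thesis by (simp add: mult_ac)
  qed
  \<comment> \<open>Tannery's theorem a second time, now for the outer sum; the first application
    gave the limits of the inner sums \<open>A\<close>.\<close>
  have Slim: "((\<lambda>\<epsilon>. \<Sum>m. B \<epsilon> m * A \<epsilon> m) \<longlongrightarrow> (\<Sum>m. b m * a m)) (at_right 0)"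
  proof (intro conjunct2[OF conjunct2[OF tannerys_theorem[where M="\<lambda>m. 2 * C * D * D * (1/4) ^ m"]]])
    show "((\<lambda>\<epsilon>. B \<epsilon> m * A \<epsilon> m) \<longlongrightarrow> b m * a m) (at_right 0)" for m by (intro tendsto_intros Blim Alim)
    show "\<forall>\<^sub>F (m, \<epsilon>) in at_top \<times>\<^sub>F at_right 0. norm (B \<epsilon> m * A \<epsilon> m) \<le> 2 * C * D * D * (1/4) ^ m"
      using evp
    proof eventually_elim
      case (elim z)
      obtain m \<epsilon> where z: "z = (m, \<epsilon>)" by (cases z)
      have e: "0 < \<epsilon>" "\<epsilon> < 1/4" using elim z by auto
      have "\<bar>B \<epsilon> m * A \<epsilon> m\<bar> \<le> (D * (1/4) ^ m) * (2 * C * D * (1/4) ^ m)"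
        unfolding abs_mult by (intro mult_mono Bb[OF e] Ab[OF e]) (use D0 in auto)
      also have "\<dots> = (2 * C * D * D * (1/4) ^ m) * (1/4) ^ m" by (simp add: mult_ac)
      also have "\<dots> \<le> (2 * C * D * D * (1/4) ^ m) * 1"
        using C0 D0 by (intro mult_left_mono power_le_one) auto
      finally show ?case using z by simp
    qed
    show "summable (\<lambda>m. 2 * C * D * D * (1/4) ^ m)" by (intro summable_mult) (simp add: summable_geometric)
  qed auto
  have nonneg: "0 \<le> (\<Sum>m. B \<epsilon> m * A \<epsilon> m)" if e: "0 < \<epsilon>" "\<epsilon> < 1/4" for \<epsilon>
  proof -
    define x where "x k = \<epsilon> * y k" for k
    have x: "0 < x k" "x k < 1/2" if "k < N" for k
    proof -
      show "0 < x k" unfolding x_def using e y[OF that] by simp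
      have "x k \<le> \<epsilon> * 1" unfolding x_def using e y[OF that] by (intro mult_left_mono) auto
      thus "x k < 1/2" using e by simp
    qed
    have injx: "inj_on x {..<N}" using injy e unfolding inj_on_def x_def by auto
    let ?u = "u \<epsilon>"
    have Ag: "A \<epsilon> m = (\<Sum>k<N. ?u k * x k ^ m * g (x k))" for m
    proof -
      have "(\<lambda>n. \<Sum>k<N. ?u k * x k ^ m * (c n * x k ^ n)) sums (\<Sum>k<N. ?u k * x k ^ m * g (x k))"
        by (intro sums_sum sums_mult g x) auto
      moreover have "(\<Sum>k<N. ?u k * x k ^ m * (c n * x k ^ n)) = c n * B \<epsilon> (m + n)" for n
        unfolding B_def sum_distrib_left x_def by (simp add: power_add mult_ac)
      ultimately show ?thesis unfolding A_def by (simp add: sums_iff)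
    qed
    have "(\<lambda>m. \<Sum>k<N. \<Sum>l<N. (?u k * ?u l * g (x k)) * (x k * x l) ^ m) sums
        (\<Sum>k<N. \<Sum>l<N. (?u k * ?u l * g (x k)) * (1 / (1 - x k * x l)))"
    proof (intro sums_sum sums_mult geometric_sums)
      fix k l assume "k \<in> {..<N}" "l \<in> {..<N}"
      hence k: "0 < x k" "x k < 1" "0 < x l" "x l < 1" using x[of k] x[of l] by auto
      have "x k * x l < 1 * 1" by (rule mult_strict_mono) (use k in auto)
      moreover have "0 < x k * x l" using k by simp
      ultimately show "norm (x k * x l) < 1" by simp
    qed
    moreover have "(\<Sum>k<N. \<Sum>l<N. (?u k * ?u l * g (x k)) * (x k * x l) ^ m) = B \<epsilon> m * A \<epsilon> m" for m
    proof -
      have "B \<epsilon> m * A \<epsilon> m = (\<Sum>l<N. ?u l * x l ^ m) * (\<Sum>k<N. ?u k * x k ^ m * g (x k))"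
        unfolding Ag B_def x_def ..
      also have "\<dots> = (\<Sum>l<N. \<Sum>k<N. (?u l * x l ^ m) * (?u k * x k ^ m * g (x k)))" by (rule sum_product)
      also have "\<dots> = (\<Sum>k<N. \<Sum>l<N. (?u l * x l ^ m) * (?u k * x k ^ m * g (x k)))" by (rule sum.swap)
      finally show ?thesis by (simp add: power_mult_distrib mult_ac)
    qed
    ultimately have S: "(\<Sum>m. B \<epsilon> m * A \<epsilon> m) = (\<Sum>k<N. \<Sum>l<N. (?u k * ?u l * g (x k)) * (1 / (1 - x k * x l)))"
      by (simp add: sums_iff)
    \<comment> \<open>Exchanging k and l moves g from x_k to x_l. Adding the two versions produces
      the symmetric kernel of the hypothesis.\<close>
    have sw: "(\<Sum>k<N. \<Sum>l<N. (?u k * ?u l * g (x k)) * (1 / (1 - x k * x l))) =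
        (\<Sum>k<N. \<Sum>l<N. (?u k * ?u l * g (x l)) * (1 / (1 - x k * x l)))"
      by (subst sum.swap) (simp add: mult_ac)
    have "2 * (\<Sum>m. B \<epsilon> m * A \<epsilon> m) = (\<Sum>k<N. \<Sum>l<N. (?u k * ?u l * g (x k)) * (1 / (1 - x k * x l)))
        + (\<Sum>k<N. \<Sum>l<N. (?u k * ?u l * g (x l)) * (1 / (1 - x k * x l)))"
      using S sw by simp
    also have "\<dots> = (\<Sum>k<N. \<Sum>l<N. ?u k * ?u l * ((g (x k) + g (x l)) / (1 - x k * x l)))"
      unfolding sum.distrib[symmetric] by (intro sum.cong) (auto simp: algebra_simps add_divide_distrib)
    also have "\<dots> \<ge> 0" by (rule ker[OF injx]) (use x in auto)
    finally show ?thesis by simp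
  qed
  have "0 \<le> (\<Sum>m. b m * a m)"
    using tendsto_lowerbound[OF Slim, of 0] eventually_mono[OF ev] nonneg by force
  also have "(\<Sum>m. b m * a m) = (\<Sum>m<N. b m * a m)" by (rule suminf_finite) (auto simp: b_def)
  also have "\<dots> = (\<Sum>m<N. p m * (\<Sum>n<N-m. c n * p (m + n)))"
  proof (rule sum.cong[OF refl])
    fix m assume "m \<in> {..<N}"
    hence m: "m < N" by simp
    have "a m = (\<Sum>n<N-m. c n * b (m + n))" unfolding a_def by (rule suminf_finite) (auto simp: b_def)
    also have "\<dots> = (\<Sum>n<N-m. c n * p (m + n))" by (intro sum.cong) (auto simp: b_def)
    finally show "b m * a m = p m * (\<Sum>n<N-m. c n * p (m + n))" using m by (simp add: b_def)
  qed
  finally show ?thesis .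
qed

section \<open>Fejer means and sampling at roots of unity\<close>

text \<open>The Toeplitz form at the vector of exponentials e^{imt}, taken separately on its real
  part cos(mt) and imaginary part sin(mt). The addition formula makes each summand depend on n
  alone, and n occurs for N - n values of m.\<close>

lemma fejer_nonneg:
  fixes c :: "nat \<Rightarrow> real"
  assumes toep: "\<And>p. 0 \<le> (\<Sum>m<N. p m * (\<Sum>n<N-m. c n * p (m + n)))"
  shows "0 \<le> (\<Sum>n<N. (real N - real n) * c n * cos (real n * t))"
proof -
  have "0 \<le> (\<Sum>m<N. cos (m * t) * (\<Sum>n<N-m. c n * cos (real (m + n) * t))) +
      (\<Sum>m<N. sin (m * t) * (\<Sum>n<N-m. c n * sin (real (m + n) * t)))"
    using toep[of "\<lambda>m. cos (m * t)"] toep[of "\<lambda>m. sin (m * t)"] by (intro add_nonneg_nonneg)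
  also have "\<dots> = (\<Sum>m<N. \<Sum>n<N-m. c n * cos (n * t))"
    unfolding sum.distrib[symmetric] sum_distrib_left
  proof (intro sum.cong refl)
    fix m n :: nat
    have "cos (real n * t) = cos (real (m + n) * t - m * t)" by (simp add: algebra_simps)
    also have "\<dots> = cos (real (m + n) * t) * cos (m * t) + sin (real (m + n) * t) * sin (m * t)" by (rule cos_diff)
    finally show "cos (m * t) * (c n * cos (real (m + n) * t)) + sin (m * t) * (c n * sin (real (m + n) * t)) = c n * cos (n * t)"
      by (simp add: algebra_simps)
  qed
  also have "\<dots> = (\<Sum>(m,n) \<in> Sigma {..<N} (\<lambda>m. {..<N-m}). c n * cos (n * t))" by (simp add: sum.Sigma)
  also have "\<dots> = (\<Sum>(n,m) \<in> Sigma {..<N} (\<lambda>n. {..<N-n}). c n * cos (n * t))"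
    by (rule sum.reindex_bij_witness[of _ prod.swap prod.swap]) auto
  also have "\<dots> = (\<Sum>n<N. \<Sum>m<N-n. c n * cos (n * t))" by (rule sum.Sigma[symmetric]) auto
  also have "\<dots> = (\<Sum>n<N. (real N - real n) * c n * cos (n * t))"
    by (intro sum.cong) (auto simp: of_nat_diff)
  finally show ?thesis .
qed

lemma sum_cos_roots:
  assumes "0 < k" "k < M"
  shows "(\<Sum>j<M. cos (real k * (2 * pi * real j / real M))) = 0"
proof -
  define x where "x = cis (2 * pi * real k / real M)"
  have pw: "x ^ j = cis (real k * (2 * pi * real j / real M))" for j
  proof -
    have "x ^ j = cis (real j * (2 * pi * real k / real M))" unfolding x_def by (rule Complex.DeMoivre)
    also have "real j * (2 * pi * real k / real M) = real k * (2 * pi * real j / real M)" by (simp add: field_simps)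
    finally show ?thesis .
  qed
  have "x ^ M = cis (2 * pi * real k)" unfolding pw using assms by (simp add: mult_ac)
  also have "\<dots> = 1" using cis_multiple_2pi[of "real k"] by simp
  finally have xM: "x ^ M = 1" .
  have "x \<noteq> 1"
  proof
    assume "x = 1"
    hence "cos (2 * pi * real k / real M) = 1" by (simp add: x_def complex_eq_iff)
    then obtain n :: int where n: "2 * pi * real k / real M = of_int n * (2 * pi)"
      using cos_one_2pi_int by (metis mult.commute mult.left_commute)
    have "(2 * pi) * (real k / real M) = (2 * pi) * of_int n" using n by (simp only: times_divide_eq_right mult.commute)
    hence e: "real k / real M = of_int n" unfolding mult_cancel_left by simp
    have "0 < real k / real M" "real k / real M < 1" using assms by auto
    hence "0 < n" "n < 1" unfolding e by simp_all
    thus False by simp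
  qed
  hence "(\<Sum>j<M. x ^ j) = 0" using xM by (simp add: sum_gp_strict)
  hence "Re (\<Sum>j<M. x ^ j) = 0" by simp
  thus ?thesis unfolding pw by simp
qed

text \<open>The 2N sample points are enough to avoid aliasing: for k, n < N both k + n and |k - n|
  are less than 2N, so each nonzero frequency sums to zero.\<close>

lemma sum_cos_mult_roots:
  assumes "k < N" "n < N"
  shows "(\<Sum>j<2*N. cos (real k * (2 * pi * real j / real (2 * N))) * cos (real n * (2 * pi * real j / real (2 * N)))) =
     (if k = n then (if n = 0 then 2 * real N else real N) else 0)"
proof -
  define T where "T m = (\<Sum>j<2*N. cos (real m * (2 * pi * real j / real (2 * N))))" for m :: nat
  have T0: "T 0 = 2 * real N" by (simp add: T_def)
  have Tm: "T m = 0" if "0 < m" "m < 2 * N" for m unfolding T_def by (rule sum_cos_roots[OF that])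
  define d where "d = (if k \<le> n then n - k else k - n)"
  have "(\<Sum>j<2*N. cos (real k * (2 * pi * real j / real (2 * N))) * cos (real n * (2 * pi * real j / real (2 * N)))) =
     (\<Sum>j<2*N. (cos (real d * (2 * pi * real j / real (2 * N))) + cos (real (k + n) * (2 * pi * real j / real (2 * N)))) / 2)"
  proof (rule sum.cong[OF refl])
    fix j
    let ?a = "2 * pi * real j / real (2 * N)"
    have "cos (real d * ?a) = cos (real k * ?a - real n * ?a)"
    proof (cases "k \<le> n")
      case True
      hence "real d = real n - real k" by (simp add: d_def of_nat_diff)
      hence "real d * ?a = - (real k * ?a - real n * ?a)" by (simp only: left_diff_distrib minus_diff_eq)
      thus ?thesis by (simp only: cos_minus)
    next
      case False
      hence "real d = real k - real n" by (simp add: d_def of_nat_diff)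
      thus ?thesis by (simp only: left_diff_distrib)
    qed
    moreover have "cos (real (k + n) * ?a) = cos (real k * ?a + real n * ?a)" by (simp only: of_nat_add distrib_right)
    ultimately show "cos (real k * ?a) * cos (real n * ?a) = (cos (real d * ?a) + cos (real (k + n) * ?a)) / 2"
      by (simp only: cos_diff cos_add) simp
  qed
  also have "\<dots> = (T d + T (k + n)) / 2" by (simp add: T_def sum.distrib flip: sum_divide_distrib)
  also have "\<dots> = (if k = n then (if n = 0 then 2 * real N else real N) else 0)"
  proof (cases "k = n")
    case True
    hence "d = 0" by (simp add: d_def)
    thus ?thesis using True T0 Tm[of "k + n"] assms by auto
  next
    case False
    hence "0 < d" "d < 2 * N" "0 < k + n" "k + n < 2 * N" using assms by (auto simp: d_def)
    thus ?thesis using False Tm by simp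
  qed
  finally show ?thesis .
qed

text \<open>The Poisson-type kernel of the disc, transported by
  $\zeta = (1 - w) / (1 + w)$ to the right half-plane, is the function wharm at $w^2$.\<close>
lemma harm_kernel_sums:
  assumes \<zeta>: "cmod \<zeta> < 1" and w: "w = (1 - \<zeta>) / (1 + \<zeta>)"
  shows "(\<lambda>n. w * (of_real ((if n = 0 then 1 else 2) * cos (real n * t)) * \<zeta> ^ n)) sums wharm ((1 + cos t) / 2) (w\<^sup>2)"
proof -
  define \<eta> where "\<eta> = cis t"
  have ne: "\<eta> * cnj \<eta> = 1" "\<eta> + cnj \<eta> = of_real (2 * cos t)"
    by (auto simp: \<eta>_def complex_eq_iff simp flip: power2_eq_square)
  have n1: "cmod (\<eta> * \<zeta>) < 1" "cmod (cnj \<eta> * \<zeta>) < 1" using \<zeta> by (auto simp: norm_mult \<eta>_def)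
  \<comment> \<open>The two geometric series count the constant term twice. Subtracting 1 leaves 1 +
    2 \<Sum> cos(nt) \<zeta>^n, the analytic completion of the Poisson kernel.\<close>
  have s: "(\<lambda>n. (\<eta> * \<zeta>) ^ n + (cnj \<eta> * \<zeta>) ^ n - (if n = 0 then 1 else 0)) sums
      (1 / (1 - \<eta> * \<zeta>) + 1 / (1 - cnj \<eta> * \<zeta>) - 1)"
    using sums_single[of 0 "\<lambda>_. 1::complex"]
    by (intro sums_diff sums_add geometric_sums n1) auto
  have e1: "(\<eta> * \<zeta>) ^ n + (cnj \<eta> * \<zeta>) ^ n - (if n = 0 then 1 else 0) =
      of_real ((if n = 0 then 1 else 2) * cos (real n * t)) * \<zeta> ^ n" for n
  proof -
    have "\<eta> ^ n + cnj \<eta> ^ n = of_real (2 * cos (real n * t))"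
    proof -
      have p: "\<eta> ^ n = cis (real n * t)" unfolding \<eta>_def by (rule Complex.DeMoivre)
      have "cnj \<eta> ^ n = cnj (cis (real n * t))" by (simp only: complex_cnj_power[symmetric] p)
      thus ?thesis unfolding p by (simp add: complex_eq_iff)
    qed
    hence "(\<eta> * \<zeta>) ^ n + (cnj \<eta> * \<zeta>) ^ n = of_real (2 * cos (real n * t)) * \<zeta> ^ n"
      unfolding power_mult_distrib by (metis distrib_right)
    thus ?thesis by auto
  qed
  have d1: "1 - \<eta> * \<zeta> \<noteq> 0" "1 - cnj \<eta> * \<zeta> \<noteq> 0" using n1 by auto
  have prod: "(1 - \<eta> * \<zeta>) * (1 - cnj \<eta> * \<zeta>) = 1 - of_real (2 * cos t) * \<zeta> + \<zeta>\<^sup>2"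
  proof -
    have "(1 - \<eta> * \<zeta>) * (1 - cnj \<eta> * \<zeta>) = 1 - (\<eta> + cnj \<eta>) * \<zeta> + (\<eta> * cnj \<eta>) * \<zeta>\<^sup>2"
      by (simp add: algebra_simps power2_eq_square)
    thus ?thesis unfolding ne by simp
  qed
  have Dn: "1 - of_real (2 * cos t) * \<zeta> + \<zeta>\<^sup>2 \<noteq> 0" using d1 prod by (metis mult_eq_0_iff)
  have "1 / (1 - \<eta> * \<zeta>) + 1 / (1 - cnj \<eta> * \<zeta>) - 1 =
     ((1 - cnj \<eta> * \<zeta>) + (1 - \<eta> * \<zeta>) - (1 - \<eta> * \<zeta>) * (1 - cnj \<eta> * \<zeta>)) / ((1 - \<eta> * \<zeta>) * (1 - cnj \<eta> * \<zeta>))"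
    using d1 by (simp add: divide_simps) 
  also have "(1 - cnj \<eta> * \<zeta>) + (1 - \<eta> * \<zeta>) - (1 - \<eta> * \<zeta>) * (1 - cnj \<eta> * \<zeta>) = 1 - (\<eta> * cnj \<eta>) * \<zeta>\<^sup>2"
    by (simp add: algebra_simps power2_eq_square)
  finally have S: "1 / (1 - \<eta> * \<zeta>) + 1 / (1 - cnj \<eta> * \<zeta>) - 1 = (1 - \<zeta>\<^sup>2) / (1 - of_real (2 * cos t) * \<zeta> + \<zeta>\<^sup>2)"
    unfolding prod ne by simp
  have zp: "1 + \<zeta> \<noteq> 0"
  proof
    assume "1 + \<zeta> = 0"
    hence "\<zeta> = - 1" by (simp add: add_eq_0_iff)
    thus False using \<zeta> by simp
  qed
  have H: "wharm ((1 + cos t) / 2) (w\<^sup>2) = w * ((1 - \<zeta>\<^sup>2) / (1 - of_real (2 * cos t) * \<zeta> + \<zeta>\<^sup>2))"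
  proof -
    \<comment> \<open>For this value of s the quadratic s (1 - \<zeta>)^2 + (1 - s) (1 + \<zeta>)^2
      has the roots e^{it} and e^{-it}, so it is the common denominator of the two geometric
      series.\<close>
    let ?s = "of_real ((1 + cos t) / 2) :: complex"
    have s1: "of_real (1 - (1 + cos t) / 2) = 1 - ?s" by simp
    have q: "(1 + \<zeta>)\<^sup>2 \<noteq> 0" using zp by simp
    have "?s * w\<^sup>2 + (1 - ?s) = (?s * (1 - \<zeta>)\<^sup>2 + (1 - ?s) * (1 + \<zeta>)\<^sup>2) / (1 + \<zeta>)\<^sup>2"
      using q unfolding w power_divide by (simp add: add_divide_distrib)
    also have "?s * (1 - \<zeta>)\<^sup>2 + (1 - ?s) * (1 + \<zeta>)\<^sup>2 = 1 - of_real (2 * cos t) * \<zeta> + \<zeta>\<^sup>2"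
      by (simp add: power2_eq_square field_simps)
    finally have den: "?s * w\<^sup>2 + (1 - ?s) = (1 - of_real (2 * cos t) * \<zeta> + \<zeta>\<^sup>2) / (1 + \<zeta>)\<^sup>2" .
    have "wharm ((1 + cos t) / 2) (w\<^sup>2) = w\<^sup>2 / (?s * w\<^sup>2 + (1 - ?s))" unfolding wharm_def s1 ..
    also have "\<dots> = (w\<^sup>2 * (1 + \<zeta>)\<^sup>2) / (1 - of_real (2 * cos t) * \<zeta> + \<zeta>\<^sup>2)" unfolding den using q by simp
    also have "w\<^sup>2 * (1 + \<zeta>)\<^sup>2 = w * (1 - \<zeta>\<^sup>2)"
    proof -
      have "w * (1 + \<zeta>) = 1 - \<zeta>" unfolding w using zp by simp
      hence "w\<^sup>2 * (1 + \<zeta>)\<^sup>2 = w * ((1 - \<zeta>) * (1 + \<zeta>))" by (simp add: power2_eq_square mult_ac)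
      thus ?thesis by (simp add: power2_eq_square algebra_simps)
    qed
    finally show ?thesis by simp
  qed
  show ?thesis unfolding H S[symmetric] using sums_mult[OF s, of w] unfolding e1 .
qed

lemma cayley_disc:
  assumes "Re w > 0" shows "cmod ((1 - w) / (1 + w)) < 1" "1 + w \<noteq> 0"
    "w = (1 - (1 - w) / (1 + w)) / (1 + (1 - w) / (1 + w))"
proof -
  show n: "1 + w \<noteq> 0" using assms by (auto simp: complex_eq_iff)
  have "(cmod (1 - w))\<^sup>2 < (cmod (1 + w))\<^sup>2" unfolding cmod_power2 using assms by (simp add: power2_eq_square algebra_simps)
  hence "cmod (1 - w) < cmod (1 + w)" by (simp add: power2_less_imp_less)
  thus "cmod ((1 - w) / (1 + w)) < 1" using n by (simp add: norm_divide divide_simps)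
  show "w = (1 - (1 - w) / (1 + w)) / (1 + (1 - w) / (1 + w))" using n by (simp add: divide_simps)
qed

lemma cayley_disc_inv:
  assumes "cmod \<zeta> < 1" shows "Re ((1 - \<zeta>) / (1 + \<zeta>)) > 0" "1 + \<zeta> \<noteq> 0"
proof -
  show n: "1 + \<zeta> \<noteq> 0"
  proof
    assume "1 + \<zeta> = 0"
    hence "\<zeta> = - 1" by (simp add: add_eq_0_iff)
    thus False using assms by simp
  qed
  have "(cmod \<zeta>)\<^sup>2 < 1" using assms by (simp add: power_less_one_iff)
  hence "Re \<zeta> * Re \<zeta> + Im \<zeta> * Im \<zeta> < 1" unfolding cmod_power2 by (simp add: power2_eq_square)
  moreover have "(cmod (1 + \<zeta>))\<^sup>2 > 0" using n by simp
  ultimately show "Re ((1 - \<zeta>) / (1 + \<zeta>)) > 0"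
    unfolding Re_divide' by (intro divide_pos_pos) (auto simp: algebra_simps power2_eq_square)
qed

text \<open>Under the squaring map and the Cayley transform, the positivity of the kernel says that
  the Taylor coefficients of $f(w^2)/w$ form a positive Toeplitz matrix; its Fejer means, sampled
  at roots of unity, are the weights of the approximants.\<close>
theorem harm_approx_exists:
  fixes f :: "complex \<Rightarrow> complex"
  assumes f: "f holomorphic_on slit" and real: "\<And>x. x > 0 \<Longrightarrow> f (complex_of_real x) \<in> \<real>" and f1: "f 1 = 1"
    and ker: "\<And>(N::nat) a u. inj_on a {..<N} \<Longrightarrow> (\<And>k. k < N \<Longrightarrow> 0 < a k) \<Longrightarrow>
      0 \<le> (\<Sum>k<N. \<Sum>l<N. u k * u l * ((a l * Re (f (complex_of_real ((a k)\<^sup>2))) + a k * Re (f (complex_of_real ((a l)\<^sup>2)))) / (a k + a l)))"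
  shows "\<exists>w s J. harm_approx w s J f"
proof -
  define W where "W \<zeta> = (1 - \<zeta>) / (1 + \<zeta>)" for \<zeta> :: complex
  define G where "G \<zeta> = f ((W \<zeta>)\<^sup>2) / W \<zeta>" for \<zeta>
  have Wp: "Re (W \<zeta>) > 0" "W \<zeta> \<noteq> 0" if "cmod \<zeta> < 1" for \<zeta>
    using cayley_disc_inv(1)[OF that] unfolding W_def[symmetric] by auto
  have Wh: "W holomorphic_on ball 0 1" unfolding W_def[abs_def]
    using cayley_disc_inv(2) by (intro holomorphic_intros) auto
  have Gh: "G holomorphic_on ball 0 1"
  proof -
    have "(f \<circ> (\<lambda>\<zeta>. (W \<zeta>)\<^sup>2)) holomorphic_on ball 0 1"
      by (rule holomorphic_on_compose_gen[OF _ f]) (auto intro!: holomorphic_intros Wh square_in_slit Wp)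
    thus ?thesis unfolding G_def[abs_def] o_def using Wp(2) by (intro holomorphic_intros Wh) auto
  qed
  define cG where "cG n = (deriv ^^ n) G 0 / fact n" for n
  define c where "c n = Re (cG n)" for n
  define g where "g x = Re (G (complex_of_real x))" for x
  have Gs: "(\<lambda>n. cG n * \<zeta> ^ n) sums G \<zeta>" if "cmod \<zeta> < 1" for \<zeta>
    using holomorphic_power_series[OF Gh, of \<zeta>] that unfolding cG_def by simp
  have Wr: "W (complex_of_real x) = complex_of_real ((1 - x) / (1 + x))" for x
    unfolding W_def by simp
  have apos: "(1 - x) / (1 + x) > 0" if "\<bar>x\<bar> < 1" for x :: real using that by auto
  have Gr: "G (complex_of_real x) = complex_of_real (Re (f (complex_of_real (((1 - x) / (1 + x))\<^sup>2))) / ((1 - x) / (1 + x)))"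
    if x: "\<bar>x\<bar> < 1" for x
  proof -
    have "f (complex_of_real (((1 - x) / (1 + x))\<^sup>2)) \<in> \<real>" by (rule real zero_less_power apos x)+
    hence "f (complex_of_real (((1 - x) / (1 + x))\<^sup>2)) = complex_of_real (Re (f (complex_of_real (((1 - x) / (1 + x))\<^sup>2))))"
      by (simp only: of_real_Re)
    thus ?thesis unfolding G_def Wr of_real_power[symmetric] by (metis of_real_divide)
  qed
  have gr: "g x = Re (f (complex_of_real (((1 - x) / (1 + x))\<^sup>2))) / ((1 - x) / (1 + x))"
    "G (complex_of_real x) = complex_of_real (g x)" if "\<bar>x\<bar> < 1" for x
    unfolding g_def Gr[OF that] by simp_all
  have gs: "(\<lambda>n. c n * x ^ n) sums g x" if x: "\<bar>x\<bar> < 1" for x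
  proof -
    have "(\<lambda>n. Re (cG n * complex_of_real x ^ n)) sums Re (G (complex_of_real x))"
      using sums_Re[OF Gs[of "complex_of_real x"]] x by simp
    thus ?thesis unfolding g_def c_def by (simp flip: of_real_power)
  qed
  \<comment> \<open>A crude bound from convergence at 1/2, just enough to start. Positivity later
    improves it to |c_n| \<le> 2.\<close>
  obtain C where C: "\<And>n. \<bar>c n\<bar> \<le> C * 2 ^ n"
  proof -
    have "(\<lambda>n. c n * (1/2) ^ n) \<longlonglongrightarrow> 0"
      using gs[of "1/2"] by (intro summable_LIMSEQ_zero) (auto simp: sums_iff)
    then obtain K where "\<And>n. norm (c n * (1/2) ^ n) \<le> K"
      using convergent_imp_Bseq[of "\<lambda>n. c n * (1/2) ^ n"] unfolding Bseq_def convergent_def by blast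
    hence "\<bar>c n\<bar> \<le> K * 2 ^ n" for n by (simp add: abs_mult power_divide field_simps)
    thus ?thesis using that by blast
  qed
  have toep: "0 \<le> (\<Sum>m<N. p m * (\<Sum>n<N-m. c n * p (m + n)))" for N p
  proof (rule toeplitz_nonneg[of c C g, OF C])
    show "(\<lambda>n. c n * x ^ n) sums g x" if "0 < x" "x < 1/2" for x using gs[of x] that by simp
    fix x u :: "nat \<Rightarrow> real" assume inj: "inj_on x {..<N}" and x: "\<And>k. k < N \<Longrightarrow> 0 < x k \<and> x k < 1/2"
    define a where "a k = (1 - x k) / (1 + x k)" for k
    define F where "F k = Re (f (complex_of_real ((a k)\<^sup>2)))" for k
    have a: "a k > 0" if "k < N" for k unfolding a_def using x[OF that] by (intro apos) auto
    have inja: "inj_on a {..<N}"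
    proof (rule inj_onI)
      fix k l assume kl: "k \<in> {..<N}" "l \<in> {..<N}" "a k = a l"
      have "1 + x k \<noteq> 0" "1 + x l \<noteq> 0" using x[of k] x[of l] kl by auto
      hence "(1 - x k) * (1 + x l) = (1 - x l) * (1 + x k)" using kl(3) unfolding a_def by (simp add: field_simps)
      hence "x k = x l" by (simp add: algebra_simps)
      thus "k = l" using inj kl by (auto dest: inj_onD)
    qed
    \<comment> \<open>Under a = (1 - x)/(1 + x) one has a_k + a_l = 2 (1 - x_k x_l) / ((1 + x_k)(1 +
      x_l)), and F = a g gives a_l F_k + a_k F_l = a_k a_l (g_k + g_l). The rescaled weights absorb
      these product factors, leaving half the disc kernel.\<close>
    define u' where "u' k = u k / (a k * (1 + x k))" for k
    have "0 \<le> (\<Sum>k<N. \<Sum>l<N. u' k * u' l * ((a l * F k + a k * F l) / (a k + a l)))"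
      unfolding F_def by (rule ker[OF inja a])
    also have "\<dots> = (\<Sum>k<N. \<Sum>l<N. (u k * u l * ((g (x k) + g (x l)) / (1 - x k * x l))) / 2)"
    proof (intro sum.cong refl)
      fix k l assume "k \<in> {..<N}" "l \<in> {..<N}"
      hence kl: "k < N" "l < N" by auto
      have gk: "g (x k) = F k / a k" "g (x l) = F l / a l"
      proof -
        have i: "\<bar>x k\<bar> < 1" "\<bar>x l\<bar> < 1" using x[OF kl(1)] x[OF kl(2)] by auto
        show "g (x k) = F k / a k" "g (x l) = F l / a l" unfolding F_def a_def by (rule gr(1)[OF i(1)], rule gr(1)[OF i(2)])
      qed
      have "x k * x l < 1 * 1" by (rule mult_strict_mono) (use x[OF kl(1)] x[OF kl(2)] in auto)
      hence p: "1 - x k * x l > 0" by simp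
      have q: "1 + x k > 0" "1 + x l > 0" "a k > 0" "a l > 0" using x[OF kl(1)] x[OF kl(2)] a kl by auto
      have s: "a k + a l = 2 * (1 - x k * x l) / ((1 + x k) * (1 + x l))"
        using q(1,2) unfolding a_def by (simp add: field_simps)
      have "u' k * u' l * ((a l * F k + a k * F l) / (a k + a l)) =
         u k * u l * ((a l * F k + a k * F l) / (a k * a l)) / (2 * (1 - x k * x l))"
        unfolding s u'_def using q p by (simp add: divide_simps)
      also have "(a l * F k + a k * F l) / (a k * a l) = g (x k) + g (x l)"
        unfolding gk using q by (simp add: field_simps)
      finally show "u' k * u' l * ((a l * F k + a k * F l) / (a k + a l)) =
         (u k * u l * ((g (x k) + g (x l)) / (1 - x k * x l))) / 2" by simp
    qed
    also have "\<dots> = (\<Sum>k<N. \<Sum>l<N. u k * u l * ((g (x k) + g (x l)) / (1 - x k * x l))) / 2"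
      by (simp add: sum_divide_distrib)
    finally show "0 \<le> (\<Sum>k<N. \<Sum>l<N. u k * u l * ((g (x k) + g (x l)) / (1 - x k * x l)))" by simp
  qed
  define Wf where "Wf N t = (\<Sum>n<N. (real N - real n) * c n * cos (real n * t))" for N t
  have Wf: "0 \<le> Wf N t" for N t unfolding Wf_def by (rule fejer_nonneg[OF toep])
  \<comment> \<open>The normalisation f(1) = 1 becomes the total mass of the weights: 1 corresponds
    to \<zeta> = 0, and c_0 is the sum of the w's.\<close>
  have c0: "c 0 = 1" unfolding c_def cG_def G_def W_def using f1 by simp
  define t where "t N j = 2 * pi * real j / real (2 * N)" for N j :: nat
  \<comment> \<open>One factor N turns N - n into the Fejer factor 1 - n/N; the factor 2 N averages
    over the sample points.\<close>
  define w where "w N j = Wf N (t N j) / (2 * real N * real N)" for N j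
  define s where "s N j = (1 + cos (t N j)) / 2" for N j
  define e where "e n = (if n = 0 then 1 else 2 :: real)" for n :: nat
  \<comment> \<open>The Taylor coefficients, in \<zeta>, of the N-th approximant divided by w;
    discrete orthogonality identifies the first N of them with Fejer-damped c_n.\<close>
  define b where "b N n = e n * (\<Sum>j<2*N. w N j * cos (real n * t N j))" for N n
  have w0: "w N j \<ge> 0" for N j unfolding w_def using Wf by simp
  have s0: "0 \<le> s N j" for N j
  proof -
    have "(1 + - 1) / 2 \<le> s N j" unfolding s_def
      by (intro divide_right_mono add_left_mono cos_ge_minus_one) simp
    thus ?thesis by simp
  qed
  have s1: "s N j \<le> 1" for N j
  proof -
    have "s N j \<le> (1 + 1) / 2" unfolding s_def by (intro divide_right_mono add_left_mono cos_le_one) simp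
    thus ?thesis by simp
  qed
  have bN: "b N n = (1 - real n / real N) * c n" if n: "n < N" for N n
  proof -
    have "(\<Sum>j<2*N. Wf N (t N j) * cos (real n * t N j)) =
       (\<Sum>j<2*N. \<Sum>k<N. ((real N - real k) * c k) * (cos (real k * t N j) * cos (real n * t N j)))"
      unfolding Wf_def sum_distrib_right by (simp add: mult_ac)
    also have "\<dots> = (\<Sum>k<N. \<Sum>j<2*N. ((real N - real k) * c k) * (cos (real k * t N j) * cos (real n * t N j)))" by (rule sum.swap)
    also have "\<dots> = (\<Sum>k<N. ((real N - real k) * c k) * (if k = n then (if n = 0 then 2 * real N else real N) else 0))"
      unfolding sum_distrib_left[symmetric] t_def using n by (intro sum.cong refl) (subst sum_cos_mult_roots, auto)
    also have "\<dots> = (\<Sum>k<N. if k = n then ((real N - real n) * c n) * (if n = 0 then 2 * real N else real N) else 0)"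
      by (intro sum.cong) auto
    also have "\<dots> = ((real N - real n) * c n) * (if n = 0 then 2 * real N else real N)" using n by simp
    finally have 1: "(\<Sum>j<2*N. Wf N (t N j) * cos (real n * t N j)) = ((real N - real n) * c n) * (if n = 0 then 2 * real N else real N)" .
    have "b N n = e n * ((\<Sum>j<2*N. Wf N (t N j) * cos (real n * t N j)) / (2 * real N * real N))"
      unfolding b_def w_def sum_divide_distrib by (simp add: mult_ac)
    also have "\<dots> = (1 - real n / real N) * c n" unfolding 1 e_def using n by (simp add: field_simps)
    finally show ?thesis .
  qed
  have bb: "\<bar>b N n\<bar> \<le> 2" if N: "N > 0" for N n
  proof -
    have "(\<Sum>j<2*N. w N j) = 1" using bN[OF N] c0 by (simp add: b_def e_def)
    moreover have "\<bar>\<Sum>j<2*N. w N j * cos (real n * t N j)\<bar> \<le> (\<Sum>j<2*N. w N j)"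
      by (intro order_trans[OF sum_abs] sum_mono) (simp add: abs_mult w0 mult_left_le)
    ultimately show ?thesis unfolding b_def e_def by auto
  qed
  have blim: "(\<lambda>N. b N n) \<longlonglongrightarrow> c n" for n
  proof -
    have "(\<lambda>N. (1 - real n * inverse (real N)) * c n) \<longlonglongrightarrow> (1 - real n * 0) * c n"
      by (intro tendsto_intros LIMSEQ_inverse_real_of_nat_add lim_inverse_n)
    hence "(\<lambda>N. (1 - real n / real N) * c n) \<longlonglongrightarrow> c n" by (simp add: divide_inverse)
    moreover have "\<forall>\<^sub>F N in sequentially. (1 - real n / real N) * c n = b N n"
      using eventually_gt_at_top[of n] by eventually_elim (simp add: bN)
    ultimately show ?thesis by (rule Lim_transform_eventually)
  qed
  \<comment> \<open>Every b is a cosine average against nonnegative weights of mass 1, so it is at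
    most 2 in modulus, and the bound passes to the limit. This gives geometric domination on the
    whole open disc.\<close>
  have cb: "\<bar>c n\<bar> \<le> 2" for n
  proof (rule tendsto_upperbound[OF tendsto_rabs[OF blim[of n]]])
    show "\<forall>\<^sub>F N in sequentially. \<bar>b N n\<bar> \<le> 2" using eventually_gt_at_top[of 0] by eventually_elim (rule bb)
  qed simp
  define E where "E r N = (\<Sum>n. \<bar>b N n - c n\<bar> * r ^ n)" for r :: real and N
  have bcb: "\<bar>b N n - c n\<bar> \<le> 4" if "N > 0" for N n using bb[OF that, of n] cb[of n] by linarith
  have Esum: "summable (\<lambda>n. \<bar>b N n - c n\<bar> * r ^ n)" if "0 \<le> r" "r < 1" "N > 0" for r N
  proof (rule summable_comparison_test'[of "\<lambda>n. 4 * r ^ n"])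
    show "summable (\<lambda>n. 4 * r ^ n)" using that by (intro summable_mult summable_geometric) simp
    show "norm (\<bar>b N n - c n\<bar> * r ^ n) \<le> 4 * r ^ n" for n
      using bcb[OF that(3), of n] that by (simp add: abs_mult mult_right_mono)
  qed
  have Elim: "E r \<longlonglongrightarrow> 0" if r: "0 \<le> r" "r < 1" for r
  proof -
    have "((\<lambda>N. suminf (\<lambda>n. \<bar>b N n - c n\<bar> * r ^ n)) \<longlongrightarrow> suminf (\<lambda>n. \<bar>c n - c n\<bar> * r ^ n)) sequentially"
    proof (intro conjunct2[OF conjunct2[OF tannerys_theorem[where M="\<lambda>n. 4 * r ^ n"]]])
      show "((\<lambda>N. \<bar>b N n - c n\<bar> * r ^ n) \<longlongrightarrow> \<bar>c n - c n\<bar> * r ^ n) sequentially" for n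
        by (intro tendsto_intros blim)
      have "\<forall>\<^sub>F (n, N) in sequentially \<times>\<^sub>F sequentially. N > (0::nat)"
        using eventually_prodI[OF always_eventually[of "\<lambda>_. True" "sequentially"] eventually_gt_at_top[of "0::nat"]]
        by (simp add: case_prod_unfold)
      thus "\<forall>\<^sub>F (n, N) in sequentially \<times>\<^sub>F sequentially. norm (\<bar>b N n - c n\<bar> * r ^ n) \<le> 4 * r ^ n"
      proof eventually_elim
        case (elim z)
        thus ?case using bcb[of "snd z" "fst z"] r by (auto simp: case_prod_unfold abs_mult intro!: mult_right_mono)
      qed
      show "summable (\<lambda>n. 4 * r ^ n)" using r by (intro summable_mult summable_geometric) simp
    qed simp
    thus ?thesis unfolding E_def[abs_def] by simp
  qed
  \<comment> \<open>The c_n are only the real parts of the Taylor coefficients of G. Since G is real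
    on (0, 1), both series agree there, and hence on the disc by the identity theorem.\<close>
  have Gc: "(\<lambda>n. of_real (c n) * \<zeta> ^ n) sums G \<zeta>" if \<zeta>: "cmod \<zeta> < 1" for \<zeta>
  proof -
    define G2 where "G2 \<zeta> = (\<Sum>n. of_real (c n) * \<zeta> ^ n)" for \<zeta> :: complex
    have G2s: "(\<lambda>n. of_real (c n) * \<zeta> ^ n) sums G2 \<zeta>" if "cmod \<zeta> < 1" for \<zeta>
    proof -
      have "summable (\<lambda>n. of_real (c n) * \<zeta> ^ n)"
      proof (rule summable_comparison_test'[of "\<lambda>n. 2 * cmod \<zeta> ^ n"])
        show "summable (\<lambda>n. 2 * cmod \<zeta> ^ n)" using that by (intro summable_mult summable_geometric) simp
        show "norm (of_real (c n) * \<zeta> ^ n) \<le> 2 * cmod \<zeta> ^ n" for n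
          using cb[of n] by (simp add: norm_mult norm_power mult_right_mono)
      qed
      thus ?thesis unfolding G2_def by (rule summable_sums)
    qed
    have G2h: "G2 holomorphic_on ball 0 1"
      by (rule power_series_holomorphic[of 0 1 "\<lambda>n. of_real (c n)"]) (use G2s in simp)
    have "G \<zeta> - G2 \<zeta> = 0"
    proof (rule analytic_continuation[of "\<lambda>z. G z - G2 z" "ball 0 1" "complex_of_real ` {0<..<1}" 0 \<zeta>])
      show "(\<lambda>z. G z - G2 z) holomorphic_on ball 0 1" by (intro holomorphic_intros Gh G2h)
      show "0 islimpt complex_of_real ` {0<..<1}"
        unfolding islimpt_approachable
      proof (intro allI impI)
        fix d :: real assume d: "d > 0"
        define x where "x = min (d/2) (1/2)"
        have "0 < x" "x < 1" "x < d" using d by (auto simp: x_def)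
        thus "\<exists>x'\<in>complex_of_real ` {0<..<1}. x' \<noteq> 0 \<and> dist x' 0 < d"
          by (intro bexI[of _ "complex_of_real x"]) auto
      qed
      fix z assume "z \<in> complex_of_real ` {0<..<1}"
      then obtain x where x: "z = complex_of_real x" "0 < x" "x < 1" by auto
      have "(\<lambda>n. complex_of_real (c n * x ^ n)) sums complex_of_real (g x)" by (rule sums_of_real[OF gs]) (use x in simp)
      hence "(\<lambda>n. of_real (c n) * z ^ n) sums complex_of_real (g x)" using x by simp
      moreover have "(\<lambda>n. of_real (c n) * z ^ n) sums G2 z" using x by (intro G2s) simp
      ultimately have "G2 z = complex_of_real (g x)" by (rule sums_unique2[symmetric])
      thus "G z - G2 z = 0" using gr(2)[of x] x by simp
    qed (use \<zeta> in auto)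
    thus ?thesis using G2s[OF \<zeta>] by simp
  qed
  \<comment> \<open>The error is a power series in \<zeta> with coefficients b - c, bounded by an
    expression in which the compact set enters only through r < 1 and the size of the square root of
    z; this gives uniformity.\<close>
  have key: "cmod ((\<Sum>j<2*N. of_real (w N j) * wharm (s N j) z) - f z) \<le> cmod (csqrt z) * E r N"
    if z: "z \<in> slit" and r: "cmod ((1 - csqrt z) / (1 + csqrt z)) \<le> r" "r < 1" and N: "N > 0" for z r N
  proof -
    define \<zeta> where "\<zeta> = (1 - csqrt z) / (1 + csqrt z)"
    note cd = cayley_disc[OF Re_csqrt_pos[OF z]]
    have \<zeta>: "cmod \<zeta> < 1" "csqrt z = (1 - \<zeta>) / (1 + \<zeta>)" using cd unfolding \<zeta>_def by auto
    have Wz: "W \<zeta> = csqrt z" unfolding W_def \<zeta>(2) ..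
    have csq: "(csqrt z)\<^sup>2 = z" by simp
    have nz: "csqrt z \<noteq> 0" using Re_csqrt_pos[OF z] by auto
    have fz: "f z = csqrt z * G \<zeta>" unfolding G_def Wz csq using nz by simp
    have "(\<lambda>n. \<Sum>j<2*N. of_real (w N j) * (csqrt z * (of_real ((if n = 0 then 1 else 2) * cos (real n * t N j)) * \<zeta> ^ n)))
       sums (\<Sum>j<2*N. of_real (w N j) * wharm ((1 + cos (t N j)) / 2) ((csqrt z)\<^sup>2))"
      by (intro sums_sum sums_mult harm_kernel_sums[OF \<zeta>(1,2)])
    moreover have "(\<Sum>j<2*N. of_real (w N j) * (csqrt z * (of_real ((if n = 0 then 1 else 2) * cos (real n * t N j)) * \<zeta> ^ n))) =
        csqrt z * (of_real (b N n) * \<zeta> ^ n)" for n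
      unfolding b_def e_def of_real_mult of_real_sum sum_distrib_left sum_distrib_right by (intro sum.cong) auto
    ultimately have s1: "(\<lambda>n. csqrt z * (of_real (b N n) * \<zeta> ^ n)) sums (\<Sum>j<2*N. of_real (w N j) * wharm (s N j) z)"
      unfolding s_def csq by simp
    have s2: "(\<lambda>n. csqrt z * (of_real (c n) * \<zeta> ^ n)) sums f z" unfolding fz by (intro sums_mult Gc \<zeta>)
    have s3: "(\<lambda>n. csqrt z * (of_real (b N n - c n) * \<zeta> ^ n)) sums ((\<Sum>j<2*N. of_real (w N j) * wharm (s N j) z) - f z)"
      using sums_diff[OF s1 s2] by (simp add: algebra_simps)
    have r0: "0 \<le> r" using r(1) norm_ge_zero order_trans by blast
    have "cmod ((\<Sum>j<2*N. of_real (w N j) * wharm (s N j) z) - f z) = cmod (\<Sum>n. csqrt z * (of_real (b N n - c n) * \<zeta> ^ n))"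
      using s3 by (simp add: sums_iff)
    also have "\<dots> \<le> (\<Sum>n. cmod (csqrt z) * (\<bar>b N n - c n\<bar> * r ^ n))"
    proof (rule norm_suminf_le)
      show "summable (\<lambda>n. cmod (csqrt z) * (\<bar>b N n - c n\<bar> * r ^ n))" by (intro summable_mult Esum r0 r N)
      fix n
      have "cmod \<zeta> ^ n \<le> r ^ n" using r(1) unfolding \<zeta>_def by (intro power_mono) auto
      thus "norm (csqrt z * (of_real (b N n - c n) * \<zeta> ^ n)) \<le> cmod (csqrt z) * (\<bar>b N n - c n\<bar> * r ^ n)"
        unfolding norm_mult norm_power norm_of_real by (intro mult_left_mono) auto
    qed
    also have "\<dots> = cmod (csqrt z) * E r N" unfolding E_def by (intro suminf_mult Esum r0 r N)
    finally show ?thesis .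
  qed
  have "harm_approx w s (\<lambda>N. 2 * N) f"
    unfolding harm_approx_def
  proof (intro conjI allI impI)
    fix K assume K: "compact K" "K \<subseteq> slit"
    have cc: "continuous_on K csqrt"
      using csqrt_holomorphic_slit K(2) holomorphic_on_imp_continuous_on holomorphic_on_subset by blast
    have cz: "continuous_on K (\<lambda>z. cmod ((1 - csqrt z) / (1 + csqrt z)))"
      using cayley_disc(2)[OF Re_csqrt_pos] K(2) by (intro continuous_intros cc) auto
    have "\<exists>r<1. \<forall>z\<in>K. cmod ((1 - csqrt z) / (1 + csqrt z)) \<le> r"
    proof (cases "K = {}")
      case False
      from continuous_attains_sup[OF K(1) False cz] obtain z0 where
        "z0 \<in> K" "\<forall>z\<in>K. cmod ((1 - csqrt z) / (1 + csqrt z)) \<le> cmod ((1 - csqrt z0) / (1 + csqrt z0))" by blast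
      thus ?thesis using cayley_disc(1)[OF Re_csqrt_pos] K(2) by (intro exI[of _ "cmod ((1 - csqrt z0) / (1 + csqrt z0))"]) auto
    qed (auto intro!: exI[of _ 0])
    then obtain r' where r': "r' < 1" "\<And>z. z \<in> K \<Longrightarrow> cmod ((1 - csqrt z) / (1 + csqrt z)) \<le> r'" by blast
    define r where "r = max r' 0"
    have r: "0 \<le> r" "r < 1" "\<And>z. z \<in> K \<Longrightarrow> cmod ((1 - csqrt z) / (1 + csqrt z)) \<le> r"
      using r' unfolding r_def by (auto simp: le_max_iff_disj)
    obtain B where B: "B > 0" "\<And>z. z \<in> K \<Longrightarrow> cmod (csqrt z) \<le> B"
      using compact_imp_bounded[OF compact_continuous_image[OF cc K(1)]] unfolding bounded_pos by auto
    show "uniform_limit K (\<lambda>N z. \<Sum>j<2*N. of_real (w N j) * wharm (s N j) z) f sequentially"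
    proof (rule uniform_limitI)
      fix \<epsilon> :: real assume \<epsilon>: "\<epsilon> > 0"
      have "\<forall>\<^sub>F N in sequentially. \<bar>E r N - 0\<bar> < \<epsilon> / B"
        using tendstoD[OF Elim[OF r(1,2)], of "\<epsilon> / B"] \<epsilon> B(1) by (simp add: dist_real_def)
      thus "\<forall>\<^sub>F N in sequentially. \<forall>z\<in>K. dist (\<Sum>j<2*N. of_real (w N j) * wharm (s N j) z) (f z) < \<epsilon>"
        using eventually_gt_at_top[of 0]
      proof eventually_elim
        case (elim N)
        show ?case
        proof
          fix z assume z: "z \<in> K"
          have "dist (\<Sum>j<2*N. of_real (w N j) * wharm (s N j) z) (f z) \<le> cmod (csqrt z) * E r N"
            unfolding dist_norm by (rule key[OF _ r(3)[OF z] r(2) elim(2)]) (use z K in auto)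
          also have "\<dots> \<le> cmod (csqrt z) * \<bar>E r N\<bar>" by (intro mult_left_mono) auto
          also have "\<dots> \<le> B * \<bar>E r N\<bar>" using B(2)[OF z] by (intro mult_right_mono) auto
          also have "\<dots> < \<epsilon>" using elim(1) B(1) by (simp add: field_simps)
          finally show "dist (\<Sum>j<2*N. of_real (w N j) * wharm (s N j) z) (f z) < \<epsilon>" .
        qed
      qed
    qed
  qed (use w0 s0 s1 f in auto)
  thus ?thesis by blast
qed

text \<open>The substitution x = (1 - a)/(1 + a) maps 1/(a_k + a_l), up to product factors, to 1/(1
  - x_k x_l), whose geometric expansion is a sum of squares.\<close>

lemma cauchy_kernel_nonneg:
  fixes a u :: "nat \<Rightarrow> real"
  assumes a: "\<And>k. k < N \<Longrightarrow> 0 < a k"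
  shows "0 \<le> (\<Sum>k<N. \<Sum>l<N. u k * u l / (a k + a l))"
proof -
  define x where "x k = (1 - a k) / (1 + a k)" for k
  define v where "v k = u k * (1 + x k)" for k
  have x: "\<bar>x k\<bar> < 1" "1 + x k = 2 / (1 + a k)" if "k < N" for k
    using a[OF that] unfolding x_def by (auto simp: abs_less_iff field_simps)
  have "(\<lambda>m. \<Sum>k<N. \<Sum>l<N. v k * v l * (x k * x l) ^ m) sums (\<Sum>k<N. \<Sum>l<N. v k * v l * (1 / (1 - x k * x l)))"
  proof (intro sums_sum sums_mult geometric_sums)
    fix k l assume "k \<in> {..<N}" "l \<in> {..<N}"
    hence "\<bar>x k\<bar> * \<bar>x l\<bar> < 1 * 1" using x by (intro mult_strict_mono') auto
    thus "norm (x k * x l) < 1" by (simp add: abs_mult)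
  qed
  moreover have "0 \<le> (\<Sum>k<N. \<Sum>l<N. v k * v l * (x k * x l) ^ m)" for m
  proof -
    have "(\<Sum>k<N. \<Sum>l<N. v k * v l * (x k * x l) ^ m) = (\<Sum>k<N. v k * x k ^ m) * (\<Sum>l<N. v l * x l ^ m)"
      by (simp add: sum_product power_mult_distrib mult_ac)
    thus ?thesis by simp
  qed
  ultimately have "0 \<le> (\<Sum>k<N. \<Sum>l<N. v k * v l * (1 / (1 - x k * x l)))"
    by (rule sums_le[OF _ sums_zero, rotated])
  also have "\<dots> = (\<Sum>k<N. \<Sum>l<N. 2 * (u k * u l / (a k + a l)))"
  proof (intro sum.cong refl)
    fix k l assume "k \<in> {..<N}" "l \<in> {..<N}"
    hence p: "0 < a k" "0 < a l" and x': "1 + x k = 2 / (1 + a k)" "1 + x l = 2 / (1 + a l)" using a x by auto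
    have s: "1 - x k * x l = 2 * (a k + a l) / ((1 + a k) * (1 + a l))"
    proof -
      have n: "1 + a k \<noteq> 0" "1 + a l \<noteq> 0" using p by auto
      have "1 - x k * x l = ((1 + a k) * (1 + a l)) / ((1 + a k) * (1 + a l)) - ((1 - a k) * (1 - a l)) / ((1 + a k) * (1 + a l))"
        unfolding x_def using n by simp
      also have "\<dots> = ((1 + a k) * (1 + a l) - (1 - a k) * (1 - a l)) / ((1 + a k) * (1 + a l))"
        by (rule diff_divide_distrib[symmetric])
      also have "(1 + a k) * (1 + a l) - (1 - a k) * (1 - a l) = 2 * (a k + a l)" by (simp add: algebra_simps)
      finally show ?thesis .
    qed
    show "v k * v l * (1 / (1 - x k * x l)) = 2 * (u k * u l / (a k + a l))"
    proof -
      have q: "1 + a k \<noteq> 0" "1 + a l \<noteq> 0" "a k + a l \<noteq> 0" using p by auto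
      have e: "(u1 * (2 / P)) * (u2 * (2 / Q)) * (1 / (2 * R / (P * Q))) = 2 * (u1 * u2 / R)"
        if "P \<noteq> 0" "Q \<noteq> 0" "R \<noteq> 0" for u1 u2 P Q R :: real using that by (simp add: field_simps)
      show ?thesis unfolding s v_def x' by (rule e[OF q])
    qed
  qed
  also have "\<dots> = 2 * (\<Sum>k<N. \<Sum>l<N. u k * u l / (a k + a l))" by (simp only: sum_distrib_left)
  finally show ?thesis by simp
qed

text \<open>For the square root the kernel is 2 a_k a_l / (a_k + a_l), a rescaled Cauchy kernel.
  Positivity is thus direct, with no appeal to operator monotonicity of the square root.\<close>

lemma harm_approx_csqrt: "\<exists>w s J. harm_approx w s J csqrt"
proof (rule harm_approx_exists[OF csqrt_holomorphic_slit])
  show "csqrt (complex_of_real x) \<in> \<real>" if "x > 0" for x using that by (simp flip: of_real_sqrt)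
  fix N :: nat and a u :: "nat \<Rightarrow> real" assume a: "\<And>k. k < N \<Longrightarrow> 0 < a k"
  have "0 \<le> 2 * (\<Sum>k<N. \<Sum>l<N. (u k * a k) * (u l * a l) / (a k + a l))"
    using cauchy_kernel_nonneg[of N a "\<lambda>k. u k * a k"] a by simp
  also have "\<dots> = (\<Sum>k<N. \<Sum>l<N. u k * u l * ((a l * Re (csqrt (complex_of_real ((a k)\<^sup>2))) +
      a k * Re (csqrt (complex_of_real ((a l)\<^sup>2)))) / (a k + a l)))"
    unfolding sum_distrib_left
  proof (intro sum.cong refl)
    fix k l assume "k \<in> {..<N}" "l \<in> {..<N}"
    hence p: "0 < a k" "0 < a l" using a by auto
    have "Re (csqrt (complex_of_real ((a j)\<^sup>2))) = a j" if "0 < a j" for j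
      unfolding of_real_power using csqrt_square[of "complex_of_real (a j)"] that by simp
    thus "2 * (u k * a k * (u l * a l) / (a k + a l)) =
        u k * u l * ((a l * Re (csqrt (complex_of_real ((a k)\<^sup>2))) + a k * Re (csqrt (complex_of_real ((a l)\<^sup>2)))) / (a k + a l))"
      using p by (simp add: field_simps)
  qed
  finally show "0 \<le> \<dots>" .
qed simp

section \<open>From operator monotonicity to a positive kernel\<close>

definition divided_diff :: "(complex \<Rightarrow> complex) \<Rightarrow> real \<Rightarrow> real \<Rightarrow> complex" where
  "divided_diff f x y = (if x = y then deriv f (of_real x) else (f (of_real x) - f (of_real y)) / of_real (x - y))"

text \<open>Partial fractions reduce x \<noteq> y to two Cauchy formulas; for x = y the double pole
  has residue f'(x).\<close>

lemma contour_integral_divided_diff: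
  assumes \<gamma>: "valid_path \<gamma>" "pathfinish \<gamma> = pathstart \<gamma>" "path_image \<gamma> \<subseteq> slit - {of_real x, of_real y}"
    "winding_number \<gamma> (of_real x) = 1" "winding_number \<gamma> (of_real y) = 1"
    and f: "f holomorphic_on slit" and xy: "0 < x" "0 < y"
  shows "contour_integral \<gamma> (\<lambda>z. f z * (1 / (z - of_real x) * (1 / (z - of_real y)))) = 2 * pi * \<i> * divided_diff f x y"
proof -
  have wn: "w \<notin> slit \<Longrightarrow> winding_number \<gamma> w = 0" for w
    using \<gamma> by (intro winding_slit_outside) auto
  show ?thesis
  proof (cases "x = y")
    case True
    have "contour_integral \<gamma> (\<lambda>z. f z / (z - of_real x) ^ Suc 1) =
        2 * pi * \<i> * (\<Sum>p\<in>{of_real x}. winding_number \<gamma> p * residue (\<lambda>z. f z / (z - of_real x) ^ Suc 1) p)"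
      using \<gamma> True wn by (intro Residue_theorem[of slit])
        (auto intro!: holomorphic_intros holomorphic_on_subset[OF f] starlike_imp_connected starlike_slit)
    also have "\<dots> = 2 * pi * \<i> * deriv f (of_real x)"
      using \<gamma>(4) residue_holomorphic_over_power[OF open_slit, of "of_real x" f 1] f xy by simp
    finally show ?thesis using True by (simp add: divided_diff_def power2_eq_square)
  next
    case False
    have i: "((\<lambda>w. f w / (w - of_real a)) has_contour_integral (2 * pi * \<i> * f (of_real a))) \<gamma>"
      if "a = x \<or> a = y" for a
    proof -
      have "((\<lambda>w. f w / (w - of_real a)) has_contour_integral (2 * pi * \<i> * winding_number \<gamma> (of_real a) * f (of_real a))) \<gamma>"
        using \<gamma> xy that wn by (intro Cauchy_integral_formula_global[of slit] f) auto
      thus ?thesis using \<gamma>(4,5) that by auto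
    qed
    define D where "D = complex_of_real (x - y)"
    have D: "D \<noteq> 0" using False by (simp add: D_def)
    have "((\<lambda>w. (f w / (w - of_real x) - f w / (w - of_real y)) / D) has_contour_integral
        (2 * pi * \<i> * f (of_real x) - 2 * pi * \<i> * f (of_real y)) / D) \<gamma>"
      by (intro has_contour_integral_div has_contour_integral_diff i) auto
    hence "contour_integral \<gamma> (\<lambda>w. (f w / (w - of_real x) - f w / (w - of_real y)) / D) =
      (2 * pi * \<i> * f (of_real x) - 2 * pi * \<i> * f (of_real y)) / D" by (rule contour_integral_unique)
    also have "\<dots> = 2 * pi * \<i> * divided_diff f x y"
      using False by (simp add: divided_diff_def D_def algebra_simps diff_divide_distrib)
    also have "contour_integral \<gamma> (\<lambda>w. (f w / (w - of_real x) - f w / (w - of_real y)) / D) =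
       contour_integral \<gamma> (\<lambda>z. f z * (1 / (z - of_real x) * (1 / (z - of_real y))))"
    proof (rule contour_integral_eq)
      fix w assume "w \<in> path_image \<gamma>"
      hence "w - of_real x \<noteq> 0" "w - of_real y \<noteq> 0" using \<gamma>(3) by auto
      moreover have "D = (w - of_real y) - (w - of_real x)" by (simp add: D_def)
      ultimately show "(f w / (w - of_real x) - f w / (w - of_real y)) / D = f w * (1 / (w - of_real x) * (1 / (w - of_real y)))"
        using D by (simp add: divide_simps) (simp add: algebra_simps)
    qed
    finally show ?thesis .
  qed
qed

text \<open>The second resolvent identity R_1 - R_0 = R_1 (Y_1 - Y_0) R_0, with the scalar kept
  outside so that it cancels in a difference quotient.\<close>

lemma resolvent_identity_entry:
  assumes Y: "Y0 \<in> carrier_mat n n" "Y1 \<in> carrier_mat n n" and z: "z \<notin> spec Y0" "z \<notin> spec Y1"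
    and E: "E \<in> carrier_mat n n" "Y1 = Y0 + c \<cdot>\<^sub>m E" and ij: "i < n" "j < n"
  shows "resolv Y1 z $$ (i,j) - resolv Y0 z $$ (i,j) =
    c * (\<Sum>k<n. \<Sum>l<n. resolv Y1 z $$ (i,k) * E $$ (k,l) * resolv Y0 z $$ (l,j))"
proof -
  note r0 = resolv_props[OF Y(1) z(1)] and r1 = resolv_props[OF Y(2) z(2)]
  let ?R0 = "resolv Y0 z" and ?R1 = "resolv Y1 z"
  let ?A0 = "z \<cdot>\<^sub>m 1\<^sub>m n - Y0" and ?A1 = "z \<cdot>\<^sub>m 1\<^sub>m n - Y1"
  have A: "?A0 \<in> carrier_mat n n" "?A1 \<in> carrier_mat n n" using Y by (auto intro: minus_carrier_mat)
  have d: "c \<cdot>\<^sub>m E = ?A0 - ?A1" using Y E by (intro eq_matI) auto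
  have p: "?R1 * (?A0 * ?R0) = ?R1" unfolding r0(2) using r1(1) by simp
  have q: "?R1 * (?A1 * ?R0) = ?R0"
  proof -
    have "?R1 * (?A1 * ?R0) = (?R1 * ?A1) * ?R0" by (rule assoc_mult_mat[symmetric, OF r1(1) A(2) r0(1)])
    thus ?thesis unfolding r1(3) using r0(1) by simp
  qed
  have "?R1 * ((c \<cdot>\<^sub>m E) * ?R0) = ?R1 * (?A0 * ?R0 - ?A1 * ?R0)"
    unfolding d minus_mult_distrib_mat[OF A r0(1)] ..
  also have "\<dots> = ?R1 * (?A0 * ?R0) - ?R1 * (?A1 * ?R0)"
    by (rule mult_minus_distrib_mat[of _ n n]) (use r0 r1 A in auto)
  also have "\<dots> = ?R1 - ?R0" unfolding p q ..
  finally have e: "?R1 - ?R0 = ?R1 * ((c \<cdot>\<^sub>m E) * ?R0)" ..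
  have cE: "c \<cdot>\<^sub>m E \<in> carrier_mat n n" using E by simp
  have "(?R1 - ?R0) $$ (i,j) = (\<Sum>k<n. ?R1 $$ (i,k) * ((c \<cdot>\<^sub>m E) * ?R0) $$ (k,j))"
    unfolding e by (rule mult_mat_entry[of _ n n _ n]) (use r0 r1 cE ij in auto)
  also have "\<dots> = (\<Sum>k<n. ?R1 $$ (i,k) * (\<Sum>l<n. (c * E $$ (k,l)) * ?R0 $$ (l,j)))"
  proof (intro sum.cong refl arg_cong2[of _ _ _ _ "(*)"])
    fix k assume "k \<in> {..<n}"
    hence k: "k < n" by simp
    have "((c \<cdot>\<^sub>m E) * ?R0) $$ (k,j) = (\<Sum>l<n. (c \<cdot>\<^sub>m E) $$ (k,l) * ?R0 $$ (l,j))"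
      by (rule mult_mat_entry[OF cE r0(1) k ij(2)])
    also have "\<dots> = (\<Sum>l<n. (c * E $$ (k,l)) * ?R0 $$ (l,j))" using E k by (intro sum.cong) auto
    finally show "((c \<cdot>\<^sub>m E) * ?R0) $$ (k,j) = \<dots>" .
  qed
  finally show ?thesis using r0 r1 ij by (simp add: sum_distrib_left mult_ac)
qed

text \<open>The Daleckii-Krein formula: to first order, f acts on the perturbation by entrywise
  multiplication with divided differences, because the resolvent of a diagonal matrix is diagonal.
  The direction \<open>E\<close> may vary with t, as it does in the comparison matrix for which this
  is used.\<close>

lemma mfun_derivative_at_diagonal:
  fixes E :: "real \<Rightarrow> complex mat" and d :: "nat \<Rightarrow> real"
  assumes f: "f holomorphic_on slit" and d: "\<And>i. i < n \<Longrightarrow> 0 < d i"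
    and E: "\<And>t. E t \<in> carrier_mat n n"
    and Ec: "\<And>i j. i < n \<Longrightarrow> j < n \<Longrightarrow> continuous_on {0..1} (\<lambda>t. E t $$ (i,j))"
  defines "Y0 \<equiv> diagm n (\<lambda>i. of_real (d i))"
  defines "Y \<equiv> (\<lambda>t::real. Y0 + of_real t \<cdot>\<^sub>m E t)"
  shows "\<exists>t0>0. t0 \<le> 1 \<and> (\<forall>T i j. (\<forall>N::nat. 0 < T N \<and> T N \<le> t0) \<longrightarrow> T \<longlonglongrightarrow> 0 \<longrightarrow> i < n \<longrightarrow> j < n \<longrightarrow>
    (\<lambda>N. (mfun f (Y (T N)) $$ (i,j) - mfun f Y0 $$ (i,j)) / of_real (T N)) \<longlonglongrightarrow> E 0 $$ (i,j) * divided_diff f (d i) (d j))"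
proof -
  have Y0: "Y0 \<in> carrier_mat n n" unfolding Y0_def by simp
  have Yc: "Y t \<in> carrier_mat n n" for t unfolding Y_def using Y0 E by simp
  obtain \<rho> where \<rho>: "\<rho> > 0" "\<And>i. i < n \<Longrightarrow> \<rho> < d i"
  proof (cases "n = 0")
    case False
    define \<rho> where "\<rho> = Min (d ` {..<n}) / 2"
    have "Min (d ` {..<n}) \<in> d ` {..<n}" using False by (intro Min_in) auto
    hence m: "Min (d ` {..<n}) > 0" using d by auto
    have le: "Min (d ` {..<n}) \<le> d i" if "i < n" for i using that by (intro Min_le) auto
    show ?thesis
    proof (rule that[of \<rho>])
      show "\<rho> > 0" using m by (simp add: \<rho>_def)
      show "\<rho> < d i" if "i < n" for i using le[OF that] m unfolding \<rho>_def by linarith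
    qed
  qed (use that[of 1] in auto)
  \<comment> \<open>Discs about the unperturbed eigenvalues, inside the right half-plane as \<rho> <
    d_i. A single contour around them encloses the spectrum of every \<open>Y t\<close> with 0 \<le>
    t \<le> t0, so the difference quotient can be formed under one integral.\<close>
  define C where "C = (\<Union>i\<in>{..<n}. cball (complex_of_real (d i)) \<rho>)"
  have C: "compact C" unfolding C_def by (intro compact_UN) auto
  have Cs: "C \<subseteq> slit"
  proof
    fix z assume "z \<in> C"
    then obtain i where i: "i < n" "cmod (complex_of_real (d i) - z) \<le> \<rho>" unfolding C_def by (auto simp: dist_norm)
    have "d i - Re z \<le> cmod (complex_of_real (d i) - z)" using complex_Re_le_cmod[of "complex_of_real (d i) - z"] by simp
    hence "Re z > 0" using i \<rho>(2)[OF i(1)] by linarith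
    thus "z \<in> slit" by (rule Re_pos_in_slit)
  qed
  obtain \<gamma> where \<gamma>: "valid_path \<gamma>" "pathfinish \<gamma> = pathstart \<gamma>" "path_image \<gamma> \<subseteq> slit - C"
    "\<And>z. z \<in> C \<Longrightarrow> winding_number \<gamma> z = 1" using contour_exists[OF C Cs] by metis
  have "\<exists>b>0. \<forall>t\<in>{0..1}. \<forall>i<n. \<forall>j<n. cmod (E t $$ (i,j)) \<le> b"
  proof -
    have "\<exists>b. \<forall>t\<in>{0..1}. cmod (E t $$ (i,j)) \<le> b" if "i < n" "j < n" for i j
      using compact_imp_bounded[OF compact_continuous_image[OF Ec[OF that]]] unfolding bounded_iff by auto
    then obtain b where b: "\<And>i j t. i < n \<Longrightarrow> j < n \<Longrightarrow> t \<in> {0..1} \<Longrightarrow> cmod (E t $$ (i,j)) \<le> b i j" by metis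
    define B where "B = 1 + (\<Sum>i<n. \<Sum>j<n. \<bar>b i j\<bar>)"
    have "B > 0" unfolding B_def by (intro add_pos_nonneg sum_nonneg) auto
    moreover have "cmod (E t $$ (i,j)) \<le> B" if "i < n" "j < n" "t \<in> {0..1}" for i j t
    proof -
      have "\<bar>b i j\<bar> \<le> (\<Sum>j<n. \<bar>b i j\<bar>)" using that by (intro member_le_sum[of j "{..<n}" "\<lambda>j. \<bar>b i j\<bar>"]) auto
      also have "\<dots> \<le> (\<Sum>i<n. \<Sum>j<n. \<bar>b i j\<bar>)" using that
        by (intro member_le_sum[of i "{..<n}" "\<lambda>i. \<Sum>j<n. \<bar>b i j\<bar>"] sum_nonneg) auto
      finally show ?thesis using b[OF that] unfolding B_def by linarith
    qed
    ultimately show ?thesis by blast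
  qed
  then obtain b where b: "b > 0" "\<And>t i j. t \<in> {0..1} \<Longrightarrow> i < n \<Longrightarrow> j < n \<Longrightarrow> cmod (E t $$ (i,j)) \<le> b" by blast
  \<comment> \<open>Row sums of the perturbation are at most t n b, which has to stay below \<rho>;
    the summand 1 avoids a zero denominator.\<close>
  define t0 where "t0 = min 1 (\<rho> / (real n * b + 1))"
  have nb: "real n * b + 1 > 0" using b(1) by (simp add: add_nonneg_pos)
  have t0: "t0 > 0" "t0 \<le> 1" "t0 * (real n * b + 1) \<le> \<rho>"
  proof -
    show "t0 > 0" "t0 \<le> 1" unfolding t0_def using \<rho>(1) nb by auto
    have "t0 \<le> \<rho> / (real n * b + 1)" unfolding t0_def by simp
    thus "t0 * (real n * b + 1) \<le> \<rho>" using nb by (simp add: field_simps)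
  qed
  \<comment> \<open>Gershgorin's argument: the eigenvalue equation is read in a coordinate where the
    eigenvector has maximal modulus.\<close>
  have sp: "spec (Y t) \<subseteq> C" if t: "0 \<le> t" "t \<le> t0" for t
  proof
    fix z assume "z \<in> spec (Y t)"
    then obtain v where v: "v \<in> carrier_vec n" "v \<noteq> 0\<^sub>v n" "Y t *\<^sub>v v = z \<cdot>\<^sub>v v" using spec_eigenvalue[OF Yc] by blast
    have n0: "n \<noteq> 0"
    proof
      assume "n = 0"
      hence "v = 0\<^sub>v n" using v(1) by (intro eq_vecI) auto
      thus False using v(2) by simp
    qed
    have "\<exists>i\<in>{..<n}. \<forall>k\<in>{..<n}. cmod (v $ k) \<le> cmod (v $ i)"
    proof -
      have "Max ((\<lambda>i. cmod (v $ i)) ` {..<n}) \<in> (\<lambda>i. cmod (v $ i)) ` {..<n}" using n0 by (intro Max_in) auto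
      then obtain i where "i \<in> {..<n}" "Max ((\<lambda>i. cmod (v $ i)) ` {..<n}) = cmod (v $ i)" by blast
      moreover have "\<forall>k\<in>{..<n}. cmod (v $ k) \<le> Max ((\<lambda>i. cmod (v $ i)) ` {..<n})" by auto
      ultimately show ?thesis by auto
    qed
    then obtain i where i: "i < n" "\<And>k. k < n \<Longrightarrow> cmod (v $ k) \<le> cmod (v $ i)" by auto
    have vi: "cmod (v $ i) > 0"
    proof (rule ccontr)
      assume "\<not> cmod (v $ i) > 0"
      hence "v $ k = 0" if "k < n" for k using i(2)[OF that] by (metis norm_le_zero_iff not_less order_trans)
      hence "v = 0\<^sub>v n" using v(1) by (intro eq_vecI) auto
      thus False using v(2) by simp
    qed
    have "(Y t *\<^sub>v v) $ i = (\<Sum>k<n. Y t $$ (i,k) * v $ k)"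
      using i v(1) Yc[of t] by (simp add: scalar_prod_def lessThan_atLeast0)
    also have "\<dots> = (\<Sum>k<n. (if k = i then of_real (d i) * v $ i else 0) + of_real t * (E t $$ (i,k) * v $ k))"
    proof (rule sum.cong[OF refl])
      fix k assume "k \<in> {..<n}"
      hence "Y t $$ (i,k) = (if i = k then of_real (d i) else 0) + of_real t * E t $$ (i,k)"
        unfolding Y_def Y0_def using i E[of t] by simp
      thus "Y t $$ (i,k) * v $ k = (if k = i then of_real (d i) * v $ i else 0) + of_real t * (E t $$ (i,k) * v $ k)"
        by (auto simp: algebra_simps)
    qed
    also have "\<dots> = of_real (d i) * v $ i + of_real t * (\<Sum>k<n. E t $$ (i,k) * v $ k)"
      using i(1) by (simp add: sum.distrib sum_distrib_left)
    finally have "z * v $ i = of_real (d i) * v $ i + of_real t * (\<Sum>k<n. E t $$ (i,k) * v $ k)"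
      using v i by simp
    hence "(z - of_real (d i)) * v $ i = of_real t * (\<Sum>k<n. E t $$ (i,k) * v $ k)" by (simp add: algebra_simps)
    hence "cmod (z - of_real (d i)) * cmod (v $ i) = t * cmod (\<Sum>k<n. E t $$ (i,k) * v $ k)"
      using t by (metis norm_mult norm_of_real abs_of_nonneg)
    also have "\<dots> \<le> t * (\<Sum>k<n. b * cmod (v $ i))"
      using t t0(2) i b(2)[of t i] b(1) by (intro mult_left_mono sum_norm_le) (auto simp: norm_mult intro!: mult_mono)
    also have "\<dots> = (t * (real n * b)) * cmod (v $ i)" by simp
    finally have "cmod (z - of_real (d i)) \<le> t * (real n * b)" using vi by simp
    also have "\<dots> \<le> t0 * (real n * b + 1)" using t b(1) by (intro mult_mono) auto
    also have "\<dots> \<le> \<rho>" by (rule t0)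
    finally show "z \<in> C" unfolding C_def using i by (auto simp: dist_norm norm_minus_commute intro!: bexI[of _ i])
  qed
  have enc: "encloses \<gamma> (Y t)" if "0 \<le> t" "t \<le> t0" for t
    using \<gamma> sp[OF that] unfolding encloses_def by blast
  have Y00: "Y 0 = Y0" unfolding Y_def using E[of 0] Y0 by (intro eq_matI) auto
  have sp0: "spec Y0 \<subseteq> C" and enc0: "encloses \<gamma> Y0" using sp[of 0] enc[of 0] t0 unfolding Y00 by auto
  have dC: "of_real (d i) \<in> C" if "i < n" for i
    unfolding C_def using that \<rho>(1) by (intro UN_I[of i]) auto
  show ?thesis
  proof (intro exI[of _ t0] conjI allI impI t0)
    fix T i j assume T: "\<forall>N::nat. 0 < T N \<and> T N \<le> t0" and T0: "T \<longlonglongrightarrow> 0" and ij: "i < n" "j < n"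
    define U where "U = slit - C"
    have U: "open U" unfolding U_def using C by (intro open_Diff open_slit compact_imp_closed)
    have UU: "z \<notin> spec (Y t)" "z \<notin> spec Y0" if "z \<in> U" "0 \<le> t" "t \<le> t0" for z t
      using that sp sp0 unfolding U_def by blast+
    define H where "H t z = f z * (\<Sum>k<n. \<Sum>l<n. resolv (Y t) z $$ (i,k) * E t $$ (k,l) * resolv Y0 z $$ (l,j))" for t z
    have hY: "H t holomorphic_on U" if "0 \<le> t" "t \<le> t0" for t
      unfolding H_def[abs_def]
      by (intro holomorphic_intros resolv_holomorphic_on[OF Yc] resolv_holomorphic_on[OF Y0] holomorphic_on_subset[OF f])
         (use ij UU that in \<open>auto simp: U_def\<close>)
    have L1: "(\<lambda>N. contour_integral \<gamma> (H (T N))) \<longlonglongrightarrow> contour_integral \<gamma> (H 0)"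
    proof (rule contour_integral_locally_uniform_limit[OF U \<gamma>(1)])
      show "path_image \<gamma> \<subseteq> U" unfolding U_def by (rule \<gamma>(3))
      show "H (T N) holomorphic_on U" for N using T by (intro hY) (auto intro: less_imp_le)
      show "H 0 holomorphic_on U" using t0 by (intro hY) auto
      fix K assume K: "compact K" "K \<subseteq> U"
      \<comment> \<open>Joint continuity on this compact set gives uniform continuity, hence
        convergence of H (T N) to H 0 uniformly in z.\<close>
      define P where "P = {0..t0} \<times> K"
      have P: "compact P" unfolding P_def by (intro compact_Times K) auto
      have Et: "continuous_on P (\<lambda>p. E (fst p) $$ (k,l))" if "k < n" "l < n" for k l
        by (rule continuous_on_compose2[OF Ec[OF that]]) (use t0 in \<open>auto simp: P_def intro!: continuous_intros\<close>)
      have res: "continuous_on P (\<lambda>p. resolv (Y (fst p)) (snd p) $$ (k,l))" if kl: "k < n" "l < n" for k l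
      proof -
        have "continuous_on P (\<lambda>p. minv (snd p \<cdot>\<^sub>m 1\<^sub>m n - Y (fst p)) $$ (k,l))"
        proof (rule minv_continuous_on[OF _ _ _ kl])
          show "snd p \<cdot>\<^sub>m 1\<^sub>m n - Y (fst p) \<in> carrier_mat n n" for p by (rule minus_carrier_mat[OF Yc])
          fix k l assume kl: "k < n" "l < n"
          have "(snd p \<cdot>\<^sub>m 1\<^sub>m n - Y (fst p)) $$ (k,l) = (if k = l then snd p else 0) -
              ((if k = l then of_real (d k) else 0) + of_real (fst p) * E (fst p) $$ (k,l))" for p
            using kl E[of "fst p"] Yc[of "fst p"] unfolding Y_def Y0_def by auto
          thus "continuous_on P (\<lambda>p. (snd p \<cdot>\<^sub>m 1\<^sub>m n - Y (fst p)) $$ (k,l))"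
            by (cases "k = l") (auto intro!: continuous_intros Et kl)
        next
          fix p assume "p \<in> P"
          hence "snd p \<notin> spec (Y (fst p))" using UU(1)[of "snd p" "fst p"] K unfolding P_def by auto
          thus "Determinant.det (snd p \<cdot>\<^sub>m 1\<^sub>m n - Y (fst p)) \<noteq> 0" using Yc[of "fst p"] by (simp add: spec_def)
        qed
        thus ?thesis by (simp add: resolv_def carrier_matD(1)[OF Yc])
      qed
      have res0: "continuous_on P (\<lambda>p. resolv Y0 (snd p) $$ (k,l))" if kl: "k < n" "l < n" for k l
      proof (rule continuous_on_compose2[of K "\<lambda>z. resolv Y0 z $$ (k,l)"])
        show "continuous_on K (\<lambda>z. resolv Y0 z $$ (k,l))"
          by (intro holomorphic_on_imp_continuous_on resolv_holomorphic_on[OF Y0 _ kl]) (use UU(2)[of _ 0] K t0 in auto)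
      qed (auto simp: P_def intro!: continuous_intros)
      have fc: "continuous_on P (\<lambda>p. f (snd p))"
      proof (rule continuous_on_compose2[of slit f])
        show "continuous_on slit f" by (rule holomorphic_on_imp_continuous_on[OF f])
      qed (use K in \<open>auto simp: P_def U_def intro!: continuous_intros\<close>)
      have "continuous_on P (\<lambda>p. H (fst p) (snd p))"
        unfolding H_def by (intro continuous_intros fc res res0 Et ij) auto
      hence uc: "uniformly_continuous_on P (\<lambda>p. H (fst p) (snd p))" by (rule compact_uniformly_continuous[OF _ P])
      show "uniform_limit K (\<lambda>N. H (T N)) (H 0) sequentially"
      proof (rule uniform_limitI)
        fix e :: real assume "e > 0"
        then obtain \<delta> where \<delta>: "\<delta> > 0" "\<And>p q. p \<in> P \<Longrightarrow> q \<in> P \<Longrightarrow> dist q p < \<delta> \<Longrightarrow> dist (H (fst q) (snd q)) (H (fst p) (snd p)) < e"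
          using uc unfolding uniformly_continuous_on_def by metis
        have "\<forall>\<^sub>F N in sequentially. dist (T N) 0 < \<delta>" by (rule tendstoD[OF T0 \<delta>(1)])
        thus "\<forall>\<^sub>F N in sequentially. \<forall>z\<in>K. dist (H (T N) z) (H 0 z) < e"
        proof eventually_elim
          case (elim N)
          show ?case
          proof
            fix z assume z: "z \<in> K"
            have "(T N, z) \<in> P" "(0, z) \<in> P" using T z t0 unfolding P_def by (auto intro: less_imp_le)
            from \<delta>(2)[OF this(2,1)] show "dist (H (T N) z) (H 0 z) < e" using elim by (simp add: dist_Pair_Pair)
          qed
        qed
      qed
    qed
    have L2: "(mfun f (Y (T N)) $$ (i,j) - mfun f Y0 $$ (i,j)) / of_real (T N) = contour_integral \<gamma> (H (T N)) / (2 * pi * \<i>)" for N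
    proof -
      have TN: "0 \<le> T N" "T N \<le> t0" "T N \<noteq> 0" using T by (auto simp: less_imp_le dual_order.strict_implies_not_eq)
      have sY: "spec (Y (T N)) \<subseteq> slit" "spec Y0 \<subseteq> slit" using sp[OF TN(1,2)] sp0 Cs by auto
      note i1 = integrable_slit_spec[OF Yc sY(1) enc[OF TN(1,2)] mfun_integrand_hol[OF Yc sY(1) f ij]]
      note i0 = integrable_slit_spec[OF Y0 sY(2) enc0 mfun_integrand_hol[OF Y0 sY(2) f ij]]
      have "contour_integral \<gamma> (\<lambda>z. f z * resolv (Y (T N)) z $$ (i,j)) - contour_integral \<gamma> (\<lambda>z. f z * resolv Y0 z $$ (i,j))
        = contour_integral \<gamma> (\<lambda>z. f z * resolv (Y (T N)) z $$ (i,j) - f z * resolv Y0 z $$ (i,j))"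
        by (rule contour_integral_diff[symmetric, OF i1 i0])
      also have "\<dots> = contour_integral \<gamma> (\<lambda>z. of_real (T N) * H (T N) z)"
      proof (rule contour_integral_eq)
        fix z assume "z \<in> path_image \<gamma>"
        hence "z \<in> U" using \<gamma>(3) by (auto simp: U_def)
        note z = UU[OF this TN(1,2)]
        have "f z * resolv (Y (T N)) z $$ (i,j) - f z * resolv Y0 z $$ (i,j) =
          f z * (resolv (Y (T N)) z $$ (i,j) - resolv Y0 z $$ (i,j))" by (simp add: algebra_simps)
        also have "\<dots> = of_real (T N) * H (T N) z"
          unfolding resolvent_identity_entry[OF Y0 Yc z(2,1) E Y_def[THEN meta_eq_to_obj_eq, THEN fun_cong] ij] H_def
          by (simp only: mult_ac)
        finally show "f z * resolv (Y (T N)) z $$ (i,j) - f z * resolv Y0 z $$ (i,j) = of_real (T N) * H (T N) z" .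
      qed
      also have "\<dots> = of_real (T N) * contour_integral \<gamma> (H (T N))"
        by (intro contour_integral_lmul contour_integrable_holomorphic_simple[OF hY[OF TN(1,2)] U \<gamma>(1)]) (use \<gamma>(3) U_def in auto)
      finally show ?thesis
        unfolding mfun_entry[OF Yc sY(1) enc[OF TN(1,2)] f ij] mfun_entry[OF Y0 sY(2) enc0 f ij]
        using TN(3) by (simp add: diff_divide_distrib[symmetric])
    qed
    have L3: "contour_integral \<gamma> (H 0) / (2 * pi * \<i>) = E 0 $$ (i,j) * divided_diff f (d i) (d j)"
    proof -
      have "contour_integral \<gamma> (H 0) = contour_integral \<gamma> (\<lambda>z. E 0 $$ (i,j) * (f z * (1 / (z - of_real (d i)) * (1 / (z - of_real (d j))))))"
      proof (rule contour_integral_eq)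
        fix z assume "z \<in> path_image \<gamma>"
        hence "z \<in> U" using \<gamma>(3) by (auto simp: U_def)
        hence "z \<notin> spec Y0" using UU(2)[of z 0] t0 by auto
        hence r: "resolv Y0 z = diagm n (\<lambda>i. 1 / (z - of_real (d i)))" unfolding Y0_def spec_diagm by (rule resolv_diagm)
        have "(\<Sum>k<n. \<Sum>l<n. resolv Y0 z $$ (i,k) * E 0 $$ (k,l) * resolv Y0 z $$ (l,j)) =
          (\<Sum>k<n. if k = i then (\<Sum>l<n. if l = j then 1 / (z - of_real (d i)) * E 0 $$ (i,j) * (1 / (z - of_real (d j))) else 0) else 0)"
        proof (rule sum.cong[OF refl])
          fix k assume k: "k \<in> {..<n}"
          have "(\<Sum>l<n. resolv Y0 z $$ (i,k) * E 0 $$ (k,l) * resolv Y0 z $$ (l,j)) =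
            (\<Sum>l<n. if l = j then (if k = i then 1 / (z - of_real (d i)) * E 0 $$ (i,j) * (1 / (z - of_real (d j))) else 0) else 0)"
            unfolding r using ij k by (intro sum.cong refl) auto
          thus "(\<Sum>l<n. resolv Y0 z $$ (i,k) * E 0 $$ (k,l) * resolv Y0 z $$ (l,j)) =
            (if k = i then (\<Sum>l<n. if l = j then 1 / (z - of_real (d i)) * E 0 $$ (i,j) * (1 / (z - of_real (d j))) else 0) else 0)"
            using ij by auto
        qed
        also have "\<dots> = 1 / (z - of_real (d i)) * E 0 $$ (i,j) * (1 / (z - of_real (d j)))" using ij by simp
        finally show "H 0 z = E 0 $$ (i,j) * (f z * (1 / (z - of_real (d i)) * (1 / (z - of_real (d j)))))"
          unfolding H_def Y00 by (simp only: mult_ac)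
      qed
      also have "\<dots> = E 0 $$ (i,j) * contour_integral \<gamma> (\<lambda>z. f z * (1 / (z - of_real (d i)) * (1 / (z - of_real (d j)))))"
      proof (intro contour_integral_lmul contour_integrable_holomorphic_simple[OF _ U \<gamma>(1)])
        show "(\<lambda>z. f z * (1 / (z - of_real (d i)) * (1 / (z - of_real (d j))))) holomorphic_on U"
          using dC[OF ij(1)] dC[OF ij(2)] by (intro holomorphic_intros holomorphic_on_subset[OF f]) (auto simp: U_def)
      qed (use \<gamma>(3) U_def in auto)
      also have "contour_integral \<gamma> (\<lambda>z. f z * (1 / (z - of_real (d i)) * (1 / (z - of_real (d j))))) = 2 * pi * \<i> * divided_diff f (d i) (d j)"
        by (rule contour_integral_divided_diff[OF \<gamma>(1,2) _ _ _ f]) (use \<gamma>(3,4) dC ij d in auto)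
      finally have e: "contour_integral \<gamma> (H 0) = (E 0 $$ (i,j) * divided_diff f (d i) (d j)) * (2 * pi * \<i>)"
        by (simp only: mult_ac)
      show ?thesis unfolding e by (rule nonzero_mult_div_cancel_right) simp
    qed
    show "(\<lambda>N. (mfun f (Y (T N)) $$ (i,j) - mfun f Y0 $$ (i,j)) / of_real (T N)) \<longlonglongrightarrow> E 0 $$ (i,j) * divided_diff f (d i) (d j)"
      unfolding L2 L3[symmetric] by (intro tendsto_divide L1 tendsto_const) simp
  qed
qed

section \<open>Householder reflections and a bordered comparison matrix\<close>

lemma mat_adjoint_props:
  assumes "A \<in> carrier_mat n m"
  shows "mat_adjoint A \<in> carrier_mat m n" "i < m \<Longrightarrow> j < n \<Longrightarrow> mat_adjoint A $$ (i,j) = cnj (A $$ (j,i))"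
  using assms unfolding mat_adjoint_def by (auto simp: mat_of_rows_def cols_def)

lemma quadratic_form_sum:
  assumes "v \<in> carrier_vec n" "w \<in> carrier_vec n" "X \<in> carrier_mat n n"
  shows "conjugate v \<bullet> (X *\<^sub>v w) = (\<Sum>i<n. \<Sum>j<n. cnj (v $ i) * X $$ (i,j) * w $ j)"
  using assms by (simp add: scalar_prod_def lessThan_atLeast0 sum_distrib_left mult.assoc)

definition householder :: "nat \<Rightarrow> (nat \<Rightarrow> real) \<Rightarrow> complex mat" where
  "householder m p = Matrix.mat m m (\<lambda>(i,j). (if i = j then 1 else 0) - 2 * of_real (p i * p j))"

lemma householder_carrier [simp]: "householder m p \<in> carrier_mat m m"
  by (simp add: householder_def)

text \<open>Expansion of (1 - 2 p p^T) D (1 - 2 p p^T), valid for every p. It is applied to the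
  diagonal matrix, to its image under f, and with D = 1 to show that the reflection is an
  involution.\<close>

lemma householder_conj_entry:
  assumes ij: "i < m" "j < m"
  shows "(householder m p * diagm m d * householder m p) $$ (i,j) =
    (if i = j then d i else 0) + of_real (p i * p j) * (4 * (\<Sum>k<m. of_real ((p k)\<^sup>2) * d k) - 2 * (d i + d j))"
proof -
  let ?U = "householder m p"
  have UD: "?U * diagm m d \<in> carrier_mat m m" by (rule mult_carrier_mat[OF householder_carrier diagm_carrier(1)])
  have 1: "(?U * diagm m d) $$ (i,k) = ?U $$ (i,k) * d k" if k: "k < m" for k
  proof -
    have "(?U * diagm m d) $$ (i,k) = (\<Sum>l<m. ?U $$ (i,l) * diagm m d $$ (l,k))"
      by (rule mult_mat_entry[OF householder_carrier diagm_carrier(1) ij(1) k])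
    also have "\<dots> = (\<Sum>l<m. if l = k then ?U $$ (i,k) * d k else 0)" using k by (intro sum.cong) auto
    finally show ?thesis using k by simp
  qed
  have "(?U * diagm m d * ?U) $$ (i,j) = (\<Sum>k<m. (?U * diagm m d) $$ (i,k) * ?U $$ (k,j))"
    by (rule mult_mat_entry[OF UD householder_carrier ij])
  also have "\<dots> = (\<Sum>k<m. (if k = i then (if i = j then d i else 0) else 0)
      - (if k = i then 2 * of_real (p i * p j) * d i else 0)
      - (if k = j then 2 * of_real (p i * p j) * d j else 0)
      + of_real (p i * p j) * (4 * (of_real ((p k)\<^sup>2) * d k)))"
  proof (rule sum.cong[OF refl])
    fix k assume "k \<in> {..<m}"
    hence k: "k < m" by simp
    show "(?U * diagm m d) $$ (i,k) * ?U $$ (k,j) = (if k = i then (if i = j then d i else 0) else 0)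
      - (if k = i then 2 * of_real (p i * p j) * d i else 0)
      - (if k = j then 2 * of_real (p i * p j) * d j else 0)
      + of_real (p i * p j) * (4 * (of_real ((p k)\<^sup>2) * d k))"
      unfolding 1[OF k] using k ij by (auto simp: householder_def algebra_simps power2_eq_square)
  qed
  also have "\<dots> = (if i = j then d i else 0) - 2 * of_real (p i * p j) * d i - 2 * of_real (p i * p j) * d j
     + of_real (p i * p j) * (4 * (\<Sum>k<m. of_real ((p k)\<^sup>2) * d k))"
    using ij by (simp add: sum.distrib sum_subtractf sum_distrib_left)
  finally show ?thesis by (simp add: algebra_simps)
qed

lemma diagm_one: "diagm m (\<lambda>_. 1) = 1\<^sub>m m"
  by (intro eq_matI) auto

lemma householder_involution:
  assumes "(\<Sum>k<m. (p k)\<^sup>2) = 1"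
  shows "householder m p * householder m p = 1\<^sub>m m"
proof (rule eq_matI)
  fix i j assume "i < dim_row (1\<^sub>m m)" "j < dim_col (1\<^sub>m m)"
  hence ij: "i < m" "j < m" by auto
  have s: "(\<Sum>k<m. of_real ((p k)\<^sup>2) * (1::complex)) = 1"
    using arg_cong[OF assms, of complex_of_real] by (simp del: of_real_power)
  have "householder m p * diagm m (\<lambda>_. 1) = householder m p"
    unfolding diagm_one by (rule right_mult_one_mat[OF householder_carrier])
  thus "(householder m p * householder m p) $$ (i,j) = 1\<^sub>m m $$ (i,j)"
    using householder_conj_entry[OF ij, of p "\<lambda>_. 1"] ij unfolding s by simp
qed (auto simp: householder_def)

text \<open>The reflection is real symmetric, so the form at v is \<Sum> d_j |(U v)_j|^2.
  Definiteness is needed because \<open>op_monotone\<close> asks it of the smaller matrix.\<close>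

lemma pd_householder_conj:
  assumes p: "(\<Sum>k<m. (p k)\<^sup>2) = 1" and d: "\<And>k. k < m \<Longrightarrow> 0 < d k"
  shows "pd (householder m p * diagm m (\<lambda>k. of_real (d k)) * householder m p)"
proof -
  let ?U = "householder m p" and ?D = "diagm m (\<lambda>k. complex_of_real (d k))"
  let ?N = "?U * ?D * ?U"
  have UD: "?U * ?D \<in> carrier_mat m m" by (rule mult_carrier_mat[OF householder_carrier diagm_carrier(1)])
  have N: "?N \<in> carrier_mat m m" by (rule mult_carrier_mat[OF UD householder_carrier])
  have dims: "dim_row ?N = m" "dim_col ?N = m" using N by auto
  have adj: "mat_adjoint ?N = ?N"
  proof (rule eq_matI)
    fix i j assume "i < dim_row ?N" "j < dim_col ?N"
    hence ij: "i < m" "j < m" unfolding dims by auto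
    show "mat_adjoint ?N $$ (i,j) = ?N $$ (i,j)"
      unfolding mat_adjoint_props(2)[OF N ij] householder_conj_entry[OF ij] householder_conj_entry[OF ij(2,1)]
      using ij by (auto simp: algebra_simps)
  qed (use mat_adjoint_props(1)[OF N] dims in auto)
  have pos: "0 < Re (conjugate v \<bullet> (?N *\<^sub>v v))" if v: "v \<in> carrier_vec m" "v \<noteq> 0\<^sub>v m" for v
  proof -
    define x where "x = ?U *\<^sub>v v"
    have x: "x \<in> carrier_vec m" unfolding x_def using v by (intro mult_mat_vec_carrier) auto
    have Ux: "?U *\<^sub>v x = v" unfolding x_def
      using assoc_mult_mat_vec[OF householder_carrier householder_carrier v(1), of p p] householder_involution[OF p] v by simp
    have x0: "x \<noteq> 0\<^sub>v m"
    proof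
      assume "x = 0\<^sub>v m"
      hence "v = ?U *\<^sub>v 0\<^sub>v m" using Ux by simp
      also have "\<dots> = 0\<^sub>v m" by (intro eq_vecI) (auto simp: householder_def)
      finally show False using v by simp
    qed
    have xi: "x $ i = (\<Sum>j<m. ?U $$ (i,j) * v $ j)" if "i < m" for i
      unfolding x_def using that v by (simp add: scalar_prod_def lessThan_atLeast0 householder_def)
    have "conjugate v \<bullet> (?N *\<^sub>v v) = conjugate v \<bullet> (?U *\<^sub>v (?D *\<^sub>v x))"
    proof -
      have "?N *\<^sub>v v = ?U * ?D *\<^sub>v x" unfolding x_def by (rule assoc_mult_mat_vec[OF UD householder_carrier v(1)])
      also have "\<dots> = ?U *\<^sub>v (?D *\<^sub>v x)" by (rule assoc_mult_mat_vec[OF householder_carrier diagm_carrier(1) x])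
      finally show ?thesis by simp
    qed
    also have "\<dots> = (\<Sum>i<m. \<Sum>j<m. cnj (v $ i) * ?U $$ (i,j) * (of_real (d j) * x $ j))"
    proof -
      have Dx: "?D *\<^sub>v x \<in> carrier_vec m" by (rule mult_mat_vec_carrier[OF diagm_carrier(1) x])
      have "(?D *\<^sub>v x) $ j = of_real (d j) * x $ j" if "j < m" for j
      proof -
        have "(?D *\<^sub>v x) $ j = (\<Sum>k<m. ?D $$ (j,k) * x $ k)"
          using that x by (simp add: scalar_prod_def lessThan_atLeast0 diagm_def)
        also have "\<dots> = (\<Sum>k<m. if k = j then of_real (d j) * x $ j else 0)" using that by (intro sum.cong) auto
        finally show ?thesis using that by simp
      qed
      thus ?thesis unfolding quadratic_form_sum[OF v(1) Dx householder_carrier] by simp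
    qed
    also have "\<dots> = (\<Sum>j<m. \<Sum>i<m. cnj (v $ i) * ?U $$ (i,j) * (of_real (d j) * x $ j))" by (rule sum.swap)
    also have "\<dots> = (\<Sum>j<m. of_real (d j) * (cnj (x $ j) * x $ j))"
    proof (rule sum.cong[OF refl])
      fix j assume "j \<in> {..<m}"
      hence j: "j < m" by simp
      have "cnj (x $ j) = (\<Sum>i<m. cnj (v $ i) * ?U $$ (i,j))"
        unfolding xi[OF j] using j by (auto simp: householder_def mult_ac intro!: sum.cong)
      thus "(\<Sum>i<m. cnj (v $ i) * ?U $$ (i,j) * (of_real (d j) * x $ j)) = of_real (d j) * (cnj (x $ j) * x $ j)"
        by (simp add: sum_distrib_left sum_distrib_right mult_ac)
    qed
    finally have "Re (conjugate v \<bullet> (?N *\<^sub>v v)) = (\<Sum>j<m. d j * (cmod (x $ j))\<^sup>2)"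
      unfolding cmod_power2 by (simp add: power2_eq_square)
    also have "\<dots> > 0"
    proof -
      obtain j where j: "j < m" "x $ j \<noteq> 0"
      proof (rule ccontr)
        assume "\<not> thesis"
        hence "x = 0\<^sub>v m" using that x by (intro eq_vecI) auto
        thus False using x0 by simp
      qed
      show ?thesis
        by (rule sum_pos2[of _ j]) (use j d in \<open>auto simp: less_imp_le\<close>)
    qed
    finally show ?thesis .
  qed
  show ?thesis unfolding pd_def dims using N adj pos by simp
qed

text \<open>A Schur complement estimate: the block is t y times the identity plus a positive
  rank-one term. Dropping the latter, the corner c has to exceed the squared border divided by t
  y.\<close>

lemma psd_bordered:
  fixes a u b :: "nat \<Rightarrow> real" and t y c :: real
  assumes M: "M \<in> carrier_mat (Suc n) (Suc n)"
    and ij: "\<And>i j. i < n \<Longrightarrow> j < n \<Longrightarrow> M $$ (i,j) = of_real (t * ((if i = j then y else 0) + 4 * (a i * a j) * (u i * u j)))"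
    and inn: "\<And>i. i < n \<Longrightarrow> M $$ (i,n) = of_real (- b i)" "\<And>i. i < n \<Longrightarrow> M $$ (n,i) = of_real (- b i)"
    and nn: "M $$ (n,n) = of_real c"
    and ty: "0 < t" "0 < y" and c: "(\<Sum>i<n. (b i)\<^sup>2 / (t * y)) \<le> c"
  shows "psd M"
proof -
  have dims: "dim_row M = Suc n" using M by auto
  have adj: "mat_adjoint M = M"
  proof (rule eq_matI)
    fix i j assume "i < dim_row M" "j < dim_col M"
    hence l: "i < Suc n" "j < Suc n" using M by auto
    have cases: "i < n \<or> i = n" "j < n \<or> j = n" using l by auto
    show "mat_adjoint M $$ (i,j) = M $$ (i,j)"
      unfolding mat_adjoint_props(2)[OF M l]
      using cases by (elim disjE) (auto simp: ij inn nn mult_ac)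
  qed (use mat_adjoint_props(1)[OF M] M in auto)
  have "0 \<le> Re (conjugate v \<bullet> (M *\<^sub>v v))" if v: "v \<in> carrier_vec (Suc n)" for v
  proof -
    define s where "s = (\<Sum>i<n. of_real (a i * u i) * v $ i)"
    have cnjs: "cnj s = (\<Sum>i<n. of_real (a i * u i) * cnj (v $ i))" unfolding s_def by simp
    have A: "(\<Sum>i<n. \<Sum>j<n. cnj (v $ i) * M $$ (i,j) * v $ j) =
        of_real (t * y) * (\<Sum>i<n. cnj (v $ i) * v $ i) + of_real (4 * t) * (cnj s * s)"
    proof -
      have "(\<Sum>i<n. \<Sum>j<n. cnj (v $ i) * M $$ (i,j) * v $ j) =
        (\<Sum>i<n. \<Sum>j<n. (if j = i then of_real (t * y) * (cnj (v $ i) * v $ i) else 0) +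
           of_real (4 * t) * ((of_real (a i * u i) * cnj (v $ i)) * (of_real (a j * u j) * v $ j)))"
        by (intro sum.cong refl) (auto simp: ij algebra_simps)
      also have "\<dots> = (\<Sum>i<n. of_real (t * y) * (cnj (v $ i) * v $ i)) + of_real (4 * t) * (cnj s * s)"
        unfolding cnjs unfolding s_def sum_product by (simp add: sum.distrib sum_distrib_left)
      finally show ?thesis by (simp add: sum_distrib_left)
    qed
    have "conjugate v \<bullet> (M *\<^sub>v v) = (\<Sum>i<n. \<Sum>j<n. cnj (v $ i) * M $$ (i,j) * v $ j)
        + (\<Sum>i<n. cnj (v $ i) * M $$ (i,n) * v $ n) + (\<Sum>j<n. cnj (v $ n) * M $$ (n,j) * v $ j)
        + cnj (v $ n) * M $$ (n,n) * v $ n"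
      unfolding quadratic_form_sum[OF v v M] by (simp add: sum.distrib algebra_simps)
    also have "Re \<dots> = t * y * (\<Sum>i<n. (cmod (v $ i))\<^sup>2) + 4 * t * (cmod s)\<^sup>2
        - 2 * (\<Sum>i<n. b i * Re (cnj (v $ n) * v $ i)) + c * (cmod (v $ n))\<^sup>2"
    proof -
      have sq: "Re (cnj z * z) = (cmod z)\<^sup>2" "Im (cnj z * z) = 0" for z
        unfolding cmod_power2 by (simp_all add: power2_eq_square)
      have 1: "Re (\<Sum>i<n. cnj (v $ i) * v $ i) = (\<Sum>i<n. (cmod (v $ i))\<^sup>2)" unfolding Re_sum sq ..
      have 2: "Re (\<Sum>i<n. cnj (v $ i) * M $$ (i,n) * v $ n) = - (\<Sum>i<n. b i * Re (cnj (v $ n) * v $ i))"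
        unfolding Re_sum sum_negf[symmetric] by (intro sum.cong) (auto simp: inn algebra_simps)
      have 3: "Re (\<Sum>j<n. cnj (v $ n) * M $$ (n,j) * v $ j) = - (\<Sum>i<n. b i * Re (cnj (v $ n) * v $ i))"
        unfolding Re_sum sum_negf[symmetric] by (intro sum.cong) (auto simp: inn algebra_simps)
      have 5: "Re (of_real r * z) = r * Re z" for r z by simp
      have 4: "Re (cnj (v $ n) * M $$ (n,n) * v $ n) = c * (cmod (v $ n))\<^sup>2"
      proof -
        have "cnj (v $ n) * M $$ (n,n) * v $ n = of_real c * (cnj (v $ n) * v $ n)" by (simp add: nn)
        thus ?thesis by (simp only: 5 sq)
      qed
      show ?thesis unfolding plus_complex.simps A 2 3 4 5 1 sq by simp
    qed
    also have "\<dots> \<ge> 0"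
    proof -
      have "2 * (b i * Re (cnj (v $ n) * v $ i)) \<le> t * y * (cmod (v $ i))\<^sup>2 + (b i)\<^sup>2 / (t * y) * (cmod (v $ n))\<^sup>2" for i
      proof -
        \<comment> \<open>Splitting the cross term with weights P and 1/P makes the
          arithmetic-geometric mean inequality consume exactly t y |v_i|^2.\<close>
        define P where "P = sqrt (t * y)"
        have P: "P > 0" "P\<^sup>2 = t * y" using ty by (auto simp: P_def)
        have "b i * Re (cnj (v $ n) * v $ i) \<le> \<bar>b i\<bar> * (cmod (v $ n) * cmod (v $ i))"
        proof -
          have "b i * Re (cnj (v $ n) * v $ i) \<le> \<bar>b i\<bar> * \<bar>Re (cnj (v $ n) * v $ i)\<bar>" by (simp only: abs_mult[symmetric] abs_ge_self)
          also have "\<dots> \<le> \<bar>b i\<bar> * cmod (cnj (v $ n) * v $ i)" by (intro mult_left_mono abs_Re_le_cmod) auto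
          finally show ?thesis by (simp add: norm_mult)
        qed
        moreover have "2 * ((P * cmod (v $ i)) * (\<bar>b i\<bar> / P * cmod (v $ n))) \<le> (P * cmod (v $ i))\<^sup>2 + (\<bar>b i\<bar> / P * cmod (v $ n))\<^sup>2"
          using sum_squares_bound[of "P * cmod (v $ i)" "\<bar>b i\<bar> / P * cmod (v $ n)"] by (simp only: mult.assoc)
        moreover have "(P * cmod (v $ i)) * (\<bar>b i\<bar> / P * cmod (v $ n)) = \<bar>b i\<bar> * (cmod (v $ n) * cmod (v $ i))"
          using P by (simp add: field_simps)
        moreover have "(P * cmod (v $ i))\<^sup>2 = t * y * (cmod (v $ i))\<^sup>2" by (simp add: power_mult_distrib P)
        moreover have "(\<bar>b i\<bar> / P * cmod (v $ n))\<^sup>2 = (b i)\<^sup>2 / (t * y) * (cmod (v $ n))\<^sup>2"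
          by (simp add: power_mult_distrib power_divide P)
        ultimately show ?thesis by linarith
      qed
      hence "(\<Sum>i<n. 2 * (b i * Re (cnj (v $ n) * v $ i))) \<le>
         (\<Sum>i<n. t * y * (cmod (v $ i))\<^sup>2 + (b i)\<^sup>2 / (t * y) * (cmod (v $ n))\<^sup>2)" by (intro sum_mono)
      also have "\<dots> = t * y * (\<Sum>i<n. (cmod (v $ i))\<^sup>2) + (\<Sum>i<n. (b i)\<^sup>2 / (t * y)) * (cmod (v $ n))\<^sup>2"
        by (simp add: sum.distrib sum_distrib_left sum_distrib_right)
      also have "\<dots> \<le> t * y * (\<Sum>i<n. (cmod (v $ i))\<^sup>2) + c * (cmod (v $ n))\<^sup>2"
        using c by (intro add_left_mono mult_right_mono) auto
      finally have "2 * (\<Sum>i<n. b i * Re (cnj (v $ n) * v $ i)) \<le> t * y * (\<Sum>i<n. (cmod (v $ i))\<^sup>2) + c * (cmod (v $ n))\<^sup>2"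
        by (simp add: sum_distrib_left)
      moreover have "4 * t * (cmod s)\<^sup>2 \<ge> 0" using ty by simp
      ultimately show ?thesis by linarith
    qed
    finally show ?thesis .
  qed
  thus ?thesis unfolding psd_def dims using M adj by simp
qed

text \<open>The diagonal matrix with entries $a_i^2$ and $y$, conjugated by a Householder reflection close to the
  identity, is dominated by a block diagonal matrix. Comparing the images under f to first order
  yields the kernel, up to an error proportional to $y$.\<close>
lemma op_monotone_perturbed_kernel:
  fixes a u :: "nat \<Rightarrow> real" and y :: real
  assumes f: "f holomorphic_on slit" and om: "op_monotone f"
    and fr: "\<And>x. x > 0 \<Longrightarrow> 0 < Re (f (complex_of_real x))"
    and a: "\<And>i. i < n \<Longrightarrow> 0 < a i" and y: "0 < y"
  defines "x \<equiv> (\<lambda>i. (a i)\<^sup>2)"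
  defines "F \<equiv> (\<lambda>i. Re (f (complex_of_real (x i))))" and "L \<equiv> (\<lambda>i j. Re (divided_diff f (x i) (x j)))"
  shows "0 \<le> (\<Sum>i<n. \<Sum>j<n. u i * u j * ((4 * y - 2 * (x i + x j) + 4 * (a i * a j)) * L i j + 2 * (F i + F j)))
     + y * (\<Sum>i<n. L i i)"
proof -
  have x: "0 < x i" if "i < n" for i using a[OF that] by (simp add: x_def)
  define S where "S = (\<Sum>i<n. (u i)\<^sup>2)"
  define X where "X = (\<Sum>i<n. (u i)\<^sup>2 * x i)"
  \<comment> \<open>The value p^T D p for D = diag(x, y) and the unit vector \<open>p\<close>
    introduced below; it equals y at t = 0.\<close>
  define q where "q t = t * X + (1 - t * S) * y" for t
  \<comment> \<open>The first summand is the increment, divided by t, of the upper-left block under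
    the reflection. The diagonal y pays for the border. The rank-one term 4 a_i a_j u_i u_j
    completes the square: -2 (x_i + x_j) becomes -2 (a_i - a_j)^2.\<close>
  define e where "e i j t = u i * u j * (4 * q t - 2 * (x i + x j)) + (if i = j then y else 0) + 4 * (a i * a j) * (u i * u j)" for i j t
  define E where "E t = Matrix.mat (Suc n) (Suc n) (\<lambda>(i,j). if i < n \<and> j < n then complex_of_real (e i j t) else 0)" for t
  define Q where "Q = X + y"
  have S0: "S \<ge> 0" unfolding S_def by (intro sum_nonneg) auto
  have X0: "X \<ge> 0" unfolding X_def using x by (intro sum_nonneg) (auto simp: less_imp_le)
  define B where "B = (\<Sum>i<n. (u i)\<^sup>2 * (4 * Q + 2 * x i + 2 * y)\<^sup>2 / y)"
  have B0: "B \<ge> 0" unfolding B_def using y by (intro sum_nonneg) auto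
  \<comment> \<open>Corner entry large enough for the Schur complement at every admissible t: y + 4
    Q bounds the corner of the reflected matrix, and \<open>B\<close> bounds the squared border over
    t y. The border is of order sqrt t, so the factor t cancels and a constant suffices.\<close>
  define \<kappa> where "\<kappa> = y + 4 * Q + B"
  have \<kappa>: "\<kappa> > 0" unfolding \<kappa>_def Q_def using y X0 B0
    by (intro add_pos_nonneg mult_nonneg_nonneg) auto
  define d where "d i = (if i < n then x i else \<kappa>)" for i
  define d' where "d' i = (if i < n then x i else y)" for i
  have d: "0 < d i" "0 < d' i" for i unfolding d_def d'_def using x \<kappa> y by auto
  define Y0 where "Y0 = diagm (Suc n) (\<lambda>i. complex_of_real (d i))"
  define Y where "Y t = Y0 + complex_of_real t \<cdot>\<^sub>m E t" for t
  have Ec: "E t \<in> carrier_mat (Suc n) (Suc n)" for t unfolding E_def by simp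
  have Eco: "continuous_on {0..1} (\<lambda>t. E t $$ (i,j))" if "i < Suc n" "j < Suc n" for i j
  proof -
    have "E t $$ (i,j) = (if i < n \<and> j < n then complex_of_real (e i j t) else 0)" for t
      unfolding E_def using that by simp
    moreover have "continuous_on {0..1} (\<lambda>t. e i j t)" unfolding e_def q_def by (intro continuous_intros)
    ultimately show ?thesis by (cases "i < n \<and> j < n") (auto intro!: continuous_intros)
  qed
  have "\<exists>t0>0. t0 \<le> 1 \<and> (\<forall>T i j. (\<forall>N::nat. 0 < T N \<and> T N \<le> t0) \<longrightarrow> T \<longlonglongrightarrow> 0 \<longrightarrow> i < Suc n \<longrightarrow> j < Suc n \<longrightarrow>
    (\<lambda>N. (mfun f (Y (T N)) $$ (i,j) - mfun f Y0 $$ (i,j)) / of_real (T N)) \<longlonglongrightarrow> E 0 $$ (i,j) * divided_diff f (d i) (d j))"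
    unfolding Y_def Y0_def by (rule mfun_derivative_at_diagonal[OF f d(1) Ec Eco])
  then obtain t0 where t0: "t0 > 0" "t0 \<le> 1" and
    t0': "\<forall>T i j. (\<forall>N::nat. 0 < T N \<and> T N \<le> t0) \<longrightarrow> T \<longlonglongrightarrow> 0 \<longrightarrow> i < Suc n \<longrightarrow> j < Suc n \<longrightarrow>
    (\<lambda>N. (mfun f (Y (T N)) $$ (i,j) - mfun f Y0 $$ (i,j)) / of_real (T N)) \<longlonglongrightarrow> E 0 $$ (i,j) * divided_diff f (d i) (d j)"
    by (elim exE conjE)
  have Y0c: "Y0 \<in> carrier_mat (Suc n) (Suc n)" unfolding Y0_def by simp
  have Yc: "Y t \<in> carrier_mat (Suc n) (Suc n)" for t unfolding Y_def using Y0c Ec by simp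
  have main: "- (\<Sum>i<n. \<Sum>j<n. u i * u j * (2 * (F i + F j))) \<le>
      (\<Sum>i<n. \<Sum>j<n. Re ((mfun f (Y t) $$ (i,j) - mfun f Y0 $$ (i,j)) / of_real t))"
    if t: "0 < t" "t \<le> 1" "t * S \<le> 1" for t
  proof -
    define r where "r = sqrt t"
    \<comment> \<open>A unit vector close to the last basis vector; the factor sqrt t makes p_i p_j
      exactly linear in t on the first n coordinates.\<close>
    define p where "p i = (if i < n then r * u i else sqrt (1 - t * S))" for i
    have r: "r * r = t" using t by (simp add: r_def)
    have pn: "(p n)\<^sup>2 = 1 - t * S" using t by (simp add: p_def)
    have pp: "p i * p j = t * (u i * u j)" if "i < n" "j < n" for i j
    proof -
      have "p i * p j = (r * r) * (u i * u j)" using that by (simp add: p_def mult_ac)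
      thus ?thesis unfolding r .
    qed
    have p2: "(p i)\<^sup>2 = t * (u i)\<^sup>2" if "i < n" for i using pp[OF that that] by (simp add: power2_eq_square)
    have sp: "(\<Sum>k<Suc n. (p k)\<^sup>2) = 1"
    proof -
      have "(\<Sum>k<n. (p k)\<^sup>2) = t * S" unfolding S_def sum_distrib_left using p2 by (intro sum.cong) auto
      thus ?thesis using pn by simp
    qed
    have sq: "(\<Sum>k<Suc n. (p k)\<^sup>2 * d' k) = q t"
    proof -
      have "(\<Sum>k<n. (p k)\<^sup>2 * d' k) = t * X" unfolding X_def sum_distrib_left using p2 by (intro sum.cong) (auto simp: d'_def)
      thus ?thesis using pn by (simp add: q_def d'_def)
    qed
    have q0: "0 \<le> q t" "q t \<le> Q"
    proof -
      show "0 \<le> q t" unfolding q_def using t X0 y by (intro add_nonneg_nonneg mult_nonneg_nonneg) auto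
      have "t * X \<le> 1 * X" "(1 - t * S) * y \<le> 1 * y" using t X0 S0 y by (intro mult_right_mono; simp)+
      thus "q t \<le> Q" unfolding q_def Q_def by simp
    qed
    let ?U = "householder (Suc n) p"
    define Nn where "Nn = ?U * diagm (Suc n) (\<lambda>k. complex_of_real (d' k)) * ?U"
    have Nc: "Nn \<in> carrier_mat (Suc n) (Suc n)" unfolding Nn_def
      by (intro mult_carrier_mat[OF mult_carrier_mat[OF householder_carrier diagm_carrier(1)] householder_carrier])
    have Ne: "Nn $$ (i,j) = of_real ((if i = j then d' i else 0) + p i * p j * (4 * q t - 2 * (d' i + d' j)))"
      if "i < Suc n" "j < Suc n" for i j
    proof -
      have "(\<Sum>k<Suc n. complex_of_real ((p k)\<^sup>2) * complex_of_real (d' k)) = of_real (q t)"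
        unfolding sq[symmetric] by simp
      thus ?thesis unfolding Nn_def householder_conj_entry[OF that] by simp
    qed
    have pdN: "pd Nn" unfolding Nn_def by (rule pd_householder_conj[OF sp d(2)])
    define \<beta> where "\<beta> i = p i * p n * (4 * q t - 2 * (x i + y))" for i
    have le: "loewner_le Nn (Y t)"
    proof -
      have "psd (Y t - Nn)"
      proof (rule psd_bordered[where t=t and y=y and a=a and u=u and n=n and b=\<beta>
            and c="\<kappa> - (y + (p n)\<^sup>2 * (4 * q t - 4 * y))"])
        show "Y t - Nn \<in> carrier_mat (Suc n) (Suc n)" by (rule minus_carrier_mat[OF Nc])
        have Ye: "(Y t - Nn) $$ (i,j) = (if i = j then of_real (d i) else 0) + of_real t * E t $$ (i,j) - Nn $$ (i,j)"
          if "i < Suc n" "j < Suc n" for i j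
          using that Ec[of t] Nc unfolding Y_def Y0_def by simp
        show "(Y t - Nn) $$ (i,j) = of_real (t * ((if i = j then y else 0) + 4 * (a i * a j) * (u i * u j)))"
          if ij: "i < n" "j < n" for i j
        proof -
          have "(Y t - Nn) $$ (i,j) = of_real ((if i = j then d i else 0) + t * e i j t -
             ((if i = j then d' i else 0) + p i * p j * (4 * q t - 2 * (d' i + d' j))))"
            using Ye[of i j] Ne[of i j] ij by (simp add: E_def)
          also have "(if i = j then d i else 0) + t * e i j t - ((if i = j then d' i else 0) + p i * p j * (4 * q t - 2 * (d' i + d' j)))
             = t * ((if i = j then y else 0) + 4 * (a i * a j) * (u i * u j))"
            unfolding pp[OF ij] e_def using ij by (simp add: d_def d'_def algebra_simps)
          finally show ?thesis .
        qed
        show "(Y t - Nn) $$ (i,n) = of_real (- \<beta> i)" "(Y t - Nn) $$ (n,i) = of_real (- \<beta> i)" if i: "i < n" for i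
          using Ye[of i n] Ye[of n i] Ne[of i n] Ne[of n i] i unfolding \<beta>_def by (auto simp: E_def d'_def add.commute)
        show "(Y t - Nn) $$ (n,n) = of_real (\<kappa> - (y + (p n)\<^sup>2 * (4 * q t - 4 * y)))"
          using Ye[of n n] Ne[of n n] by (simp add: E_def d_def d'_def power2_eq_square)
        show "(\<Sum>i<n. (\<beta> i)\<^sup>2 / (t * y)) \<le> \<kappa> - (y + (p n)\<^sup>2 * (4 * q t - 4 * y))"
        proof -
          have pn1: "0 \<le> (p n)\<^sup>2" "(p n)\<^sup>2 \<le> 1" using pn t S0 by auto
          have "(\<Sum>i<n. (\<beta> i)\<^sup>2 / (t * y)) \<le> B"
            unfolding B_def
          proof (rule sum_mono)
            fix i assume "i \<in> {..<n}"
            hence i: "i < n" by simp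
            have "\<bar>4 * q t - 2 * (x i + y)\<bar> \<le> 4 * Q + 2 * x i + 2 * y"
              using q0 x[OF i] y by (intro abs_leI) auto
            hence b: "(4 * q t - 2 * (x i + y))\<^sup>2 \<le> (4 * Q + 2 * x i + 2 * y)\<^sup>2"
              using power_mono[OF _ abs_ge_zero, of "4 * q t - 2 * (x i + y)" _ 2] by simp
            have "(\<beta> i)\<^sup>2 = t * ((u i)\<^sup>2 * ((p n)\<^sup>2 * (4 * q t - 2 * (x i + y))\<^sup>2))"
              unfolding \<beta>_def by (simp add: power_mult_distrib p2[OF i] mult_ac)
            hence "(\<beta> i)\<^sup>2 / (t * y) = (u i)\<^sup>2 * ((p n)\<^sup>2 * (4 * q t - 2 * (x i + y))\<^sup>2) / y"
              using t by simp
            also have "\<dots> \<le> (u i)\<^sup>2 * (1 * (4 * Q + 2 * x i + 2 * y)\<^sup>2) / y"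
              using pn1 b y by (intro divide_right_mono mult_left_mono mult_mono) auto
            finally show "(\<beta> i)\<^sup>2 / (t * y) \<le> (u i)\<^sup>2 * (4 * Q + 2 * x i + 2 * y)\<^sup>2 / y" by simp
          qed
          moreover have "(p n)\<^sup>2 * (4 * q t - 4 * y) \<le> 4 * Q"
          proof -
            have "(p n)\<^sup>2 * (4 * q t - 4 * y) \<le> (p n)\<^sup>2 * (4 * Q)" using pn1 q0 y by (intro mult_left_mono) auto
            also have "\<dots> \<le> 1 * (4 * Q)" using pn1 q0 by (intro mult_right_mono) auto
            finally show ?thesis by simp
          qed
          ultimately show ?thesis unfolding \<kappa>_def by linarith
        qed
      qed (use t y in auto)
      thus ?thesis unfolding loewner_le_def using Nc Yc[of t] by simp
    qed
    have lef: "loewner_le (mfun f Nn) (mfun f (Y t))"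
      using om Nc Yc[of t] pdN le unfolding op_monotone_def by blast
    \<comment> \<open>The calculus commutes with the reflection, so f acts on the diagonal entries
      and the same expansion applies with f(x_i) in place of x_i and \<open>G\<close> in place of q
      t.\<close>
    have fN: "mfun f Nn = ?U * diagm (Suc n) (\<lambda>k. f (of_real (d' k))) * ?U"
    proof -
      have s: "spec (diagm (Suc n) (\<lambda>k. complex_of_real (d' k))) \<subseteq> slit" unfolding spec_diagm using d by auto
      have "mfun f Nn = ?U * mfun f (diagm (Suc n) (\<lambda>k. complex_of_real (d' k))) * ?U"
        unfolding Nn_def by (rule mfun_similar(2)[OF householder_carrier householder_carrier householder_involution[OF sp] diagm_carrier(1) s f])
      also have "mfun f (diagm (Suc n) (\<lambda>k. complex_of_real (d' k))) = diagm (Suc n) (\<lambda>k. f (of_real (d' k)))"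
        by (rule mfun_diagm[OF _ f]) (use d in auto)
      finally show ?thesis .
    qed
    define G where "G = (\<Sum>k<Suc n. (p k)\<^sup>2 * Re (f (of_real (d' k))))"
    have G0: "G \<ge> 0" unfolding G_def using fr[OF d(2)] by (intro sum_nonneg) (auto simp: less_imp_le)
    have fNe: "Re (mfun f Nn $$ (i,j)) = (if i = j then F i else 0) + t * (u i * u j) * (4 * G - 2 * (F i + F j))"
      if ij: "i < n" "j < n" for i j
    proof -
      have e: "mfun f Nn $$ (i,j) = (if i = j then f (of_real (d' i)) else 0) +
          of_real (p i * p j) * (4 * (\<Sum>k<Suc n. of_real ((p k)\<^sup>2) * f (of_real (d' k))) - 2 * (f (of_real (d' i)) + f (of_real (d' j))))"
        unfolding fN by (rule householder_conj_entry) (use ij in auto)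
      have R: "Re (of_real c * z) = c * Re z" "Re (4 * z) = 4 * Re z" "Re (2 * z) = 2 * Re z" for c z by simp_all
      have "Re (mfun f Nn $$ (i,j)) = (if i = j then Re (f (of_real (d' i))) else 0) +
          p i * p j * (4 * G - 2 * (Re (f (of_real (d' i))) + Re (f (of_real (d' j)))))"
        unfolding e G_def by (simp only: plus_complex.simps minus_complex.simps R Re_sum if_distrib[of Re] zero_complex.simps)
      thus ?thesis unfolding pp[OF ij] using ij by (simp add: F_def d'_def)
    qed
    have fY0: "Re (mfun f Y0 $$ (i,j)) = (if i = j then F i else 0)" if ij: "i < n" "j < n" for i j
    proof -
      have "mfun f Y0 = diagm (Suc n) (\<lambda>k. f (of_real (d k)))" unfolding Y0_def
        by (rule mfun_diagm[OF _ f]) (use d in auto)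
      thus ?thesis using ij by (simp add: F_def d_def)
    qed
    \<comment> \<open>The all-ones vector on the first n coordinates sums the entries of the
      upper-left block, whose first-order behaviour is known; the coordinate carrying \<kappa> drops
      out.\<close>
    define v where "v = Matrix.vec (Suc n) (\<lambda>i. if i < n then 1 else (0::complex))"
    have v: "v \<in> carrier_vec (Suc n)" by (simp add: v_def)
    have Mc: "mfun f (Y t) - mfun f Nn \<in> carrier_mat (Suc n) (Suc n)" by (rule minus_carrier_mat[OF mfun_carrier[OF Nc]])
    have "0 \<le> Re (conjugate v \<bullet> ((mfun f (Y t) - mfun f Nn) *\<^sub>v v))"
      using lef v Mc unfolding loewner_le_def psd_def by auto
    also have "conjugate v \<bullet> ((mfun f (Y t) - mfun f Nn) *\<^sub>v v) = (\<Sum>i<n. \<Sum>j<n. mfun f (Y t) $$ (i,j) - mfun f Nn $$ (i,j))"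
      unfolding quadratic_form_sum[OF v v Mc] using Yc[of t] Nc by (simp add: v_def)
    also have "Re \<dots> = (\<Sum>i<n. \<Sum>j<n. Re (mfun f (Y t) $$ (i,j)) - Re (mfun f Y0 $$ (i,j)) - t * (u i * u j) * (4 * G - 2 * (F i + F j)))"
      unfolding Re_sum minus_complex.simps by (intro sum.cong refl) (auto simp: fNe fY0)
    also have "\<dots> = (\<Sum>i<n. \<Sum>j<n. Re (mfun f (Y t) $$ (i,j)) - Re (mfun f Y0 $$ (i,j)))
        - t * (4 * G * ((\<Sum>i<n. u i) * (\<Sum>j<n. u j)) - (\<Sum>i<n. \<Sum>j<n. u i * u j * (2 * (F i + F j))))"
    proof -
      have "(\<Sum>i<n. \<Sum>j<n. t * (u i * u j) * (4 * G - 2 * (F i + F j))) =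
        t * (4 * G * ((\<Sum>i<n. u i) * (\<Sum>j<n. u j)) - (\<Sum>i<n. \<Sum>j<n. u i * u j * (2 * (F i + F j))))"
      proof -
        have "(\<Sum>i<n. \<Sum>j<n. t * (u i * u j) * (4 * G - 2 * (F i + F j))) =
          (\<Sum>i<n. \<Sum>j<n. t * (4 * G * (u i * u j) - u i * u j * (2 * (F i + F j))))"
          by (intro sum.cong refl) (simp add: algebra_simps)
        also have "\<dots> = t * (\<Sum>i<n. \<Sum>j<n. 4 * G * (u i * u j) - u i * u j * (2 * (F i + F j)))"
          by (simp only: sum_distrib_left)
        also have "(\<Sum>i<n. \<Sum>j<n. 4 * G * (u i * u j) - u i * u j * (2 * (F i + F j))) =
          (\<Sum>i<n. \<Sum>j<n. 4 * G * (u i * u j)) - (\<Sum>i<n. \<Sum>j<n. u i * u j * (2 * (F i + F j)))"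
          by (simp only: sum_subtractf)
        also have "(\<Sum>i<n. \<Sum>j<n. 4 * G * (u i * u j)) = 4 * G * (\<Sum>i<n. \<Sum>j<n. u i * u j)"
          by (simp only: sum_distrib_left)
        also have "(\<Sum>i<n. \<Sum>j<n. u i * u j) = (\<Sum>i<n. u i) * (\<Sum>j<n. u j)" by (simp only: sum_product)
        finally show ?thesis .
      qed
      thus ?thesis by (simp add: sum_subtractf)
    qed
    finally have "t * (4 * G * ((\<Sum>i<n. u i) * (\<Sum>j<n. u j)) - (\<Sum>i<n. \<Sum>j<n. u i * u j * (2 * (F i + F j)))) \<le>
       (\<Sum>i<n. \<Sum>j<n. Re (mfun f (Y t) $$ (i,j)) - Re (mfun f Y0 $$ (i,j)))" by linarith
    \<comment> \<open>The term 4 G (\<Sum> u_i)^2 is discarded; it is nonnegative because f is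
      positive on the positive axis.\<close>
    moreover have "t * (- (\<Sum>i<n. \<Sum>j<n. u i * u j * (2 * (F i + F j)))) \<le>
        t * (4 * G * ((\<Sum>i<n. u i) * (\<Sum>j<n. u j)) - (\<Sum>i<n. \<Sum>j<n. u i * u j * (2 * (F i + F j))))"
      using t G0 by (intro mult_left_mono) auto
    ultimately have "- (\<Sum>i<n. \<Sum>j<n. u i * u j * (2 * (F i + F j))) \<le>
       (\<Sum>i<n. \<Sum>j<n. Re (mfun f (Y t) $$ (i,j)) - Re (mfun f Y0 $$ (i,j))) / t"
      using t(1) by (simp add: pos_le_divide_eq mult.commute)
    thus ?thesis by (simp add: sum_divide_distrib)
  qed
  \<comment> \<open>Besides t \<le> t0, the last coordinate sqrt(1 - t S) of \<open>p\<close> must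
    be real; S + 1 covers the case S = 0.\<close>
  define tm where "tm = min t0 (1 / (S + 1))"
  have tm: "tm > 0" "tm \<le> t0" "tm * S \<le> 1"
  proof -
    show "tm > 0" "tm \<le> t0" unfolding tm_def using t0 S0 by auto
    have "tm * S \<le> (1 / (S + 1)) * S" unfolding tm_def using S0 by (intro mult_right_mono) auto
    also have "\<dots> \<le> 1" using S0 by (simp add: field_simps)
    finally show "tm * S \<le> 1" .
  qed
  define T where "T N = tm / real (Suc N)" for N
  have T: "0 < T N" "T N \<le> tm" for N
    unfolding T_def using tm by (auto simp: field_simps)
  have Tl: "T \<longlonglongrightarrow> 0"
    unfolding T_def[abs_def] divide_inverse using tendsto_mult[OF tendsto_const LIMSEQ_inverse_real_of_nat, of tm] by simp
  have lim: "(\<lambda>N. \<Sum>i<n. \<Sum>j<n. Re ((mfun f (Y (T N)) $$ (i,j) - mfun f Y0 $$ (i,j)) / of_real (T N)))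
     \<longlonglongrightarrow> (\<Sum>i<n. \<Sum>j<n. Re (E 0 $$ (i,j) * divided_diff f (d i) (d j)))"
    using T tm Tl by (intro tendsto_sum tendsto_Re t0'[rule_format]) (auto intro: order_trans)
  have "- (\<Sum>i<n. \<Sum>j<n. u i * u j * (2 * (F i + F j))) \<le> (\<Sum>i<n. \<Sum>j<n. Re (E 0 $$ (i,j) * divided_diff f (d i) (d j)))"
  proof (rule tendsto_lowerbound[OF lim])
    show "\<forall>\<^sub>F N in sequentially. - (\<Sum>i<n. \<Sum>j<n. u i * u j * (2 * (F i + F j))) \<le>
       (\<Sum>i<n. \<Sum>j<n. Re ((mfun f (Y (T N)) $$ (i,j) - mfun f Y0 $$ (i,j)) / of_real (T N)))"
    proof (intro always_eventually allI main T)
      fix N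
      show "T N \<le> 1" using T(2)[of N] tm(2) t0(2) by linarith
      have "T N * S \<le> tm * S" using T(2)[of N] S0 by (intro mult_right_mono) auto
      thus "T N * S \<le> 1" using tm(3) by linarith
    qed
  qed simp
  also have "\<dots> = (\<Sum>i<n. \<Sum>j<n. u i * u j * ((4 * y - 2 * (x i + x j) + 4 * (a i * a j)) * L i j) + (if j = i then y * L i i else 0))"
  proof (intro sum.cong refl)
    fix i j assume "i \<in> {..<n}" "j \<in> {..<n}"
    hence ij: "i < n" "j < n" by auto
    have q0: "q 0 = y" by (simp add: q_def)
    have "Re (E 0 $$ (i,j) * divided_diff f (d i) (d j)) = e i j 0 * L i j"
      using ij by (simp add: E_def L_def d_def)
    also have "\<dots> = u i * u j * ((4 * y - 2 * (x i + x j) + 4 * (a i * a j)) * L i j) + (if j = i then y * L i i else 0)"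
      unfolding e_def q0 by (auto simp: algebra_simps)
    finally show "Re (E 0 $$ (i,j) * divided_diff f (d i) (d j)) = \<dots>" .
  qed
  also have "\<dots> = (\<Sum>i<n. \<Sum>j<n. u i * u j * ((4 * y - 2 * (x i + x j) + 4 * (a i * a j)) * L i j)) + y * (\<Sum>i<n. L i i)"
    by (simp add: sum.distrib sum_distrib_left)
  finally have "- (\<Sum>i<n. \<Sum>j<n. u i * u j * (2 * (F i + F j))) \<le>
     (\<Sum>i<n. \<Sum>j<n. u i * u j * ((4 * y - 2 * (x i + x j) + 4 * (a i * a j)) * L i j)) + y * (\<Sum>i<n. L i i)" .
  moreover have "(\<Sum>i<n. \<Sum>j<n. u i * u j * ((4 * y - 2 * (x i + x j) + 4 * (a i * a j)) * L i j + 2 * (F i + F j))) =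
     (\<Sum>i<n. \<Sum>j<n. u i * u j * ((4 * y - 2 * (x i + x j) + 4 * (a i * a j)) * L i j)) + (\<Sum>i<n. \<Sum>j<n. u i * u j * (2 * (F i + F j)))"
    by (simp only: distrib_left sum.distrib)
  ultimately show ?thesis by linarith
qed

text \<open>The perturbed inequality is affine in y, so y may tend to 0. For i \<noteq> j the
  coefficient -2 (a_i - a_j)^2 meets the denominator a_i^2 - a_j^2 of the divided difference; what
  remains, -2 (a_i - a_j)(F_i - F_j)/(a_i + a_j) + 2 (F_i + F_j), is four times the kernel. On the
  diagonal the coefficient is 0 and the derivative disappears.\<close>

lemma op_monotone_kernel:
  fixes a u :: "nat \<Rightarrow> real"
  assumes f: "f holomorphic_on slit" and om: "op_monotone f"
    and fr: "\<And>x. x > 0 \<Longrightarrow> 0 < Re (f (complex_of_real x))"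
    and inj: "inj_on a {..<n}" and a: "\<And>i. i < n \<Longrightarrow> 0 < a i"
  shows "0 \<le> (\<Sum>i<n. \<Sum>j<n. u i * u j * ((a j * Re (f (complex_of_real ((a i)\<^sup>2))) + a i * Re (f (complex_of_real ((a j)\<^sup>2)))) / (a i + a j)))"
proof -
  define x where "x i = (a i)\<^sup>2" for i
  define F where "F i = Re (f (complex_of_real (x i)))" for i
  define L where "L i j = Re (divided_diff f (x i) (x j))" for i j
  define K where "K = (\<Sum>i<n. \<Sum>j<n. u i * u j * ((- 2 * (x i + x j) + 4 * (a i * a j)) * L i j + 2 * (F i + F j)))"
  define R where "R = (\<Sum>i<n. \<Sum>j<n. u i * u j * (4 * L i j)) + (\<Sum>i<n. L i i)"
  have KR: "0 \<le> K + y * R" if "y > 0" for y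
  proof -
    have "0 \<le> (\<Sum>i<n. \<Sum>j<n. u i * u j * ((4 * y - 2 * (x i + x j) + 4 * (a i * a j)) * L i j + 2 * (F i + F j)))
      + y * (\<Sum>i<n. L i i)"
      unfolding x_def F_def L_def by (rule op_monotone_perturbed_kernel[OF f om fr a that])
    also have "(\<Sum>i<n. \<Sum>j<n. u i * u j * ((4 * y - 2 * (x i + x j) + 4 * (a i * a j)) * L i j + 2 * (F i + F j))) =
        K + y * (\<Sum>i<n. \<Sum>j<n. u i * u j * (4 * L i j))"
      unfolding K_def sum_distrib_left sum.distrib[symmetric] by (intro sum.cong refl) (simp add: algebra_simps)
    finally show ?thesis by (simp add: R_def algebra_simps)
  qed
  have "0 \<le> K"
  proof (rule tendsto_lowerbound)
    show "((\<lambda>y. K + y * R) \<longlongrightarrow> K) (at_right 0)"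
    proof -
      have "((\<lambda>y. K + y * R) \<longlongrightarrow> K + 0 * R) (at_right 0)" by (intro tendsto_intros)
      thus ?thesis by simp
    qed
    show "\<forall>\<^sub>F y in at_right 0. 0 \<le> K + y * R" using eventually_at_right_less by eventually_elim (rule KR)
  qed simp
  also have "K = (\<Sum>i<n. \<Sum>j<n. 4 * (u i * u j * ((a j * F i + a i * F j) / (a i + a j))))"
    unfolding K_def
  proof (intro sum.cong refl)
    fix i j assume "i \<in> {..<n}" "j \<in> {..<n}"
    hence ij: "i < n" "j < n" by auto
    have p: "0 < a i" "0 < a j" using a ij by auto
    have "(- 2 * (x i + x j) + 4 * (a i * a j)) * L i j + 2 * (F i + F j) = 4 * ((a j * F i + a i * F j) / (a i + a j))"
    proof (cases "i = j")
      case True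
      thus ?thesis using p by (simp add: x_def power2_eq_square)
    next
      case False
      have ne: "a i \<noteq> a j" using inj False ij by (auto dest: inj_onD)
      have xd: "x i - x j = (a i - a j) * (a i + a j)" by (simp add: x_def power2_eq_square algebra_simps)
      have nz: "a i - a j \<noteq> 0" "a i + a j \<noteq> 0" using ne p by auto
      hence xne: "x i \<noteq> x j" using xd by auto
      have L: "L i j = (F i - F j) / (x i - x j)"
        unfolding L_def divided_diff_def F_def using xne by (simp add: Re_divide_of_real flip: of_real_diff)
      have c: "- 2 * (x i + x j) + 4 * (a i * a j) = - 2 * (a i - a j) * (a i - a j)"
        by (simp add: x_def power2_eq_square algebra_simps)
      have "(- 2 * (x i + x j) + 4 * (a i * a j)) * L i j = - 2 * (a i - a j) * (F i - F j) / (a i + a j)"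
        unfolding L c xd using nz by simp
      thus ?thesis using nz(2) by (simp add: field_simps)
    qed
    thus "u i * u j * ((- 2 * (x i + x j) + 4 * (a i * a j)) * L i j + 2 * (F i + F j)) =
      4 * (u i * u j * ((a j * F i + a i * F j) / (a i + a j)))" by simp
  qed
  also have "\<dots> = 4 * (\<Sum>i<n. \<Sum>j<n. u i * u j * ((a j * F i + a i * F j) / (a i + a j)))" by (simp only: sum_distrib_left)
  finally show ?thesis unfolding F_def x_def by simp
qed

text \<open>This takes the place of Loewner's integral representation in everything that
  follows.\<close>

theorem rep_fun_harm_approx:
  assumes "rep_fun f" shows "\<exists>w s J. harm_approx w s J f"
proof (rule harm_approx_exists)
  show "f holomorphic_on slit" "f 1 = 1" using assms by (auto simp: rep_fun_def)
  show "f (complex_of_real x) \<in> \<real>" if "x > 0" for x using assms that by (auto simp: rep_fun_def)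
  show "0 \<le> (\<Sum>k<N. \<Sum>l<N. u k * u l * ((a l * Re (f (complex_of_real ((a k)\<^sup>2))) + a k * Re (f (complex_of_real ((a l)\<^sup>2)))) / (a k + a l)))"
    if "inj_on a {..<N}" "\<And>k. k < N \<Longrightarrow> 0 < a k" for N :: nat and a u
    by (rule op_monotone_kernel[OF _ _ _ that]) (use assms in \<open>auto simp: rep_fun_def\<close>)
qed

section \<open>Sesquilinear forms and sectorial matrices\<close>

definition ip :: "complex Matrix.vec \<Rightarrow> complex Matrix.vec \<Rightarrow> complex" where
  "ip u v = conjugate u \<bullet> v"

abbreviation sqn :: "complex Matrix.vec \<Rightarrow> real" where
  "sqn u \<equiv> Re (ip u u)"

definition sesq :: "complex mat \<Rightarrow> complex Matrix.vec \<Rightarrow> complex Matrix.vec \<Rightarrow> complex" where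
  "sesq X u v = ip u (X *\<^sub>v v)"

lemma ip_sum: "u \<in> carrier_vec n \<Longrightarrow> v \<in> carrier_vec n \<Longrightarrow> ip u v = (\<Sum>i<n. cnj (u $ i) * v $ i)"
  by (simp add: ip_def scalar_prod_def lessThan_atLeast0)

lemma ip_cnj: "u \<in> carrier_vec n \<Longrightarrow> v \<in> carrier_vec n \<Longrightarrow> cnj (ip u v) = ip v u"
  by (simp add: ip_sum[of _ n] mult.commute)

lemma ip_add:
  assumes "u \<in> carrier_vec n" "v \<in> carrier_vec n" "w \<in> carrier_vec n"
  shows "ip u (v + w) = ip u v + ip u w" "ip (v + w) u = ip v u + ip w u"
  using assms by (simp_all add: ip_sum[of _ n] distrib_left distrib_right sum.distrib)

lemma ip_smult:
  assumes "u \<in> carrier_vec n" "v \<in> carrier_vec n"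
  shows "ip u (c \<cdot>\<^sub>v v) = c * ip u v" "ip (c \<cdot>\<^sub>v u) v = cnj c * ip u v"
  using assms by (simp_all add: ip_sum[of _ n] sum_distrib_left mult_ac)

lemma sqn_sum: "u \<in> carrier_vec n \<Longrightarrow> sqn u = (\<Sum>i<n. (cmod (u $ i))\<^sup>2)"
proof -
  assume u: "u \<in> carrier_vec n"
  have "Re (cnj z * z) = (cmod z)\<^sup>2" for z unfolding cmod_power2 by (simp add: power2_eq_square)
  thus ?thesis unfolding ip_sum[OF u u] Re_sum by simp
qed

lemma sqn_nonneg: "u \<in> carrier_vec n \<Longrightarrow> 0 \<le> sqn u"
  by (simp add: sqn_sum[of _ n] sum_nonneg del: Re_sum)

lemma sqn_pos:
  assumes u: "u \<in> carrier_vec n" "u \<noteq> 0\<^sub>v n" shows "0 < sqn u"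
proof -
  have "\<exists>j<n. u $ j \<noteq> 0"
  proof (rule ccontr)
    assume "\<not> (\<exists>j<n. u $ j \<noteq> 0)"
    hence "u = 0\<^sub>v n" using u(1) by (intro eq_vecI) auto
    thus False using u(2) by simp
  qed
  then obtain j where "j < n" "u $ j \<noteq> 0" by blast
  thus ?thesis unfolding sqn_sum[OF u(1)] by (intro sum_pos2[of _ j]) auto
qed

lemma ip_self_real: "u \<in> carrier_vec n \<Longrightarrow> ip u u = complex_of_real (sqn u)"
  using ip_cnj[of u n u] by (simp add: complex_eq_iff)

lemma sesq_sum:
  assumes "u \<in> carrier_vec n" "v \<in> carrier_vec n" "X \<in> carrier_mat n n"
  shows "sesq X u v = (\<Sum>i<n. \<Sum>j<n. cnj (u $ i) * X $$ (i,j) * v $ j)"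
  unfolding sesq_def ip_def by (rule quadratic_form_sum[OF assms])

lemma sesq_add_vec:
  assumes "X \<in> carrier_mat n n" "u \<in> carrier_vec n" "v \<in> carrier_vec n" "w \<in> carrier_vec n"
  shows "sesq X u (v + w) = sesq X u v + sesq X u w" "sesq X (v + w) u = sesq X v u + sesq X w u"
  using assms by (simp_all add: sesq_def mult_add_distrib_mat_vec[of _ n n] ip_add[of _ n])

lemma sesq_smult_vec:
  assumes "X \<in> carrier_mat n n" "u \<in> carrier_vec n" "v \<in> carrier_vec n"
  shows "sesq X u (c \<cdot>\<^sub>v v) = c * sesq X u v" "sesq X (c \<cdot>\<^sub>v u) v = cnj c * sesq X u v"
  using assms by (simp_all add: sesq_def mult_mat_vec[of _ n n] ip_smult[of _ n])

lemma sesq_lin_mat: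
  assumes "X \<in> carrier_mat n n" "Y \<in> carrier_mat n n" "u \<in> carrier_vec n" "v \<in> carrier_vec n"
  shows "sesq (X + Y) u v = sesq X u v + sesq Y u v" "sesq (X - Y) u v = sesq X u v - sesq Y u v"
    "sesq (c \<cdot>\<^sub>m X) u v = c * sesq X u v"
proof -
  have "X + Y \<in> carrier_mat n n" "X - Y \<in> carrier_mat n n" "c \<cdot>\<^sub>m X \<in> carrier_mat n n"
    using assms by (auto intro: minus_carrier_mat)
  note s = this[THEN sesq_sum[OF assms(3,4)]] assms(1,2)[THEN sesq_sum[OF assms(3,4)]]
  show "sesq (X + Y) u v = sesq X u v + sesq Y u v"
    unfolding s sum.distrib[symmetric] using assms by (intro sum.cong refl) (auto simp: algebra_simps)
  show "sesq (X - Y) u v = sesq X u v - sesq Y u v"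
    unfolding s sum_subtractf[symmetric] using assms by (intro sum.cong refl) (auto simp: algebra_simps)
  show "sesq (c \<cdot>\<^sub>m X) u v = c * sesq X u v"
    unfolding s sum_distrib_left using assms by (intro sum.cong refl) (auto simp: algebra_simps)
qed

lemma sesq_one: "u \<in> carrier_vec n \<Longrightarrow> v \<in> carrier_vec n \<Longrightarrow> sesq (1\<^sub>m n) u v = ip u v"
  by (simp add: sesq_def)

lemma sesq_adjoint:
  assumes "X \<in> carrier_mat n n" "u \<in> carrier_vec n" "v \<in> carrier_vec n"
  shows "sesq (mat_adjoint X) u v = cnj (sesq X v u)"
proof -
  note a = mat_adjoint_props[OF assms(1)]
  have "sesq (mat_adjoint X) u v = (\<Sum>i<n. \<Sum>j<n. cnj (u $ i) * cnj (X $$ (j,i)) * v $ j)"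
    unfolding sesq_sum[OF assms(2,3) a(1)] by (intro sum.cong refl) (auto simp: a(2))
  also have "\<dots> = (\<Sum>j<n. \<Sum>i<n. cnj (u $ i) * cnj (X $$ (j,i)) * v $ j)" by (rule sum.swap)
  also have "\<dots> = cnj (sesq X v u)" unfolding sesq_sum[OF assms(3,2,1)] by (simp add: mult_ac)
  finally show ?thesis .
qed

lemma ip_mult_mat:
  assumes "X \<in> carrier_mat n n" "u \<in> carrier_vec n" "v \<in> carrier_vec n"
  shows "ip u (X *\<^sub>v v) = ip (mat_adjoint X *\<^sub>v u) v"
proof -
  have "mat_adjoint X *\<^sub>v u \<in> carrier_vec n"
    by (rule mult_mat_vec_carrier[OF mat_adjoint_props(1)[OF assms(1)] assms(2)])
  from ip_cnj[OF assms(3) this] have "ip (mat_adjoint X *\<^sub>v u) v = cnj (sesq (mat_adjoint X) v u)"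
    by (simp add: sesq_def)
  thus ?thesis unfolding sesq_adjoint[OF assms(1,3,2)] by (simp add: sesq_def)
qed

lemma ReM_carrier: "X \<in> carrier_mat n n \<Longrightarrow> ReM X \<in> carrier_mat n n"
  unfolding ReM_def using mat_adjoint_props(1) by auto

lemma sesq_ReM:
  assumes "X \<in> carrier_mat n n" "u \<in> carrier_vec n" "v \<in> carrier_vec n"
  shows "sesq (ReM X) u v = (sesq X u v + cnj (sesq X v u)) / 2"
proof -
  note a = mat_adjoint_props(1)[OF assms(1)]
  have "X + mat_adjoint X \<in> carrier_mat n n" using a assms by simp
  thus ?thesis unfolding ReM_def
    by (subst sesq_lin_mat(3)[of _ n X]) (use assms a in \<open>simp_all add: sesq_lin_mat(1)[of _ n] sesq_adjoint\<close>)
qed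

lemma Re_sesq_ReM:
  assumes "X \<in> carrier_mat n n" "u \<in> carrier_vec n"
  shows "sesq (ReM X) u u = complex_of_real (Re (sesq X u u))"
  unfolding sesq_ReM[OF assms assms(2)] by (simp add: complex_eq_iff)

lemma mat_adjoint_ReM:
  assumes "X \<in> carrier_mat n n" shows "mat_adjoint (ReM X) = ReM X"
proof (rule eq_matI)
  note R = ReM_carrier[OF assms] and a = mat_adjoint_props[OF assms]
  fix i j assume "i < dim_row (ReM X)" "j < dim_col (ReM X)"
  hence ij: "i < n" "j < n" using R by auto
  show "mat_adjoint (ReM X) $$ (i,j) = ReM X $$ (i,j)"
    unfolding mat_adjoint_props(2)[OF R ij] unfolding ReM_def using assms a ij by simp
qed (use ReM_carrier[OF assms] mat_adjoint_props(1)[OF ReM_carrier[OF assms]] in auto)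

lemma psd_iff:
  assumes "X \<in> carrier_mat n n"
  shows "psd X \<longleftrightarrow> mat_adjoint X = X \<and> (\<forall>v\<in>carrier_vec n. 0 \<le> Re (sesq X v v))"
  using assms unfolding psd_def sesq_def ip_def by auto

lemma mat_adjoint_lin:
  assumes "X \<in> carrier_mat n n" "Y \<in> carrier_mat n n"
  shows "mat_adjoint (X + Y) = mat_adjoint X + mat_adjoint Y" "mat_adjoint (X - Y) = mat_adjoint X - mat_adjoint Y"
    "mat_adjoint (c \<cdot>\<^sub>m X) = cnj c \<cdot>\<^sub>m mat_adjoint X" "mat_adjoint (1\<^sub>m n) = (1\<^sub>m n :: complex mat)"
proof -
  have c: "X + Y \<in> carrier_mat n n" "X - Y \<in> carrier_mat n n" "c \<cdot>\<^sub>m X \<in> carrier_mat n n"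
    using assms by (auto intro: minus_carrier_mat)
  note x = mat_adjoint_props[OF assms(1)] and y = mat_adjoint_props[OF assms(2)]
  show "mat_adjoint (X + Y) = mat_adjoint X + mat_adjoint Y"
    by (rule eq_matI) (use assms x y mat_adjoint_props[OF c(1)] in auto)
  show "mat_adjoint (X - Y) = mat_adjoint X - mat_adjoint Y"
    by (rule eq_matI) (use assms x y mat_adjoint_props[OF c(2)] in auto)
  show "mat_adjoint (c \<cdot>\<^sub>m X) = cnj c \<cdot>\<^sub>m mat_adjoint X"
    by (rule eq_matI) (use assms x y mat_adjoint_props[OF c(3)] in auto)
  show "mat_adjoint (1\<^sub>m n) = (1\<^sub>m n :: complex mat)"
    by (rule eq_matI) (use mat_adjoint_props[OF one_carrier_mat[of n]] in auto)
qed

text \<open>Real parts are Hermitian by construction, so the Loewner order between their real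
  multiples is a statement about the real quadratic forms of X and Y alone; all later estimates are
  made there.\<close>

lemma loewner_le_ReM_iff:
  assumes "X \<in> carrier_mat n n" "Y \<in> carrier_mat n n"
  shows "loewner_le (complex_of_real c \<cdot>\<^sub>m ReM X) (complex_of_real d \<cdot>\<^sub>m ReM Y) \<longleftrightarrow>
    (\<forall>v\<in>carrier_vec n. c * Re (sesq X v v) \<le> d * Re (sesq Y v v))"
proof -
  note R = ReM_carrier[OF assms(1)] ReM_carrier[OF assms(2)]
  have c: "complex_of_real c \<cdot>\<^sub>m ReM X \<in> carrier_mat n n" "complex_of_real d \<cdot>\<^sub>m ReM Y \<in> carrier_mat n n" using R by auto
  have D: "complex_of_real d \<cdot>\<^sub>m ReM Y - complex_of_real c \<cdot>\<^sub>m ReM X \<in> carrier_mat n n" by (rule minus_carrier_mat[OF c(1)])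
  have adj: "mat_adjoint (complex_of_real d \<cdot>\<^sub>m ReM Y - complex_of_real c \<cdot>\<^sub>m ReM X) = complex_of_real d \<cdot>\<^sub>m ReM Y - complex_of_real c \<cdot>\<^sub>m ReM X"
    using mat_adjoint_lin(2)[OF c(2,1)] mat_adjoint_lin(3)[OF R(1,1)] mat_adjoint_lin(3)[OF R(2,2)]
      mat_adjoint_ReM[OF assms(1)] mat_adjoint_ReM[OF assms(2)] by simp
  have "Re (sesq (complex_of_real d \<cdot>\<^sub>m ReM Y - complex_of_real c \<cdot>\<^sub>m ReM X) v v) = d * Re (sesq Y v v) - c * Re (sesq X v v)"
    if v: "v \<in> carrier_vec n" for v
    unfolding sesq_lin_mat(2)[OF c(2,1) v v] sesq_lin_mat(3)[OF R(1,1) v v] sesq_lin_mat(3)[OF R(2,2) v v]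
      Re_sesq_ReM[OF assms(1) v] Re_sesq_ReM[OF assms(2) v] by simp
  thus ?thesis unfolding loewner_le_def psd_iff[OF D] using adj carrier_matD[OF R(1)] carrier_matD[OF R(2)] by simp
qed

text \<open>Applied to $z \pm ic\,y$ with $z = x - y$, the sector condition bounds the skew part of the form;
  this replaces the Cauchy-Schwarz inequality for sectorial forms.\<close>
lemma sector_form_bound:
  assumes X: "X \<in> carrier_mat n n" and t: "0 \<le> t"
    and sec: "\<And>v. v \<in> carrier_vec n \<Longrightarrow> \<bar>Im (sesq X v v)\<bar> \<le> t * Re (sesq X v v)"
    and pos: "\<And>v. v \<in> carrier_vec n \<Longrightarrow> 0 \<le> Re (sesq X v v)"
    and xy: "x \<in> carrier_vec n" "y \<in> carrier_vec n"
  shows "2 * Re (sesq X y x) \<le> Re (sesq X x x) + (1 + t\<^sup>2) * Re (sesq X y y)"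
proof -
  define z where "z = x + (-1) \<cdot>\<^sub>v y"
  have z: "z \<in> carrier_vec n" unfolding z_def using xy by simp
  have key: "c * (Re (sesq X y z) - Re (sesq X z y)) \<le> t * (Re (sesq X z z) + c\<^sup>2 * Re (sesq X y y))" for c :: real
  proof -
    have ex: "sesq X (z + (\<i> * of_real d) \<cdot>\<^sub>v y) (z + (\<i> * of_real d) \<cdot>\<^sub>v y) =
        sesq X z z + of_real (d\<^sup>2) * sesq X y y + \<i> * of_real d * (sesq X z y - sesq X y z)" for d :: real
    proof -
      have dy: "(\<i> * of_real d) \<cdot>\<^sub>v y \<in> carrier_vec n" using xy by simp
      have s: "z + (\<i> * of_real d) \<cdot>\<^sub>v y \<in> carrier_vec n" using z dy by simp
      show ?thesis
        unfolding sesq_add_vec(1)[OF X s z dy] sesq_add_vec(2)[OF X z z dy] sesq_add_vec(2)[OF X dy z dy]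
          sesq_smult_vec[OF X z xy(2)] sesq_smult_vec[OF X xy(2) z] sesq_smult_vec(1)[OF X s xy(2)]
          sesq_add_vec(2)[OF X xy(2) z dy] sesq_smult_vec(2)[OF X xy(2) xy(2)]
        by (simp add: algebra_simps power2_eq_square)
    qed
    have c1: "z + (\<i> * of_real d) \<cdot>\<^sub>v y \<in> carrier_vec n" for d :: real using z xy by simp
    define P where "P = Re (sesq X z z) + c\<^sup>2 * Re (sesq X y y)"
    define R where "R = Im (sesq X z z) + c\<^sup>2 * Im (sesq X y y)"
    define dr where "dr = Re (sesq X z y) - Re (sesq X y z)"
    define di where "di = Im (sesq X z y) - Im (sesq X y z)"
    have 1: "\<bar>R + c * dr\<bar> \<le> t * (P - c * di)"
      using sec[OF c1[of c]] unfolding ex by (simp add: P_def R_def dr_def di_def algebra_simps)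
    have 2: "\<bar>R - c * dr\<bar> \<le> t * (P + c * di)"
      using sec[OF c1[of "-c"]] unfolding ex by (simp add: P_def R_def dr_def di_def algebra_simps)
    \<comment> \<open>Combining the bounds for c and -c cancels the imaginary part \<open>R\<close>
      and the difference \<open>di\<close>, so that only real parts remain.\<close>
    have "- (R + c * dr) + (R - c * dr) \<le> t * (P - c * di) + t * (P + c * di)" using 1 2 by linarith
    also have "\<dots> = 2 * (t * P)" by (simp add: algebra_simps)
    finally have "- (c * dr) \<le> t * P" by linarith
    moreover have "- (c * dr) = c * (Re (sesq X y z) - Re (sesq X z y))" unfolding dr_def by (simp add: algebra_simps)
    ultimately show ?thesis unfolding P_def by simp
  qed
  \<comment> \<open>The choice c = t allows division by t and gives the constant 1 + t^2 = sec^2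
    \<theta>. For t = 0 the right-hand side of \<open>key\<close> vanishes and c = 1 already shows
    that the difference is not positive.\<close>
  have k: "Re (sesq X y z) - Re (sesq X z y) \<le> Re (sesq X z z) + t\<^sup>2 * Re (sesq X y y)"
  proof (cases "t = 0")
    case True
    thus ?thesis using key[of 1] pos[OF z] by simp
  next
    case False
    hence "0 < t" using t by simp
    moreover have "t * (Re (sesq X y z) - Re (sesq X z y)) \<le> t * (Re (sesq X z z) + t\<^sup>2 * Re (sesq X y y))" by (rule key)
    ultimately show ?thesis by simp
  qed
  have my: "(-1) \<cdot>\<^sub>v y \<in> carrier_vec n" using xy by simp
  have e1: "sesq X y z = sesq X y x - sesq X y y" "sesq X z y = sesq X x y - sesq X y y"
    unfolding z_def sesq_add_vec[OF X xy(2,1) my] sesq_smult_vec[OF X xy(2,2)] by simp_all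
  have e2: "sesq X z z = sesq X x x - sesq X y x - sesq X x y + sesq X y y"
  proof -
    have "sesq X z z = sesq X x z + sesq X ((-1) \<cdot>\<^sub>v y) z"
      using sesq_add_vec(2)[OF X z xy(1) my] by (simp add: z_def)
    also have "sesq X ((-1) \<cdot>\<^sub>v y) z = - sesq X y z" using sesq_smult_vec(2)[OF X xy(2) z] by simp
    also have "sesq X x z = sesq X x x - sesq X x y"
      unfolding z_def sesq_add_vec(1)[OF X xy(1,1) my] sesq_smult_vec(1)[OF X xy] by simp
    finally show ?thesis using e1 by simp
  qed
  show ?thesis using k unfolding e1 e2 by (simp add: algebra_simps)
qed

section \<open>Sectorial matrices and harmonic means as splittings\<close>

text \<open>The scale-free form of \<open>sector\<close> with t = tan \<theta>: quantified over all
  vectors instead of unit vectors, which suits sums of forms at different vectors. Strictness is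
  stated separately, as it fails at 0.\<close>

definition sect :: "real \<Rightarrow> nat \<Rightarrow> complex mat \<Rightarrow> bool" where
  "sect t n X \<longleftrightarrow> X \<in> carrier_mat n n \<and> (\<forall>v\<in>carrier_vec n. \<bar>Im (sesq X v v)\<bar> \<le> t * Re (sesq X v v)) \<and>
     (\<forall>v\<in>carrier_vec n. v \<noteq> 0\<^sub>v n \<longrightarrow> 0 < Re (sesq X v v))"

lemma sesq_zero_vec: "X \<in> carrier_mat n n \<Longrightarrow> sesq X (0\<^sub>v n) (0\<^sub>v n) = 0"
  by (simp add: sesq_sum[of _ n])

lemma sectD:
  assumes "sect t n X"
  shows "X \<in> carrier_mat n n" "v \<in> carrier_vec n \<Longrightarrow> \<bar>Im (sesq X v v)\<bar> \<le> t * Re (sesq X v v)"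
    "v \<in> carrier_vec n \<Longrightarrow> v \<noteq> 0\<^sub>v n \<Longrightarrow> 0 < Re (sesq X v v)" "v \<in> carrier_vec n \<Longrightarrow> 0 \<le> Re (sesq X v v)"
proof -
  show 1: "X \<in> carrier_mat n n" "v \<in> carrier_vec n \<Longrightarrow> \<bar>Im (sesq X v v)\<bar> \<le> t * Re (sesq X v v)"
    "v \<in> carrier_vec n \<Longrightarrow> v \<noteq> 0\<^sub>v n \<Longrightarrow> 0 < Re (sesq X v v)" using assms unfolding sect_def by auto
  show "v \<in> carrier_vec n \<Longrightarrow> 0 \<le> Re (sesq X v v)"
    using 1 sesq_zero_vec[OF 1(1)] by (cases "v = 0\<^sub>v n") auto
qed

lemma sector_imp_sect:
  assumes s: "sector \<theta> X" and X: "X \<in> carrier_mat n n" shows "sect (tan \<theta>) n X"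
proof -
  have "0 < Re (sesq X v v) \<and> \<bar>Im (sesq X v v)\<bar> \<le> tan \<theta> * Re (sesq X v v)" if v: "v \<in> carrier_vec n" "v \<noteq> 0\<^sub>v n" for v
  proof -
    define r where "r = sqn v"
    have r: "r > 0" unfolding r_def by (rule sqn_pos[OF v])
    define c where "c = complex_of_real (1 / sqrt r)"
    have cc: "cnj c * c = complex_of_real (1 / r)" unfolding c_def using r by (simp flip: of_real_mult of_real_divide)
    define w where "w = c \<cdot>\<^sub>v v"
    have w: "w \<in> carrier_vec n" unfolding w_def using v by simp
    have "ip w w = cnj c * (c * ip v v)" unfolding w_def using v by (simp add: ip_smult[of _ n])
    also have "\<dots> = (cnj c * c) * complex_of_real r" unfolding r_def ip_self_real[OF v(1), symmetric] by simp
    also have "\<dots> = 1" unfolding cc using r by (simp flip: of_real_mult)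
    finally have w1: "ip w w = 1" .
    have "sesq X w w = cnj c * (c * sesq X v v)" unfolding w_def
      using v X by (simp add: sesq_smult_vec[OF X])
    hence sw: "sesq X w w = complex_of_real (1 / r) * sesq X v v" using cc by (metis mult.assoc)
    have "sesq X w w \<in> numrange X" unfolding numrange_def sesq_def ip_def using w w1 X unfolding ip_def by auto
    hence "Re (sesq X w w) > 0 \<and> \<bar>Im (sesq X w w)\<bar> \<le> Re (sesq X w w) * tan \<theta>" using s unfolding sector_def by auto
    thus ?thesis unfolding sw using r by (simp add: field_simps abs_mult)
  qed
  moreover have "\<bar>Im (sesq X (0\<^sub>v n) (0\<^sub>v n))\<bar> \<le> tan \<theta> * Re (sesq X (0\<^sub>v n) (0\<^sub>v n))" unfolding sesq_zero_vec[OF X] by simp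
  ultimately show ?thesis unfolding sect_def using X by metis
qed

text \<open>A form evaluated at an eigenvector is the eigenvalue times the squared norm, so every
  eigenvalue has positive real part.\<close>

lemma sect_spec_slit:
  assumes "sect t n X" shows "spec X \<subseteq> slit"
proof
  note X = sectD[OF assms]
  fix z assume "z \<in> spec X"
  then obtain v where v: "v \<in> carrier_vec n" "v \<noteq> 0\<^sub>v n" "X *\<^sub>v v = z \<cdot>\<^sub>v v" using spec_eigenvalue[OF X(1)] by blast
  have "sesq X v v = z * ip v v" unfolding sesq_def v(3) ip_smult(1)[OF v(1,1)] ..
  also have "ip v v = complex_of_real (sqn v)" by (rule ip_self_real[OF v(1)])
  finally have "sesq X v v = z * complex_of_real (sqn v)" .
  hence "0 < Re z * sqn v" using X(3)[OF v(1,2)] by simp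
  hence "Re z > 0" using sqn_pos[OF v(1,2)] by (simp add: zero_less_mult_iff)
  thus "z \<in> slit" by (rule Re_pos_in_slit)
qed

definition pencil :: "nat \<Rightarrow> real \<Rightarrow> complex mat \<Rightarrow> complex mat \<Rightarrow> complex mat \<Rightarrow> bool" where
  "pencil n s A B H \<longleftrightarrow> H \<in> carrier_mat n n \<and> (\<forall>u\<in>carrier_vec n. \<exists>a\<in>carrier_vec n. \<exists>b\<in>carrier_vec n.
     A *\<^sub>v a = H *\<^sub>v u \<and> B *\<^sub>v b = H *\<^sub>v u \<and> u = complex_of_real s \<cdot>\<^sub>v a + complex_of_real (1 - s) \<cdot>\<^sub>v b)"

lemma pencilE:
  assumes "pencil n s A B H" "u \<in> carrier_vec n"
  obtains a b where "a \<in> carrier_vec n" "b \<in> carrier_vec n" "A *\<^sub>v a = H *\<^sub>v u" "B *\<^sub>v b = H *\<^sub>v u"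
    "u = complex_of_real s \<cdot>\<^sub>v a + complex_of_real (1 - s) \<cdot>\<^sub>v b"
  using assms unfolding pencil_def by metis

lemma pencil_test:
  assumes w: "w \<in> carrier_vec n" and ab: "a' \<in> carrier_vec n" "b' \<in> carrier_vec n"
  shows "ip (complex_of_real s \<cdot>\<^sub>v a' + complex_of_real (1 - s) \<cdot>\<^sub>v b') w = of_real s * ip a' w + of_real (1 - s) * ip b' w"
  by (subst ip_add(2)[OF w]) (use w ab in \<open>simp_all add: ip_smult[of _ n]\<close>)

text \<open>Both A a and B b equal H u, so H u may be paired with any other splitting a', b' of u.
  Taking a' = a gives the energy of the distinguished splitting; a general a' gives cross terms,
  whose comparison with the energy is the source of the variational bound.\<close>

lemma pencil_form:
  assumes H: "H \<in> carrier_mat n n" and ab: "a \<in> carrier_vec n" "b \<in> carrier_vec n" and u: "u \<in> carrier_vec n"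
    and eq: "A *\<^sub>v a = H *\<^sub>v u" "B *\<^sub>v b = H *\<^sub>v u"
    and ab': "a' \<in> carrier_vec n" "b' \<in> carrier_vec n" and u': "u = complex_of_real s \<cdot>\<^sub>v a' + complex_of_real (1 - s) \<cdot>\<^sub>v b'"
  shows "sesq H u u = of_real s * sesq A a' a + of_real (1 - s) * sesq B b' b"
proof -
  have w: "H *\<^sub>v u \<in> carrier_vec n" using H u by simp
  have "sesq H u u = ip (complex_of_real s \<cdot>\<^sub>v a' + complex_of_real (1 - s) \<cdot>\<^sub>v b') (H *\<^sub>v u)"
    unfolding sesq_def using u' by simp
  also have "\<dots> = of_real s * ip a' (H *\<^sub>v u) + of_real (1 - s) * ip b' (H *\<^sub>v u)" by (rule pencil_test[OF w ab'])
  finally show ?thesis unfolding sesq_def eq .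
qed

text \<open>Twice the form of H is a sum of cross terms, each bounded by the energy of (a, b) plus
  sec^2 times the energy of (a', b'). The first part is once the form of H and is subtracted. For t
  = 0 this is the variational description of the parallel sum.\<close>

lemma pencil_upper:
  assumes p: "pencil n s A B H" and s: "0 \<le> s" "s \<le> 1" and A: "sect t n A" and B: "sect t n B" and t: "0 \<le> t"
    and u: "u \<in> carrier_vec n"
    and ab': "a' \<in> carrier_vec n" "b' \<in> carrier_vec n" and u': "u = complex_of_real s \<cdot>\<^sub>v a' + complex_of_real (1 - s) \<cdot>\<^sub>v b'"
  shows "Re (sesq H u u) \<le> (1 + t\<^sup>2) * (s * Re (sesq A a' a') + (1 - s) * Re (sesq B b' b'))"
proof -
  obtain a b where ab: "a \<in> carrier_vec n" "b \<in> carrier_vec n" and eq: "A *\<^sub>v a = H *\<^sub>v u" "B *\<^sub>v b = H *\<^sub>v u"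
    and uu: "u = complex_of_real s \<cdot>\<^sub>v a + complex_of_real (1 - s) \<cdot>\<^sub>v b" by (rule pencilE[OF p u])
  have H: "H \<in> carrier_mat n n" using p unfolding pencil_def by simp
  have q: "Re (sesq H u u) = s * Re (sesq A a a) + (1 - s) * Re (sesq B b b)"
    unfolding pencil_form[OF H ab u eq ab uu] by simp
  have q': "Re (sesq H u u) = s * Re (sesq A a' a) + (1 - s) * Re (sesq B b' b)"
    unfolding pencil_form[OF H ab u eq ab' u'] by simp
  have "2 * Re (sesq A a' a) \<le> Re (sesq A a a) + (1 + t\<^sup>2) * Re (sesq A a' a')"
    by (rule sector_form_bound[OF sectD(1)[OF A] t sectD(2)[OF A] sectD(4)[OF A] ab(1) ab'(1)])
  moreover have "2 * Re (sesq B b' b) \<le> Re (sesq B b b) + (1 + t\<^sup>2) * Re (sesq B b' b')"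
    by (rule sector_form_bound[OF sectD(1)[OF B] t sectD(2)[OF B] sectD(4)[OF B] ab(2) ab'(2)])
  ultimately have "s * (2 * Re (sesq A a' a)) + (1 - s) * (2 * Re (sesq B b' b)) \<le>
     s * (Re (sesq A a a) + (1 + t\<^sup>2) * Re (sesq A a' a')) + (1 - s) * (Re (sesq B b b) + (1 + t\<^sup>2) * Re (sesq B b' b'))"
    using s by (intro add_mono mult_left_mono) auto
  moreover have "s * (2 * Re (sesq A a' a)) + (1 - s) * (2 * Re (sesq B b' b)) = 2 * Re (sesq H u u)"
    unfolding q' by (simp add: algebra_simps)
  moreover have "s * (Re (sesq A a a) + (1 + t\<^sup>2) * Re (sesq A a' a')) + (1 - s) * (Re (sesq B b b) + (1 + t\<^sup>2) * Re (sesq B b' b')) =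
     Re (sesq H u u) + (1 + t\<^sup>2) * (s * Re (sesq A a' a') + (1 - s) * Re (sesq B b' b'))"
    unfolding q by (simp add: algebra_simps)
  ultimately show ?thesis by linarith
qed

text \<open>In its own splitting the form of H is a nonnegative combination of values of the forms
  of A and B, and the sector is a convex cone.\<close>

lemma pencil_sector:
  assumes p: "pencil n s A B H" and s: "0 \<le> s" "s \<le> 1" and A: "sect t n A" and B: "sect t n B"
    and u: "u \<in> carrier_vec n"
  shows "\<bar>Im (sesq H u u)\<bar> \<le> t * Re (sesq H u u)"
proof -
  obtain a b where ab: "a \<in> carrier_vec n" "b \<in> carrier_vec n" and eq: "A *\<^sub>v a = H *\<^sub>v u" "B *\<^sub>v b = H *\<^sub>v u"
    and uu: "u = complex_of_real s \<cdot>\<^sub>v a + complex_of_real (1 - s) \<cdot>\<^sub>v b" by (rule pencilE[OF p u])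
  have H: "H \<in> carrier_mat n n" using p unfolding pencil_def by simp
  note q = pencil_form[OF H ab u eq ab uu]
  have "\<bar>Im (sesq H u u)\<bar> = \<bar>s * Im (sesq A a a) + (1 - s) * Im (sesq B b b)\<bar>" unfolding q by simp
  also have "\<dots> \<le> s * \<bar>Im (sesq A a a)\<bar> + (1 - s) * \<bar>Im (sesq B b b)\<bar>"
    by (rule order_trans[OF abs_triangle_ineq]) (use s in \<open>simp add: abs_mult\<close>)
  also have "\<dots> \<le> s * (t * Re (sesq A a a)) + (1 - s) * (t * Re (sesq B b b))"
    using s sectD(2)[OF A ab(1)] sectD(2)[OF B ab(2)] by (intro add_mono mult_left_mono) auto
  also have "\<dots> = t * Re (sesq H u u)" unfolding q by (simp add: algebra_simps)
  finally show ?thesis .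
qed

lemma smult_mat_mult_vec:
  fixes X :: "complex mat"
  assumes "X \<in> carrier_mat n n" "v \<in> carrier_vec n"
  shows "(c \<cdot>\<^sub>m X) *\<^sub>v v = c \<cdot>\<^sub>v (X *\<^sub>v v)"
  using assms by (intro eq_vecI) (auto simp: scalar_prod_def sum_distrib_left mult.assoc)

lemma nonneg_if_perturbed:
  fixes x c :: real assumes "\<And>e. e > 0 \<Longrightarrow> 0 \<le> x + e * c" shows "0 \<le> x"
proof (rule tendsto_lowerbound)
  have "((\<lambda>e. x + e * c) \<longlongrightarrow> x + 0 * c) (at_right 0)" by (intro tendsto_intros)
  thus "((\<lambda>e. x + e * c) \<longlongrightarrow> x) (at_right 0)" by simp
  show "\<forall>\<^sub>F e in at_right 0. 0 \<le> x + e * c" using eventually_at_right_less by eventually_elim (rule assms)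
qed simp

lemma sqn_lincomb:
  assumes "x \<in> carrier_vec n" "y \<in> carrier_vec n"
  shows "sqn (x + complex_of_real c \<cdot>\<^sub>v y) = sqn x + 2 * c * Re (ip y x) + c\<^sup>2 * sqn y"
proof -
  have cy: "complex_of_real c \<cdot>\<^sub>v y \<in> carrier_vec n" using assms by simp
  have "ip (x + complex_of_real c \<cdot>\<^sub>v y) (x + complex_of_real c \<cdot>\<^sub>v y) =
     ip x x + of_real c * ip x y + of_real c * ip y x + of_real (c\<^sup>2) * ip y y"
    unfolding ip_add(1)[OF add_carrier_vec[OF assms(1) cy] assms(1) cy] ip_add(2)[OF assms(1) assms(1) cy]
      ip_add(2)[OF cy assms(1) cy] ip_smult[OF assms] ip_smult[OF assms(2,1)] ip_smult(1)[OF cy assms(2)] ip_smult(2)[OF assms(2,2)]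
    by (simp add: power2_eq_square)
  moreover have "Re (ip x y) = Re (ip y x)" using ip_cnj[OF assms] by (metis complex_cnj(1) complex.sel(1) cnj.simps(1))
  ultimately show ?thesis by (simp add: algebra_simps)
qed

text \<open>Writing $y = Pz$ with $P$ the real part, the claim reduces to $\langle a - z, P(a - z)\rangle \ge 0$ and
  $(M - P)(P - m) \ge 0$ in the form $m M \langle z, y\rangle \le (M + m)\langle y, y\rangle - \langle y, Py\rangle$.\<close>
lemma kantorovich_tangent:
  assumes A: "A \<in> carrier_mat n n" and m: "0 < m" "m \<le> M"
    and lo: "\<And>v. v \<in> carrier_vec n \<Longrightarrow> m * sqn v \<le> Re (sesq A v v)"
    and hi: "\<And>v. v \<in> carrier_vec n \<Longrightarrow> Re (sesq A v v) \<le> M * sqn v"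
    and y: "y \<in> carrier_vec n" and a: "a \<in> carrier_vec n"
  shows "2 * Re (ip y a) - ((M + m) * sqn y - Re (sesq A y y)) / (m * M) \<le> Re (sesq A a a)"
proof -
  define P where "P = ReM A"
  have P: "P \<in> carrier_mat n n" unfolding P_def by (rule ReM_carrier[OF A])
  have PA: "Re (sesq P v v) = Re (sesq A v v)" if "v \<in> carrier_vec n" for v
    unfolding P_def Re_sesq_ReM[OF A that] by simp
  have herm: "sesq P u v = ip (P *\<^sub>v u) v" if "u \<in> carrier_vec n" "v \<in> carrier_vec n" for u v
    unfolding sesq_def ip_mult_mat[OF P that] by (simp add: P_def mat_adjoint_ReM[OF A])
  have det: "Determinant.det P \<noteq> 0"
  proof
    assume "Determinant.det P = 0"
    then obtain v where v: "v \<in> carrier_vec n" "v \<noteq> 0\<^sub>v n" "P *\<^sub>v v = 0\<^sub>v n" using det_0_iff_vec_prod_zero[OF P] by blast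
    have "sesq P v v = 0" unfolding sesq_def v(3) using v(1) by (simp add: ip_sum[of _ n])
    hence "m * sqn v \<le> 0" using lo[OF v(1)] PA[OF v(1)] by simp
    thus False using sqn_pos[OF v(1,2)] m(1) by (simp add: mult_le_0_iff)
  qed
  define z where "z = minv P *\<^sub>v y"
  note mi = minv_adj_mat(2,3)[OF P det]
  have z: "z \<in> carrier_vec n" unfolding z_def using mi(1) y by simp
  have Pz: "P *\<^sub>v z = y" unfolding z_def using assoc_mult_mat_vec[OF P mi(1) y] mi(2) y by simp
  define zz where "zz = sqn z"
  define zp where "zp = Re (ip z y)"
  define pp where "pp = sqn y"
  define pr where "pr = Re (sesq A y y)"
  have s1: "sesq P y z = ip y y" "sesq P z y = ip y y" "sesq P z z = ip z y"
    using herm[OF z y] by (simp_all add: sesq_def Pz)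
  have g: "Re (sesq A (y + complex_of_real c \<cdot>\<^sub>v z) (y + complex_of_real c \<cdot>\<^sub>v z)) = pr + 2 * c * pp + c\<^sup>2 * zp"
    "sqn (y + complex_of_real c \<cdot>\<^sub>v z) = pp + 2 * c * zp + c\<^sup>2 * zz" for c
  proof -
    have cz: "complex_of_real c \<cdot>\<^sub>v z \<in> carrier_vec n" using z by simp
    have s: "y + complex_of_real c \<cdot>\<^sub>v z \<in> carrier_vec n" using y cz by simp
    have "sesq P (y + complex_of_real c \<cdot>\<^sub>v z) (y + complex_of_real c \<cdot>\<^sub>v z) =
      sesq P y y + of_real c * ip y y + of_real c * ip y y + of_real (c\<^sup>2) * ip z y"
      unfolding sesq_add_vec(1)[OF P s y cz] sesq_add_vec(2)[OF P y y cz] sesq_smult_vec(1)[OF P s z]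
        sesq_add_vec(2)[OF P z y cz] sesq_smult_vec(2)[OF P z y] sesq_smult_vec(2)[OF P z z] s1
      by (simp add: algebra_simps power2_eq_square)
    hence "Re (sesq P (y + complex_of_real c \<cdot>\<^sub>v z) (y + complex_of_real c \<cdot>\<^sub>v z)) = Re (sesq P y y) + 2 * c * pp + c\<^sup>2 * zp"
      by (simp add: pp_def zp_def)
    thus "Re (sesq A (y + complex_of_real c \<cdot>\<^sub>v z) (y + complex_of_real c \<cdot>\<^sub>v z)) = pr + 2 * c * pp + c\<^sup>2 * zp"
      unfolding PA[OF s] PA[OF y] pr_def .
    show "sqn (y + complex_of_real c \<cdot>\<^sub>v z) = pp + 2 * c * zp + c\<^sup>2 * zz"
      unfolding sqn_lincomb[OF y z] by (simp add: pp_def zp_def zz_def)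
  qed
  \<comment> \<open>The argument divides by M' - m, and M = m is allowed; hence first M' > m, then
    M' tends to M.\<close>
  have E: "0 \<le> (M' + m) * pp - pr - m * M' * zp" if M': "m < M'" "M \<le> M'" for M'
  proof -
    \<comment> \<open>These are (P - m) z and (P - M') z. The forms of M' - P at the first and of P
      - m at the second add up to M' - m times \<langle>z, (M' - P)(P - m) z\<rangle>, the number
      \<open>G\<close> below; no diagonalization is used.\<close>
    define g1 where "g1 = y + complex_of_real (- m) \<cdot>\<^sub>v z"
    define g2 where "g2 = y + complex_of_real (- M') \<cdot>\<^sub>v z"
    have gc: "g1 \<in> carrier_vec n" "g2 \<in> carrier_vec n" unfolding g1_def g2_def using y z by auto
    have "Re (sesq A g1 g1) \<le> M * sqn g1" by (rule hi[OF gc(1)])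
    also have "\<dots> \<le> M' * sqn g1" using M' sqn_nonneg[OF gc(1)] by (intro mult_right_mono) auto
    finally have D1: "0 \<le> M' * (pp + 2 * (-m) * zp + (-m)\<^sup>2 * zz) - (pr + 2 * (-m) * pp + (-m)\<^sup>2 * zp)"
      unfolding g1_def g by simp
    have D2: "0 \<le> (pr + 2 * (-M') * pp + (-M')\<^sup>2 * zp) - m * (pp + 2 * (-M') * zp + (-M')\<^sup>2 * zz)"
      using lo[OF gc(2)] unfolding g2_def g by simp
    define G where "G = (M' + m) * zp - pp - m * M' * zz"
    have "(M' - m) * G = (M' * (pp + 2 * (-m) * zp + (-m)\<^sup>2 * zz) - (pr + 2 * (-m) * pp + (-m)\<^sup>2 * zp))
      + ((pr + 2 * (-M') * pp + (-M')\<^sup>2 * zp) - m * (pp + 2 * (-M') * zp + (-M')\<^sup>2 * zz))"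
      unfolding G_def by (simp add: algebra_simps power2_eq_square)
    hence "0 \<le> (M' - m) * G" using D1 D2 by linarith
    hence G: "0 \<le> G" using M' by (simp add: zero_le_mult_iff)
    \<comment> \<open>The target is \<langle>z, P (M' - P)(P - m) z\<rangle>; writing the leading
      factor as (P - m) + m splits it into the form at g1 and m G.\<close>
    have "(M' + m) * pp - pr - m * M' * zp = (M' * (pp + 2 * (-m) * zp + (-m)\<^sup>2 * zz) - (pr + 2 * (-m) * pp + (-m)\<^sup>2 * zp)) + m * G"
      unfolding G_def by (simp add: algebra_simps power2_eq_square)
    thus ?thesis using D1 G m(1) by (simp only: add_nonneg_nonneg mult_nonneg_nonneg less_imp_le)
  qed
  have "0 \<le> (M + m) * pp - pr - m * M * zp"
  proof (rule nonneg_if_perturbed)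
    fix e :: real assume "e > 0"
    hence "0 \<le> ((M + e) + m) * pp - pr - m * (M + e) * zp" using m by (intro E) auto
    thus "0 \<le> ((M + m) * pp - pr - m * M * zp) + e * (pp - m * zp)" by (simp add: algebra_simps)
  qed
  hence "zp * (m * M) \<le> (M + m) * pp - pr" by (simp add: algebra_simps)
  hence 1: "zp \<le> ((M + m) * pp - pr) / (m * M)" using m by (simp add: pos_le_divide_eq)
  have "0 \<le> Re (sesq A (a + (-1) \<cdot>\<^sub>v z) (a + (-1) \<cdot>\<^sub>v z))"
  proof -
    have s: "a + (-1) \<cdot>\<^sub>v z \<in> carrier_vec n" using a z by simp
    have "0 \<le> m * sqn (a + (-1) \<cdot>\<^sub>v z)" using m sqn_nonneg[OF s] by simp
    thus ?thesis using lo[OF s] by linarith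
  qed
  also have "Re (sesq A (a + (-1) \<cdot>\<^sub>v z) (a + (-1) \<cdot>\<^sub>v z)) = Re (sesq A a a) - 2 * Re (ip y a) + zp"
  proof -
    have mz: "(-1) \<cdot>\<^sub>v z \<in> carrier_vec n" using z by simp
    have s: "a + (-1) \<cdot>\<^sub>v z \<in> carrier_vec n" using a mz by simp
    have za: "sesq P z a = ip y a" unfolding herm[OF z a] Pz ..
    have az: "sesq P a z = ip a y" unfolding sesq_def Pz ..
    have "sesq P (a + (-1) \<cdot>\<^sub>v z) (a + (-1) \<cdot>\<^sub>v z) = sesq P a a - ip a y - ip y a + ip z y"
      unfolding sesq_add_vec(1)[OF P s a mz] sesq_add_vec(2)[OF P a a mz] sesq_smult_vec(1)[OF P s z]
        sesq_add_vec(2)[OF P z a mz] sesq_smult_vec(2)[OF P z a] sesq_smult_vec(2)[OF P z z] s1 za az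
      by simp
    moreover have "Re (ip a y) = Re (ip y a)" using arg_cong[OF ip_cnj[OF a y], of Re] by simp
    ultimately have "Re (sesq P (a + (-1) \<cdot>\<^sub>v z) (a + (-1) \<cdot>\<^sub>v z)) = Re (sesq P a a) - 2 * Re (ip y a) + zp"
      by (simp add: zp_def)
    thus ?thesis unfolding PA[OF s] PA[OF a] .
  qed
  finally show ?thesis using 1 unfolding pp_def pr_def by linarith
qed

text \<open>The Kantorovich bound is affine in a, so it can be used with one and the same y for a
  and for b. The linear terms then recombine, s a + (1 - s) b = u, and the unknown splitting
  disappears. Only real parts enter, so no sec factor is lost here.\<close>

lemma pencil_lower:
  assumes p: "pencil n s A B H" and s: "0 \<le> s" "s \<le> 1"
    and A: "A \<in> carrier_mat n n" and B: "B \<in> carrier_mat n n" and m: "0 < m" "m \<le> M"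
    and loA: "\<And>v. v \<in> carrier_vec n \<Longrightarrow> m * sqn v \<le> Re (sesq A v v)"
    and hiA: "\<And>v. v \<in> carrier_vec n \<Longrightarrow> Re (sesq A v v) \<le> M * sqn v"
    and loB: "\<And>v. v \<in> carrier_vec n \<Longrightarrow> m * sqn v \<le> Re (sesq B v v)"
    and hiB: "\<And>v. v \<in> carrier_vec n \<Longrightarrow> Re (sesq B v v) \<le> M * sqn v"
    and u: "u \<in> carrier_vec n"
  shows "(4 * m * M / (M + m)\<^sup>2) * (s * Re (sesq A u u) + (1 - s) * Re (sesq B u u)) \<le> Re (sesq H u u)"
proof -
  obtain a b where ab: "a \<in> carrier_vec n" "b \<in> carrier_vec n" and eq: "A *\<^sub>v a = H *\<^sub>v u" "B *\<^sub>v b = H *\<^sub>v u"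
    and uu: "u = complex_of_real s \<cdot>\<^sub>v a + complex_of_real (1 - s) \<cdot>\<^sub>v b" by (rule pencilE[OF p u])
  have H: "H \<in> carrier_mat n n" using p unfolding pencil_def by simp
  have q: "Re (sesq H u u) = s * Re (sesq A a a) + (1 - s) * Re (sesq B b b)"
    unfolding pencil_form[OF H ab u eq ab uu] by simp
  \<comment> \<open>The multiple y = l u for which the terms in |u|^2 cancel; the remaining
    coefficient l^2 / (m M) is the Kantorovich constant.\<close>
  define l where "l = 2 * m * M / (M + m)"
  define y where "y = complex_of_real l \<cdot>\<^sub>v u"
  have y: "y \<in> carrier_vec n" unfolding y_def using u by simp
  have ya: "Re (ip y c) = l * Re (ip u c)" if "c \<in> carrier_vec n" for c
    unfolding y_def using u that by (simp add: ip_smult[of _ n])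
  have yy: "sqn y = l\<^sup>2 * sqn u" unfolding y_def using u by (simp add: ip_smult[of _ n] power2_eq_square)
  have yX: "Re (sesq X y y) = l\<^sup>2 * Re (sesq X u u)" if "X \<in> carrier_mat n n" for X
    unfolding y_def using u that by (simp add: sesq_smult_vec[OF that] power2_eq_square)
  define W where "W = s * Re (sesq A u u) + (1 - s) * Re (sesq B u u)"
  have Mm: "M + m > 0" "M > 0" using m by auto
  have tA: "2 * (l * Re (ip u a)) - ((M + m) * (l\<^sup>2 * sqn u) - l\<^sup>2 * Re (sesq A u u)) / (m * M) \<le> Re (sesq A a a)"
    using kantorovich_tangent[OF A m loA hiA y ab(1)] unfolding ya[OF ab(1)] yy yX[OF A] .
  have tB: "2 * (l * Re (ip u b)) - ((M + m) * (l\<^sup>2 * sqn u) - l\<^sup>2 * Re (sesq B u u)) / (m * M) \<le> Re (sesq B b b)"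
    using kantorovich_tangent[OF B m loB hiB y ab(2)] unfolding ya[OF ab(2)] yy yX[OF B] .
  have uab: "sqn u = s * Re (ip u a) + (1 - s) * Re (ip u b)"
  proof -
    have "ip u u = ip u (complex_of_real s \<cdot>\<^sub>v a + complex_of_real (1 - s) \<cdot>\<^sub>v b)" using uu by simp
    also have "\<dots> = of_real s * ip u a + of_real (1 - s) * ip u b"
      by (subst ip_add(1)[OF u]) (use u ab in \<open>simp_all add: ip_smult[of _ n]\<close>)
    finally show ?thesis by simp
  qed
  have "s * (2 * (l * Re (ip u a)) - ((M + m) * (l\<^sup>2 * sqn u) - l\<^sup>2 * Re (sesq A u u)) / (m * M)) +
     (1 - s) * (2 * (l * Re (ip u b)) - ((M + m) * (l\<^sup>2 * sqn u) - l\<^sup>2 * Re (sesq B u u)) / (m * M)) \<le> Re (sesq H u u)"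
    unfolding q using s tA tB by (intro add_mono mult_left_mono) auto
  also have "s * (2 * (l * Re (ip u a)) - ((M + m) * (l\<^sup>2 * sqn u) - l\<^sup>2 * Re (sesq A u u)) / (m * M)) +
     (1 - s) * (2 * (l * Re (ip u b)) - ((M + m) * (l\<^sup>2 * sqn u) - l\<^sup>2 * Re (sesq B u u)) / (m * M)) =
     2 * l * (s * Re (ip u a) + (1 - s) * Re (ip u b)) - ((M + m) * (l\<^sup>2 * sqn u) - l\<^sup>2 * W) / (m * M)"
    unfolding W_def by (simp add: algebra_simps diff_divide_distrib add_divide_distrib)
  also have "\<dots> = (2 * l - (M + m) * l\<^sup>2 / (m * M)) * sqn u + l\<^sup>2 / (m * M) * W"
    unfolding uab[symmetric] by (simp add: algebra_simps diff_divide_distrib)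
  also have "2 * l - (M + m) * l\<^sup>2 / (m * M) = 0"
  proof -
    have "2 * (2 * m * M / D) - D * (2 * m * M / D)\<^sup>2 / (m * M) = 0" if "D \<noteq> 0" for D
      using that m Mm by (simp add: divide_simps power2_eq_square)
    thus ?thesis unfolding l_def using Mm by simp
  qed
  also have "l\<^sup>2 / (m * M) = 4 * m * M / (M + m)\<^sup>2"
  proof -
    have "(2 * m * M / D)\<^sup>2 / (m * M) = 4 * m * M / D\<^sup>2" if "D \<noteq> 0" for D
      using that m Mm by (simp add: divide_simps power2_eq_square)
    thus ?thesis unfolding l_def using Mm by simp
  qed
  finally show ?thesis unfolding W_def by simp
qed

section \<open>Functions of matrices and operator means as pencils\<close>

lemma sect_det_nonzero:
  assumes "sect t n A" shows "Determinant.det A \<noteq> 0"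
proof
  note A = sectD[OF assms]
  assume "Determinant.det A = 0"
  then obtain v where v: "v \<in> carrier_vec n" "v \<noteq> 0\<^sub>v n" "A *\<^sub>v v = 0\<^sub>v n" using det_0_iff_vec_prod_zero[OF A(1)] by blast
  have "sesq A v v = 0" unfolding sesq_def v(3) using v(1) by (simp add: ip_sum[of _ n])
  thus False using A(3)[OF v(1,2)] by simp
qed

text \<open>h_s(X) is the harmonic mean of 1 and X, so the estimates for means also serve for the
  functional calculus. With V inverse to s X + (1 - s), the splitting is b = V u and a = X
  b.\<close>

lemma mfun_harm_pencil:
  assumes X: "X \<in> carrier_mat n n" "spec X \<subseteq> slit" and s: "0 \<le> s" "s \<le> 1"
  shows "pencil n s (1\<^sub>m n) X (mfun (wharm s) X)"
  unfolding pencil_def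
proof (intro conjI ballI)
  show "mfun (wharm s) X \<in> carrier_mat n n" using X by simp
  obtain V where V: "V \<in> carrier_mat n n"
    "(of_real s \<cdot>\<^sub>m X + of_real (1 - s) \<cdot>\<^sub>m 1\<^sub>m n) * V = 1\<^sub>m n" "mfun (wharm s) X = X * V"
    by (rule mfun_harm[OF X s])
  fix u :: "complex Matrix.vec" assume u: "u \<in> carrier_vec n"
  define b where "b = V *\<^sub>v u"
  have b: "b \<in> carrier_vec n" unfolding b_def using V u by simp
  have Xb: "X *\<^sub>v b \<in> carrier_vec n" using X b by simp
  have Hu: "mfun (wharm s) X *\<^sub>v u = X *\<^sub>v b" unfolding V(3) b_def by (rule assoc_mult_mat_vec[OF X(1) V(1) u])
  have "complex_of_real s \<cdot>\<^sub>v (X *\<^sub>v b) + complex_of_real (1 - s) \<cdot>\<^sub>v b = (of_real s \<cdot>\<^sub>m X + of_real (1 - s) \<cdot>\<^sub>m 1\<^sub>m n) *\<^sub>v b"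
  proof -
    have "(of_real s \<cdot>\<^sub>m X + of_real (1 - s) \<cdot>\<^sub>m 1\<^sub>m n) *\<^sub>v b = (of_real s \<cdot>\<^sub>m X) *\<^sub>v b + (of_real (1 - s) \<cdot>\<^sub>m 1\<^sub>m n) *\<^sub>v b"
      by (rule add_mult_distrib_mat_vec[of _ n n]) (use X b in auto)
    also have "(of_real s \<cdot>\<^sub>m X) *\<^sub>v b = complex_of_real s \<cdot>\<^sub>v (X *\<^sub>v b)" by (rule smult_mat_mult_vec[OF X(1) b])
    also have "(of_real (1 - s) \<cdot>\<^sub>m 1\<^sub>m n) *\<^sub>v b = complex_of_real (1 - s) \<cdot>\<^sub>v (1\<^sub>m n *\<^sub>v b)" by (rule smult_mat_mult_vec[OF one_carrier_mat b])
    finally show ?thesis using b by simp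
  qed
  also have "\<dots> = ((of_real s \<cdot>\<^sub>m X + of_real (1 - s) \<cdot>\<^sub>m 1\<^sub>m n) * V) *\<^sub>v u"
  proof -
    have "of_real s \<cdot>\<^sub>m X + of_real (1 - s) \<cdot>\<^sub>m 1\<^sub>m n \<in> carrier_mat n n" using X by simp
    thus ?thesis unfolding b_def by (rule assoc_mult_mat_vec[symmetric, OF _ V(1) u])
  qed
  also have "\<dots> = u" unfolding V(2) using u by simp
  finally have eq: "u = complex_of_real s \<cdot>\<^sub>v (X *\<^sub>v b) + complex_of_real (1 - s) \<cdot>\<^sub>v b" ..
  show "\<exists>a\<in>carrier_vec n. \<exists>b\<in>carrier_vec n. 1\<^sub>m n *\<^sub>v a = mfun (wharm s) X *\<^sub>v u \<and> X *\<^sub>v b = mfun (wharm s) X *\<^sub>v u \<and>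
     u = complex_of_real s \<cdot>\<^sub>v a + complex_of_real (1 - s) \<cdot>\<^sub>v b"
    by (rule bexI[OF _ Xb], rule bexI[OF _ b]) (use eq Hu Xb in simp)
qed

text \<open>Multiplication by S = A^{1/2} on both sides carries a splitting for 1 and T to one for A
  and B, after pulling the vectors back by the inverse of S. S is in general not Hermitian, so the
  argument relies on S S = A and not on a congruence of forms.\<close>

lemma mmean_pencil:
  assumes A: "sect t n A" and B: "sect t n B"
  obtains S T where "S \<in> carrier_mat n n" "T \<in> carrier_mat n n" "spec T \<subseteq> slit"
    "\<And>g. mmean g A B = S * mfun g T * S"
    "\<And>s. 0 \<le> s \<Longrightarrow> s \<le> 1 \<Longrightarrow> pencil n s A B (S * mfun (wharm s) T * S)"
proof -
  note cA = sectD(1)[OF A] and cB = sectD(1)[OF B]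
  define S where "S = mfun csqrt A"
  have S: "S \<in> carrier_mat n n" unfolding S_def using cA by simp
  obtain w s0 J where "harm_approx w s0 J csqrt" using harm_approx_csqrt by blast
  hence SS: "S * S = A" unfolding S_def by (rule mfun_csqrt_square[OF _ cA sect_spec_slit[OF A]])
  have "Determinant.det S * Determinant.det S \<noteq> 0" using det_mult[OF S S] SS sect_det_nonzero[OF A] by simp
  hence dS: "Determinant.det S \<noteq> 0" by simp
  define Si where "Si = minv S"
  have Si: "Si \<in> carrier_mat n n" "S * Si = 1\<^sub>m n" "Si * S = 1\<^sub>m n" unfolding Si_def using minv_adj_mat[OF S dS] by auto
  define T where "T = Si * B * Si"
  have SiB: "Si * B \<in> carrier_mat n n" using Si cB by simp
  have T: "T \<in> carrier_mat n n" unfolding T_def using SiB Si by simp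
  have SSi: "S *\<^sub>v (Si *\<^sub>v v) = v" "Si *\<^sub>v (S *\<^sub>v v) = v" if "v \<in> carrier_vec n" for v
    using assoc_mult_mat_vec[OF S Si(1) that] assoc_mult_mat_vec[OF Si(1) S that] Si that by auto
  have Av: "A *\<^sub>v v = S *\<^sub>v (S *\<^sub>v v)" if "v \<in> carrier_vec n" for v
    unfolding SS[symmetric] by (rule assoc_mult_mat_vec[OF S S that])
  have Tv: "T *\<^sub>v v = Si *\<^sub>v (B *\<^sub>v (Si *\<^sub>v v))" if v: "v \<in> carrier_vec n" for v
  proof -
    have w: "Si *\<^sub>v v \<in> carrier_vec n" using Si v by simp
    have "T *\<^sub>v v = (Si * B) *\<^sub>v (Si *\<^sub>v v)" unfolding T_def by (rule assoc_mult_mat_vec[OF SiB Si(1) v])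
    also have "\<dots> = Si *\<^sub>v (B *\<^sub>v (Si *\<^sub>v v))" by (rule assoc_mult_mat_vec[OF Si(1) cB w])
    finally show ?thesis .
  qed
  \<comment> \<open>T itself may fail to be accretive. An eigenvector of T yields w \<noteq> 0 with
    B w = z A w, and a real z \<le> 0 would contradict positivity of both real parts at w.\<close>
  have sT: "spec T \<subseteq> slit"
  proof
    fix z assume "z \<in> spec T"
    then obtain v where v: "v \<in> carrier_vec n" "v \<noteq> 0\<^sub>v n" "T *\<^sub>v v = z \<cdot>\<^sub>v v" using spec_eigenvalue[OF T] by blast
    define w where "w = Si *\<^sub>v v"
    have w: "w \<in> carrier_vec n" unfolding w_def using Si v by simp
    have Bw: "B *\<^sub>v w \<in> carrier_vec n" using cB w by simp
    have Sw: "S *\<^sub>v w = v" unfolding w_def by (rule SSi(1)[OF v(1)])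
    have w0: "w \<noteq> 0\<^sub>v n"
    proof
      assume "w = 0\<^sub>v n"
      hence "v = S *\<^sub>v 0\<^sub>v n" using Sw by simp
      also have "\<dots> = 0\<^sub>v n" using S by (intro eq_vecI) auto
      finally show False using v by simp
    qed
    have "B *\<^sub>v w = S *\<^sub>v (T *\<^sub>v v)" unfolding Tv[OF v(1)] w_def[symmetric] SSi(1)[OF Bw] ..
    also have "\<dots> = z \<cdot>\<^sub>v (S *\<^sub>v v)" unfolding v(3) by (rule mult_mat_vec[OF S v(1)])
    also have "S *\<^sub>v v = A *\<^sub>v w" unfolding Av[OF w] Sw ..
    finally have e: "B *\<^sub>v w = z \<cdot>\<^sub>v (A *\<^sub>v w)" .
    have Aw: "A *\<^sub>v w \<in> carrier_vec n" using cA w by simp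
    have q: "sesq B w w = z * sesq A w w" unfolding sesq_def e by (rule ip_smult(1)[OF w Aw])
    show "z \<in> slit"
    proof (rule ccontr)
      assume "z \<notin> slit"
      hence z: "Im z = 0" "Re z \<le> 0" by (auto simp: slit_def)
      have "Re (sesq B w w) = Re z * Re (sesq A w w)" unfolding q using z by simp
      also have "\<dots> \<le> 0" using z sectD(3)[OF A w w0] by (simp add: mult_le_0_iff)
      finally show False using sectD(3)[OF B w w0] by simp
    qed
  qed
  show ?thesis
  proof (rule that[OF S T sT])
    show "mmean g A B = S * mfun g T * S" for g unfolding mmean_def Let_def S_def Si_def T_def ..
    fix s :: real assume s: "0 \<le> s" "s \<le> 1"
    let ?h = "mfun (wharm s) T"
    have h: "?h \<in> carrier_mat n n" using T by simp
    have Sh: "S * ?h \<in> carrier_mat n n" using S h by simp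
    show "pencil n s A B (S * ?h * S)"
      unfolding pencil_def
    proof (intro conjI ballI)
      show "S * ?h * S \<in> carrier_mat n n" using Sh S by simp
      fix u :: "complex Matrix.vec" assume u: "u \<in> carrier_vec n"
      have Su: "S *\<^sub>v u \<in> carrier_vec n" using S u by simp
      obtain a0 b0 where ab0: "a0 \<in> carrier_vec n" "b0 \<in> carrier_vec n" "1\<^sub>m n *\<^sub>v a0 = ?h *\<^sub>v (S *\<^sub>v u)" "T *\<^sub>v b0 = ?h *\<^sub>v (S *\<^sub>v u)"
        "S *\<^sub>v u = complex_of_real s \<cdot>\<^sub>v a0 + complex_of_real (1 - s) \<cdot>\<^sub>v b0"
        by (rule pencilE[OF mfun_harm_pencil[OF T sT s] Su])
      have a0: "a0 = ?h *\<^sub>v (S *\<^sub>v u)" using ab0(1,3) by simp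
      have Hu: "(S * ?h * S) *\<^sub>v u = S *\<^sub>v a0"
        unfolding a0 assoc_mult_mat_vec[OF Sh S u] by (rule assoc_mult_mat_vec[OF S h Su])
      define a where "a = Si *\<^sub>v a0"
      define b where "b = Si *\<^sub>v b0"
      have ab: "a \<in> carrier_vec n" "b \<in> carrier_vec n" unfolding a_def b_def using Si ab0 by auto
      have Bb: "B *\<^sub>v b \<in> carrier_vec n" using cB ab by simp
      have 1: "A *\<^sub>v a = S *\<^sub>v a0" unfolding Av[OF ab(1)] unfolding a_def SSi(1)[OF ab0(1)] ..
      have 2: "B *\<^sub>v b = S *\<^sub>v a0"
      proof -
        have "S *\<^sub>v a0 = S *\<^sub>v (T *\<^sub>v b0)" unfolding ab0(4) a0 ..
        also have "\<dots> = B *\<^sub>v b" unfolding Tv[OF ab0(2)] b_def[symmetric] by (rule SSi(1)[OF Bb])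
        finally show ?thesis ..
      qed
      have 3: "u = complex_of_real s \<cdot>\<^sub>v a + complex_of_real (1 - s) \<cdot>\<^sub>v b"
      proof -
        have "u = Si *\<^sub>v (S *\<^sub>v u)" using SSi(2)[OF u] ..
        also have "\<dots> = Si *\<^sub>v (complex_of_real s \<cdot>\<^sub>v a0) + Si *\<^sub>v (complex_of_real (1 - s) \<cdot>\<^sub>v b0)"
          unfolding ab0(5) by (rule mult_add_distrib_mat_vec[OF Si(1)]) (use ab0 in auto)
        also have "\<dots> = complex_of_real s \<cdot>\<^sub>v a + complex_of_real (1 - s) \<cdot>\<^sub>v b"
          unfolding mult_mat_vec[OF Si(1) ab0(1)] mult_mat_vec[OF Si(1) ab0(2)] a_def b_def ..
        finally show ?thesis .
      qed
      show "\<exists>a\<in>carrier_vec n. \<exists>b\<in>carrier_vec n. A *\<^sub>v a = S * ?h * S *\<^sub>v u \<and> B *\<^sub>v b = S * ?h * S *\<^sub>v u \<and>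
         u = complex_of_real s \<cdot>\<^sub>v a + complex_of_real (1 - s) \<cdot>\<^sub>v b"
        by (rule bexI[OF _ ab(1)], rule bexI[OF _ ab(2)]) (use 1 2 3 Hu in simp)
    qed
  qed
qed

section \<open>Passing to the limit\<close>

lemma sesq_mfun_limit:
  assumes h: "harm_approx w s J f" and X: "X \<in> carrier_mat n n" "spec X \<subseteq> slit"
    and u: "u \<in> carrier_vec n" and v: "v \<in> carrier_vec n"
  shows "(\<lambda>N. \<Sum>k<J N. of_real (w N k) * sesq (mfun (wharm (s N k)) X) u v) \<longlonglongrightarrow> sesq (mfun f X) u v"
proof -
  have "(\<lambda>N. \<Sum>i<n. \<Sum>j<n. cnj (u $ i) * (\<Sum>k<J N. of_real (w N k) * mfun (wharm (s N k)) X $$ (i,j)) * v $ j)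
     \<longlonglongrightarrow> (\<Sum>i<n. \<Sum>j<n. cnj (u $ i) * mfun f X $$ (i,j) * v $ j)"
    by (intro tendsto_sum tendsto_mult tendsto_const harm_approx_mfun[OF h X]) auto
  moreover have "(\<Sum>i<n. \<Sum>j<n. cnj (u $ i) * (\<Sum>k<J N. of_real (w N k) * mfun (wharm (s N k)) X $$ (i,j)) * v $ j) =
     (\<Sum>k<J N. of_real (w N k) * sesq (mfun (wharm (s N k)) X) u v)" for N
  proof -
    have "(\<Sum>k<J N. of_real (w N k) * sesq (mfun (wharm (s N k)) X) u v) =
       (\<Sum>k<J N. \<Sum>i<n. \<Sum>j<n. of_real (w N k) * (cnj (u $ i) * mfun (wharm (s N k)) X $$ (i,j) * v $ j))"
      using X by (simp add: sesq_sum[OF u v] sum_distrib_left)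
    also have "\<dots> = (\<Sum>i<n. \<Sum>k<J N. \<Sum>j<n. of_real (w N k) * (cnj (u $ i) * mfun (wharm (s N k)) X $$ (i,j) * v $ j))"
      by (rule sum.swap)
    also have "\<dots> = (\<Sum>i<n. \<Sum>j<n. \<Sum>k<J N. of_real (w N k) * (cnj (u $ i) * mfun (wharm (s N k)) X $$ (i,j) * v $ j))"
      by (intro sum.cong refl sum.swap)
    also have "\<dots> = (\<Sum>i<n. \<Sum>j<n. cnj (u $ i) * (\<Sum>k<J N. of_real (w N k) * mfun (wharm (s N k)) X $$ (i,j)) * v $ j)"
      unfolding sum_distrib_left sum_distrib_right by (intro sum.cong refl) (simp only: mult_ac)
    finally show ?thesis ..
  qed
  ultimately show ?thesis using mfun_carrier[OF X(1), of f] by (simp add: sesq_sum[OF u v])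
qed

lemma Re_sesq_mfun_limit:
  assumes "harm_approx w s J f" "X \<in> carrier_mat n n" "spec X \<subseteq> slit" "u \<in> carrier_vec n" "v \<in> carrier_vec n"
  shows "(\<lambda>N. \<Sum>k<J N. w N k * Re (sesq (mfun (wharm (s N k)) X) u v)) \<longlonglongrightarrow> Re (sesq (mfun f X) u v)"
proof -
  have "Re (\<Sum>k<J N. of_real (w N k) * sesq (mfun (wharm (s N k)) X) u v) =
     (\<Sum>k<J N. w N k * Re (sesq (mfun (wharm (s N k)) X) u v))" for N unfolding Re_sum by simp
  thus ?thesis using tendsto_Re[OF sesq_mfun_limit[OF assms]] by (simp only:)
qed

lemma Im_sesq_mfun_limit:
  assumes "harm_approx w s J f" "X \<in> carrier_mat n n" "spec X \<subseteq> slit" "u \<in> carrier_vec n" "v \<in> carrier_vec n"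
  shows "(\<lambda>N. \<Sum>k<J N. w N k * Im (sesq (mfun (wharm (s N k)) X) u v)) \<longlonglongrightarrow> Im (sesq (mfun f X) u v)"
proof -
  have "Im (\<Sum>k<J N. of_real (w N k) * sesq (mfun (wharm (s N k)) X) u v) =
     (\<Sum>k<J N. w N k * Im (sesq (mfun (wharm (s N k)) X) u v))" for N unfolding Im_sum by simp
  thus ?thesis using tendsto_Im[OF sesq_mfun_limit[OF assms]] by (simp only:)
qed

text \<open>The form of S h S at u is the form of h at the pair (adjoint of S applied to u, S u).
  These differ for non-Hermitian S, which is why the preceding limits are stated for two
  vectors.\<close>

lemma Re_sesq_conj_limit:
  assumes h: "harm_approx w s J f" and X: "X \<in> carrier_mat n n" "spec X \<subseteq> slit" and S: "S \<in> carrier_mat n n"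
    and u: "u \<in> carrier_vec n"
  shows "(\<lambda>N. \<Sum>k<J N. w N k * Re (sesq (S * mfun (wharm (s N k)) X * S) u u)) \<longlonglongrightarrow> Re (sesq (S * mfun f X * S) u u)"
proof -
  have e: "sesq (S * mfun g X * S) u u = sesq (mfun g X) (mat_adjoint S *\<^sub>v u) (S *\<^sub>v u)" for g
  proof -
    have g: "mfun g X \<in> carrier_mat n n" using X by simp
    have Sg: "S * mfun g X \<in> carrier_mat n n" using S g by simp
    have Su: "S *\<^sub>v u \<in> carrier_vec n" using S u by simp
    have gSu: "mfun g X *\<^sub>v (S *\<^sub>v u) \<in> carrier_vec n" using g Su by simp
    have "(S * mfun g X * S) *\<^sub>v u = S *\<^sub>v (mfun g X *\<^sub>v (S *\<^sub>v u))"
      unfolding assoc_mult_mat_vec[OF Sg S u] by (rule assoc_mult_mat_vec[OF S g Su])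
    thus ?thesis unfolding sesq_def using ip_mult_mat[OF S u gSu] by simp
  qed
  have "mat_adjoint S *\<^sub>v u \<in> carrier_vec n" "S *\<^sub>v u \<in> carrier_vec n"
    using mult_mat_vec_carrier[OF mat_adjoint_props(1)[OF S] u] S u by auto
  from Re_sesq_mfun_limit[OF h X this] show ?thesis unfolding e .
qed

text \<open>Each h_s has value 1 and derivative 1 - s at the point 1. Locally uniform convergence of
  holomorphic functions carries over to derivatives, so both moments of the weights have
  limits.\<close>

lemma harm_approx_weights:
  assumes h: "harm_approx w s J f" and f1: "f 1 = 1"
  shows "(\<lambda>N. \<Sum>k<J N. w N k) \<longlonglongrightarrow> 1" "(\<lambda>N. \<Sum>k<J N. w N k * (1 - s N k)) \<longlonglongrightarrow> Re (deriv f 1)"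
proof -
  note d = harm_approxD[OF h]
  have 1: "(1::complex) \<in> slit" using of_real_in_slit[of 1] by simp
  have "uniform_limit {1} (\<lambda>N z. \<Sum>j<J N. of_real (w N j) * wharm (s N j) z) f sequentially"
    by (rule d(5)) (use 1 in auto)
  from tendsto_Re[OF tendsto_uniform_limitI[OF this, of 1]]
  show "(\<lambda>N. \<Sum>k<J N. w N k) \<longlonglongrightarrow> 1" unfolding Re_sum by (simp add: f1 wharm_def)
  have cb: "cball (1::complex) (1/2) \<subseteq> slit"
  proof
    fix z :: complex assume "z \<in> cball 1 (1/2)"
    hence "cmod (1 - z) \<le> 1/2" by (simp add: dist_norm)
    moreover have "1 - Re z \<le> cmod (1 - z)" using complex_Re_le_cmod[of "1 - z"] by simp
    ultimately show "z \<in> slit" by (intro Re_pos_in_slit) linarith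
  qed
  have ul: "uniform_limit (ball 1 (1/2)) (\<lambda>N z. \<Sum>j<J N. of_real (w N j) * wharm (s N j) z) f sequentially"
    by (rule uniform_limit_on_subset[OF d(5)[OF compact_cball cb]]) auto
  have hol: "(\<lambda>z. \<Sum>j<J N. of_real (w N j) * wharm (s N j) z) holomorphic_on ball 1 (1/2)" for N
    using cb by (intro holomorphic_intros holomorphic_on_subset[OF holomorphic_harm[OF d(2,3)]]) auto
  have "(\<lambda>N. deriv (\<lambda>z. \<Sum>j<J N. of_real (w N j) * wharm (s N j) z) 1) \<longlonglongrightarrow> deriv f 1"
    by (rule deriv_complex_uniform_limit[OF ul]) (use hol in auto)
  moreover have "deriv (\<lambda>z. \<Sum>j<J N. of_real (w N j) * wharm (s N j) z) 1 = of_real (\<Sum>k<J N. w N k * (1 - s N k))" for N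
  proof (rule DERIV_imp_deriv)
    have "(wharm \<sigma> has_field_derivative of_real (1 - \<sigma>)) (at 1)" for \<sigma>
      unfolding wharm_def[abs_def] by (rule derivative_eq_intros refl | simp)+
    hence "((\<lambda>z. \<Sum>j<J N. of_real (w N j) * wharm (s N j) z) has_field_derivative (\<Sum>k<J N. of_real (w N k) * of_real (1 - s N k))) (at 1)"
      by (intro DERIV_sum DERIV_cmult)
    thus "((\<lambda>z. \<Sum>j<J N. of_real (w N j) * wharm (s N j) z) has_field_derivative of_real (\<Sum>k<J N. w N k * (1 - s N k))) (at 1)"
      by simp
  qed
  ultimately have "(\<lambda>N. complex_of_real (\<Sum>k<J N. w N k * (1 - s N k))) \<longlonglongrightarrow> deriv f 1" by simp
  from tendsto_Re[OF this] show "(\<lambda>N. \<Sum>k<J N. w N k * (1 - s N k)) \<longlonglongrightarrow> Re (deriv f 1)" by simp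
qed

text \<open>The difference v + (1 - v) x - g(x) is nonnegative and vanishes at 1, so 1 is a minimum
  and the derivative there is zero.\<close>

lemma mean_derivative_at_one:
  fixes v :: real
  assumes g: "g holomorphic_on slit" "g 1 = 1"
    and le: "\<And>x::real. x > 0 \<Longrightarrow> Re (g (complex_of_real x)) \<le> v + (1 - v) * x"
  shows "Re (deriv g 1) = 1 - v"
proof -
  have 1: "(1::complex) \<in> slit" using of_real_in_slit[of 1] by simp
  have "(g has_field_derivative deriv g 1) (at (of_real 1))"
    using holomorphic_derivI[OF g(1) open_slit 1] by simp
  hence D: "((\<lambda>x. Re (g (complex_of_real x))) has_real_derivative Re (deriv g 1)) (at 1)"
    by (intro has_field_derivative_Re has_vector_derivative_real_field)
  have "((\<lambda>x. v + (1 - v) * x) has_real_derivative 1 - v) (at 1)"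
    by (auto intro!: derivative_eq_intros)
  from DERIV_diff[OF this D]
  have "(1 - v) - Re (deriv g 1) = 0"
  proof (rule DERIV_local_min[of _ _ _ 1])
    show "\<forall>y. \<bar>1 - y\<bar> < 1 \<longrightarrow> v + (1 - v) * 1 - Re (g (complex_of_real 1)) \<le> v + (1 - v) * y - Re (g (complex_of_real y))"
    proof (intro allI impI)
      fix y :: real assume "\<bar>1 - y\<bar> < 1"
      hence "y > 0" by linarith
      thus "v + (1 - v) * 1 - Re (g (complex_of_real 1)) \<le> v + (1 - v) * y - Re (g (complex_of_real y))"
        using le[of y] g(2) by simp
    qed
  qed simp
  thus ?thesis by simp
qed

section \<open>Positive unital maps and sectorial matrices in the limit\<close>

text \<open>Positivity of \<Phi> concerns Hermitian arguments only. That \<Phi> keeps Hermitian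
  matrices Hermitian follows by shifting them into the positive cone; then real and imaginary parts
  may be treated separately.\<close>

lemma pos_linear_ReM:
  assumes \<Phi>: "pos_unital_linear n k \<Phi>" and C: "C \<in> carrier_mat n n"
    and pos: "\<And>v. v \<in> carrier_vec n \<Longrightarrow> 0 \<le> Re (sesq C v v)" and x: "x \<in> carrier_vec k"
  shows "0 \<le> Re (sesq (\<Phi> C) x x)"
proof -
  have car: "\<Phi> X \<in> carrier_mat k k" if "X \<in> carrier_mat n n" for X using \<Phi> that unfolding pos_unital_linear_def by blast
  have add: "\<Phi> (X + Y) = \<Phi> X + \<Phi> Y" if "X \<in> carrier_mat n n" "Y \<in> carrier_mat n n" for X Y
    using \<Phi> that unfolding pos_unital_linear_def by blast
  have smult: "\<Phi> (c \<cdot>\<^sub>m X) = c \<cdot>\<^sub>m \<Phi> X" if "X \<in> carrier_mat n n" for c X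
    using \<Phi> that unfolding pos_unital_linear_def by blast
  have psd: "psd (\<Phi> X)" if "X \<in> carrier_mat n n" "psd X" for X using \<Phi> that unfolding pos_unital_linear_def by blast
  have herm: "mat_adjoint (\<Phi> H) = \<Phi> H" if H: "H \<in> carrier_mat n n" "mat_adjoint H = H" for H
  proof -
    \<comment> \<open>The sum of the moduli of the entries bounds the form of H by c |v|^2, so H + c
      is positive semidefinite.\<close>
    define c where "c = (\<Sum>i<n. \<Sum>j<n. cmod (H $$ (i,j)))"
    define D where "D = H + complex_of_real c \<cdot>\<^sub>m 1\<^sub>m n"
    have c1: "complex_of_real c \<cdot>\<^sub>m 1\<^sub>m n \<in> carrier_mat n n" by simp
    have D: "D \<in> carrier_mat n n" unfolding D_def using H by simp
    have "psd D" unfolding psd_iff[OF D]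
    proof (intro conjI ballI)
      show "mat_adjoint D = D" unfolding D_def mat_adjoint_lin(1)[OF H(1) c1] mat_adjoint_lin(3)[OF one_carrier_mat one_carrier_mat]
        using H mat_adjoint_lin(4)[OF one_carrier_mat[of n] one_carrier_mat[of n]] by simp
      fix v :: "complex Matrix.vec" assume v: "v \<in> carrier_vec n"
      have vi: "(cmod (v $ i))\<^sup>2 \<le> sqn v" if "i < n" for i
        unfolding sqn_sum[OF v] using that by (intro member_le_sum[of i "{..<n}" "\<lambda>i. (cmod (v $ i))\<^sup>2"]) auto
      have vij: "cmod (v $ i) * cmod (v $ j) \<le> sqn v" if "i < n" "j < n" for i j
      proof -
        have "2 * (cmod (v $ i) * cmod (v $ j)) \<le> (cmod (v $ i))\<^sup>2 + (cmod (v $ j))\<^sup>2"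
          using sum_squares_bound[of "cmod (v $ i)" "cmod (v $ j)"] by (simp only: mult.assoc)
        thus ?thesis using vi[OF that(1)] vi[OF that(2)] by linarith
      qed
      have "- Re (sesq H v v) \<le> cmod (sesq H v v)" using abs_Re_le_cmod[of "sesq H v v"] by linarith
      also have "\<dots> \<le> (\<Sum>i<n. \<Sum>j<n. cmod (H $$ (i,j)) * sqn v)"
        unfolding sesq_sum[OF v v H(1)]
      proof (intro sum_norm_le)
        fix i j assume "i \<in> {..<n}" "j \<in> {..<n}"
        hence ij: "i < n" "j < n" by auto
        have "norm (cnj (v $ i) * H $$ (i,j) * v $ j) = cmod (H $$ (i,j)) * (cmod (v $ i) * cmod (v $ j))"
          by (simp add: norm_mult mult_ac)
        also have "\<dots> \<le> cmod (H $$ (i,j)) * sqn v" by (intro mult_left_mono vij ij) auto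
        finally show "norm (cnj (v $ i) * H $$ (i,j) * v $ j) \<le> cmod (H $$ (i,j)) * sqn v" .
      qed
      also have "\<dots> = c * sqn v" unfolding c_def sum_distrib_right ..
      finally have "0 \<le> Re (sesq H v v) + c * sqn v" by linarith
      also have "\<dots> = Re (sesq D v v)"
        unfolding D_def sesq_lin_mat(1)[OF H(1) c1 v v] sesq_lin_mat(3)[OF one_carrier_mat one_carrier_mat v v] sesq_one[OF v v] by simp
      finally show "0 \<le> Re (sesq D v v)" .
    qed
    from psd[OF D this] have "mat_adjoint (\<Phi> D) = \<Phi> D" using psd_iff[OF car[OF D]] by blast
    moreover have "\<Phi> D = \<Phi> H + complex_of_real c \<cdot>\<^sub>m 1\<^sub>m k"
      unfolding D_def add[OF H(1) c1] smult[OF one_carrier_mat] using \<Phi> unfolding pos_unital_linear_def by simp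
    moreover have "mat_adjoint (\<Phi> H + complex_of_real c \<cdot>\<^sub>m 1\<^sub>m k) = mat_adjoint (\<Phi> H) + complex_of_real c \<cdot>\<^sub>m 1\<^sub>m k"
      using mat_adjoint_lin(1)[OF car[OF H(1)], of "complex_of_real c \<cdot>\<^sub>m 1\<^sub>m k"] mat_adjoint_lin(3)[OF one_carrier_mat[of k] one_carrier_mat[of k], of "complex_of_real c"]
        mat_adjoint_lin(4)[OF one_carrier_mat[of k] one_carrier_mat[of k]] by simp
    ultimately have e: "mat_adjoint (\<Phi> H) + complex_of_real c \<cdot>\<^sub>m 1\<^sub>m k = \<Phi> H + complex_of_real c \<cdot>\<^sub>m 1\<^sub>m k" by simp
    show ?thesis
    proof (rule eq_matI)
      fix i j assume "i < dim_row (\<Phi> H)" "j < dim_col (\<Phi> H)"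
      hence ij: "i < k" "j < k" using car[OF H(1)] by auto
      have "(mat_adjoint (\<Phi> H) + complex_of_real c \<cdot>\<^sub>m 1\<^sub>m k) $$ (i,j) = (\<Phi> H + complex_of_real c \<cdot>\<^sub>m 1\<^sub>m k) $$ (i,j)" using e by simp
      thus "mat_adjoint (\<Phi> H) $$ (i,j) = \<Phi> H $$ (i,j)" using ij car[OF H(1)] mat_adjoint_props(1)[OF car[OF H(1)]] by simp
    qed (use car[OF H(1)] mat_adjoint_props(1)[OF car[OF H(1)]] in auto)
  qed
  text \<open>C is the sum of its Hermitian part and i times the Hermitian matrix Q, and the latter
    contributes nothing to the real part.\<close>
  define Q where "Q = ReM ((- \<i>) \<cdot>\<^sub>m C)"
  have R: "ReM C \<in> carrier_mat n n" by (rule ReM_carrier[OF C])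
  have iC: "(- \<i>) \<cdot>\<^sub>m C \<in> carrier_mat n n" using C by simp
  have Q: "Q \<in> carrier_mat n n" unfolding Q_def by (rule ReM_carrier[OF iC])
  have dec: "C = ReM C + \<i> \<cdot>\<^sub>m Q"
  proof (rule eq_matI)
    fix i j assume "i < dim_row (ReM C + \<i> \<cdot>\<^sub>m Q)" "j < dim_col (ReM C + \<i> \<cdot>\<^sub>m Q)"
    hence ij: "i < n" "j < n" using Q by auto
    have 1: "ReM C $$ (i,j) = (C $$ (i,j) + cnj (C $$ (j,i))) / 2"
      using C ij mat_adjoint_props[OF C] by (simp add: ReM_def)
    have 2: "Q $$ (i,j) = (- \<i> * C $$ (i,j) + cnj (- \<i> * C $$ (j,i))) / 2"
      using C ij mat_adjoint_props[OF iC] by (simp add: ReM_def Q_def)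
    have 3: "(a + cnj b) / 2 + \<i> * ((- \<i> * a + cnj (- \<i> * b)) / 2) = a" for a b
      by (simp add: complex_eq_iff field_simps)
    have "(ReM C + \<i> \<cdot>\<^sub>m Q) $$ (i,j) = ReM C $$ (i,j) + \<i> * Q $$ (i,j)" using ij Q R by simp
    thus "C $$ (i,j) = (ReM C + \<i> \<cdot>\<^sub>m Q) $$ (i,j)" unfolding 1 2 3 by simp
  qed (use C Q in auto)
  have iQ: "\<i> \<cdot>\<^sub>m Q \<in> carrier_mat n n" using Q by simp
  have "\<Phi> C = \<Phi> (ReM C) + \<i> \<cdot>\<^sub>m \<Phi> Q" using add[OF R iQ] smult[OF Q] dec by simp
  moreover have "\<i> \<cdot>\<^sub>m \<Phi> Q \<in> carrier_mat k k" using car[OF Q] by simp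
  ultimately have "sesq (\<Phi> C) x x = sesq (\<Phi> (ReM C)) x x + \<i> * sesq (\<Phi> Q) x x"
    using sesq_lin_mat(1)[OF car[OF R] _ x x] sesq_lin_mat(3)[OF car[OF Q] car[OF Q] x x] by simp
  moreover have "Im (sesq (\<Phi> Q) x x) = 0"
  proof -
    have "mat_adjoint (\<Phi> Q) = \<Phi> Q" by (rule herm[OF Q]) (simp add: Q_def mat_adjoint_ReM[OF iC])
    hence "sesq (\<Phi> Q) x x = cnj (sesq (\<Phi> Q) x x)" using sesq_adjoint[OF car[OF Q] x x] by simp
    thus ?thesis by (simp add: complex_eq_iff)
  qed
  moreover have "0 \<le> Re (sesq (\<Phi> (ReM C)) x x)"
  proof -
    have "psd (ReM C)" unfolding psd_iff[OF R] using mat_adjoint_ReM[OF C] Re_sesq_ReM[OF C] pos by auto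
    from psd[OF R this] show ?thesis using psd_iff[OF car[OF R]] x by blast
  qed
  ultimately show ?thesis by simp
qed

text \<open>The sector condition is closed and passes to the limit, but strict positivity might be
  lost there. A lower bound uniform in s for the h_s(X), together with total weight tending to 1,
  preserves it.\<close>

lemma mfun_sect:
  assumes h: "harm_approx w s J f" and f1: "f 1 = 1" and X: "sect t n X" and m: "0 < m"
    and lo: "\<And>v. v \<in> carrier_vec n \<Longrightarrow> m * sqn v \<le> Re (sesq X v v)"
    and one: "sect t n (1\<^sub>m n)"
  shows "sect t n (mfun f X)"
  unfolding sect_def
proof (intro conjI ballI impI)
  note d = harm_approxD[OF h]
  note cX = sectD(1)[OF X] and sX = sect_spec_slit[OF X]
  show "mfun f X \<in> carrier_mat n n" using cX by simp
  note pen = mfun_harm_pencil[OF cX sX d(2,3)]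
  fix u :: "complex Matrix.vec" assume u: "u \<in> carrier_vec n"
  show "\<bar>Im (sesq (mfun f X) u u)\<bar> \<le> t * Re (sesq (mfun f X) u u)"
  proof (rule LIMSEQ_le[OF tendsto_rabs[OF Im_sesq_mfun_limit[OF h cX sX u u]] tendsto_mult[OF tendsto_const Re_sesq_mfun_limit[OF h cX sX u u]]])
    show "\<exists>N0. \<forall>N\<ge>N0. \<bar>\<Sum>k<J N. w N k * Im (sesq (mfun (wharm (s N k)) X) u u)\<bar> \<le>
        t * (\<Sum>k<J N. w N k * Re (sesq (mfun (wharm (s N k)) X) u u))"
    proof (intro exI allI impI)
      fix N
      have "\<bar>\<Sum>k<J N. w N k * Im (sesq (mfun (wharm (s N k)) X) u u)\<bar> \<le>
         (\<Sum>k<J N. w N k * \<bar>Im (sesq (mfun (wharm (s N k)) X) u u)\<bar>)"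
        by (rule order_trans[OF sum_abs]) (simp add: abs_mult d(1))
      also have "\<dots> \<le> (\<Sum>k<J N. w N k * (t * Re (sesq (mfun (wharm (s N k)) X) u u)))"
        by (intro sum_mono mult_left_mono d(1) pencil_sector[OF pen d(2,3) one X u])
      also have "\<dots> = t * (\<Sum>k<J N. w N k * Re (sesq (mfun (wharm (s N k)) X) u u))"
        by (simp add: sum_distrib_left mult_ac)
      finally show "\<bar>\<Sum>k<J N. w N k * Im (sesq (mfun (wharm (s N k)) X) u u)\<bar> \<le> \<dots>" .
    qed
  qed
  assume u0: "u \<noteq> 0\<^sub>v n"
  \<comment> \<open>A common lower bound for the two matrices 1 and X whose harmonic mean is
    h_s(X).\<close>
  define \<mu> where "\<mu> = min 1 m"
  have \<mu>: "0 < \<mu>" "\<mu> \<le> 1" "\<mu> \<le> m" using m by (auto simp: \<mu>_def)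
  have low: "\<mu> * sqn u \<le> Re (sesq (mfun (wharm (s N k)) X) u u)" for N k
  proof -
    let ?s = "s N k" and ?H = "mfun (wharm (s N k)) X"
    obtain a b where ab: "a \<in> carrier_vec n" "b \<in> carrier_vec n" and eq: "1\<^sub>m n *\<^sub>v a = ?H *\<^sub>v u" "X *\<^sub>v b = ?H *\<^sub>v u"
      and uu: "u = complex_of_real ?s \<cdot>\<^sub>v a + complex_of_real (1 - ?s) \<cdot>\<^sub>v b" by (rule pencilE[OF pen u])
    have H: "?H \<in> carrier_mat n n" using cX by simp
    have s: "0 \<le> ?s" "?s \<le> 1" by (rule d)+
    \<comment> \<open>Convexity of the squared norm along u = s a + (1 - s) b; the defect is s (1 -
      s) |a - b|^2.\<close>
    have "sqn u \<le> ?s * sqn a + (1 - ?s) * sqn b"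
    proof -
      have sa: "complex_of_real ?s \<cdot>\<^sub>v a \<in> carrier_vec n" using ab by simp
      have "sqn u = ?s\<^sup>2 * sqn a + 2 * (1 - ?s) * (?s * Re (ip b a)) + (1 - ?s)\<^sup>2 * sqn b"
        unfolding uu sqn_lincomb[OF sa ab(2)] using ab by (simp add: ip_smult[of _ n] power2_eq_square)
      moreover have "0 \<le> sqn (a + complex_of_real (-1) \<cdot>\<^sub>v b)" using ab by (intro sqn_nonneg[of _ n]) auto
      hence "0 \<le> (?s * (1 - ?s)) * (sqn a + 2 * (-1) * Re (ip b a) + (-1)\<^sup>2 * sqn b)"
        unfolding sqn_lincomb[OF ab] using s by (intro mult_nonneg_nonneg) auto
      moreover have "?s * sqn a + (1 - ?s) * sqn b - (?s\<^sup>2 * sqn a + 2 * (1 - ?s) * (?s * Re (ip b a)) + (1 - ?s)\<^sup>2 * sqn b)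
        = (?s * (1 - ?s)) * (sqn a + 2 * (-1) * Re (ip b a) + (-1)\<^sup>2 * sqn b)"
        by (simp add: algebra_simps power2_eq_square)
      ultimately show ?thesis by linarith
    qed
    hence "\<mu> * sqn u \<le> \<mu> * (?s * sqn a + (1 - ?s) * sqn b)" using \<mu> by (intro mult_left_mono) auto
    also have "\<dots> = ?s * (\<mu> * sqn a) + (1 - ?s) * (\<mu> * sqn b)" by (simp add: algebra_simps)
    also have "\<dots> \<le> ?s * Re (sesq (1\<^sub>m n) a a) + (1 - ?s) * Re (sesq X b b)"
    proof (intro add_mono mult_left_mono)
      show "\<mu> * sqn a \<le> Re (sesq (1\<^sub>m n) a a)" unfolding sesq_one[OF ab(1,1)]
        using \<mu> sqn_nonneg[OF ab(1)] by (simp add: mult_left_le_one_le)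
      have "\<mu> * sqn b \<le> m * sqn b" using \<mu> sqn_nonneg[OF ab(2)] by (intro mult_right_mono) auto
      thus "\<mu> * sqn b \<le> Re (sesq X b b)" using lo[OF ab(2)] by linarith
    qed (use s in auto)
    also have "\<dots> = Re (sesq ?H u u)" unfolding pencil_form[OF H ab u eq ab uu] by simp
    finally show ?thesis .
  qed
  have "1 * (\<mu> * sqn u) \<le> Re (sesq (mfun f X) u u)"
  proof (rule LIMSEQ_le[OF tendsto_mult[OF harm_approx_weights(1)[OF h f1] tendsto_const] Re_sesq_mfun_limit[OF h cX sX u u]])
    show "\<exists>N0. \<forall>N\<ge>N0. (\<Sum>k<J N. w N k) * (\<mu> * sqn u) \<le> (\<Sum>k<J N. w N k * Re (sesq (mfun (wharm (s N k)) X) u u))"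
      unfolding sum_distrib_right by (intro exI allI impI sum_mono mult_left_mono low d(1))
  qed
  moreover have "0 < \<mu> * sqn u" using \<mu> sqn_pos[OF u u0] by simp
  ultimately show "0 < Re (sesq (mfun f X) u u)" by linarith
qed

lemma sect_one: assumes "0 \<le> t" shows "sect t n (1\<^sub>m n)"
  unfolding sect_def using assms sqn_nonneg[of _ n] sqn_pos[of _ n] ip_self_real[of _ n]
  by (auto simp: sesq_one mult_nonneg_nonneg) (metis Im_complex_of_real abs_zero mult_nonneg_nonneg)

text \<open>The weights $w$ and parameters $s$ of a mean satisfy $\sum w s \to v$, $\sum w (1 - s) \to 1 - v$, since its
  representing function is tangent to $v + (1 - v)x$ at 1.\<close>
lemma mmean_limit:
  assumes g: "rep_fun g" and le: "\<And>x::real. x > 0 \<Longrightarrow> Re (g (complex_of_real x)) \<le> v + (1 - v) * x"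
    and A: "sect t n A" and B: "sect t n B"
  obtains w s :: "nat \<Rightarrow> nat \<Rightarrow> real" and H :: "nat \<Rightarrow> nat \<Rightarrow> complex mat" and J :: "nat \<Rightarrow> nat"
  where "\<And>N k. 0 \<le> w N k" "\<And>N k. 0 \<le> s N k" "\<And>N k. s N k \<le> (1::real)"
    "\<And>N k. pencil n (s N k) A B (H N k)" "mmean g A B \<in> carrier_mat n n"
    "\<And>u. u \<in> carrier_vec n \<Longrightarrow> (\<lambda>N::nat. \<Sum>k<J N. w N k * Re (sesq (H N k) u u)) \<longlonglongrightarrow> Re (sesq (mmean g A B) u u)"
    "\<And>a b. (\<lambda>N. \<Sum>k<J N. w N k * (s N k * a + (1 - s N k) * b)) \<longlonglongrightarrow> v * a + (1 - v) * b"
proof -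
  have gr: "g holomorphic_on slit" "g 1 = 1" using g by (auto simp: rep_fun_def)
  obtain w s J where h: "harm_approx w s J g" using rep_fun_harm_approx[OF g] by blast
  note d = harm_approxD[OF h]
  obtain S T where ST: "S \<in> carrier_mat n n" "T \<in> carrier_mat n n" "spec T \<subseteq> slit"
    "\<And>g. mmean g A B = S * mfun g T * S"
    "\<And>s. 0 \<le> s \<Longrightarrow> s \<le> 1 \<Longrightarrow> pencil n s A B (S * mfun (wharm s) T * S)"
    using mmean_pencil[OF A B] by metis
  have lim: "(\<lambda>N. \<Sum>k<J N. w N k * (s N k * a + (1 - s N k) * b)) \<longlonglongrightarrow> v * a + (1 - v) * b" for a b
  proof -
    \<comment> \<open>Written as a + (1 - s)(b - a), the average involves only the total weight and
      the moment of 1 - s, both of which have known limits.\<close>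
    have "(\<lambda>N. (\<Sum>k<J N. w N k) * a + (\<Sum>k<J N. w N k * (1 - s N k)) * (b - a)) \<longlonglongrightarrow> 1 * a + (1 - v) * (b - a)"
    proof -
      have dg: "Re (deriv g 1) = 1 - v" by (rule mean_derivative_at_one[OF gr le])
      note hw = harm_approx_weights[OF h gr(2)]
      show ?thesis by (intro tendsto_add tendsto_mult tendsto_const hw(1) hw(2)[unfolded dg])
    qed
    moreover have "(\<Sum>k<J N. w N k) * a + (\<Sum>k<J N. w N k * (1 - s N k)) * (b - a) = (\<Sum>k<J N. w N k * (s N k * a + (1 - s N k) * b))" for N
      unfolding sum_distrib_right sum.distrib[symmetric] by (intro sum.cong refl) (simp add: algebra_simps)
    moreover have "1 * a + (1 - v) * (b - a) = v * a + (1 - v) * b" by (simp add: algebra_simps)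
    ultimately show ?thesis by simp
  qed
  show ?thesis
  proof (rule that[of w s "\<lambda>N k. S * mfun (wharm (s N k)) T * S" J])
    show "mmean g A B \<in> carrier_mat n n" unfolding ST(4) using ST(1,2) by (metis mfun_carrier mult_carrier_mat)
    show "(\<lambda>N. \<Sum>k<J N. w N k * Re (sesq (S * mfun (wharm (s N k)) T * S) u u)) \<longlonglongrightarrow> Re (sesq (mmean g A B) u u)"
      if "u \<in> carrier_vec n" for u unfolding ST(4) by (rule Re_sesq_conj_limit[OF h ST(2,3,1) that])
  qed (use d ST(5) lim in auto)
qed

section \<open>Comparison of matrix functions and the final inequality\<close>

text \<open>For each h_s the splitting of u that belongs to Z is an admissible trial splitting for X
  and for Y, since all three share the partner matrix 1. The variational upper bound costs sec^2,
  and what is left to compare are the forms of X, Y and Z at the single vector b.\<close>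

lemma mfun_superlinear:
  assumes h: "harm_approx w s J f" and t: "0 \<le> t" and X: "sect t n X" and Y: "sect t n Y"
    and Z: "Z \<in> carrier_mat n n" "spec Z \<subseteq> slit" and v: "0 \<le> v" "v \<le> 1" and \<kappa>: "0 \<le> \<kappa>" "\<kappa> \<le> 1"
    and le: "\<And>u. u \<in> carrier_vec n \<Longrightarrow> \<kappa> * (v * Re (sesq X u u) + (1 - v) * Re (sesq Y u u)) \<le> Re (sesq Z u u)"
    and u: "u \<in> carrier_vec n"
  shows "\<kappa> * (v * Re (sesq (mfun f X) u u) + (1 - v) * Re (sesq (mfun f Y) u u)) \<le> (1 + t\<^sup>2) * Re (sesq (mfun f Z) u u)"
proof -
  note d = harm_approxD[OF h]
  note cX = sectD(1)[OF X] sect_spec_slit[OF X] and cY = sectD(1)[OF Y] sect_spec_slit[OF Y]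
  let ?h = "\<lambda>N k W. Re (sesq (mfun (wharm (s N k)) W) u u)"
  have termwise: "\<kappa> * (v * ?h N k X + (1 - v) * ?h N k Y) \<le> (1 + t\<^sup>2) * ?h N k Z" for N k
  proof -
    let ?s = "s N k"
    have s: "0 \<le> ?s" "?s \<le> 1" by (rule d)+
    obtain a b where ab: "a \<in> carrier_vec n" "b \<in> carrier_vec n"
      and eq: "1\<^sub>m n *\<^sub>v a = mfun (wharm ?s) Z *\<^sub>v u" "Z *\<^sub>v b = mfun (wharm ?s) Z *\<^sub>v u"
      and uu: "u = complex_of_real ?s \<cdot>\<^sub>v a + complex_of_real (1 - ?s) \<cdot>\<^sub>v b"
      by (rule pencilE[OF mfun_harm_pencil[OF Z s] u])
    define q where "q = (\<lambda>W. ?s * sqn a + (1 - ?s) * Re (sesq W b b))"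
    have cH: "mfun (wharm ?s) Z \<in> carrier_mat n n" using Z by simp
    have HZ: "?h N k Z = q Z" unfolding pencil_form[OF cH ab u eq ab uu] q_def sesq_one[OF ab(1,1)] by simp
    have HX: "?h N k X \<le> (1 + t\<^sup>2) * q X"
      using pencil_upper[OF mfun_harm_pencil[OF cX s] s sect_one[OF t] X t u ab uu] unfolding q_def sesq_one[OF ab(1,1)] .
    have HY: "?h N k Y \<le> (1 + t\<^sup>2) * q Y"
      using pencil_upper[OF mfun_harm_pencil[OF cY s] s sect_one[OF t] Y t u ab uu] unfolding q_def sesq_one[OF ab(1,1)] .
    have "\<kappa> * (v * ?h N k X + (1 - v) * ?h N k Y) \<le> \<kappa> * (v * ((1 + t\<^sup>2) * q X) + (1 - v) * ((1 + t\<^sup>2) * q Y))"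
      using \<kappa> v HX HY by (intro mult_left_mono add_mono) auto
    also have "\<dots> = (1 + t\<^sup>2) * (\<kappa> * (?s * sqn a) + (1 - ?s) * (\<kappa> * (v * Re (sesq X b b) + (1 - v) * Re (sesq Y b b))))"
      unfolding q_def by (simp add: algebra_simps)
    also have "\<dots> \<le> (1 + t\<^sup>2) * (?s * sqn a + (1 - ?s) * Re (sesq Z b b))"
    proof (intro mult_left_mono add_mono)
      \<comment> \<open>The summand from the matrix 1 carries \<kappa> on one side only; \<kappa>
        \<le> 1 makes it harmless.\<close>
      show "\<kappa> * (?s * sqn a) \<le> ?s * sqn a"
        using \<kappa> s sqn_nonneg[OF ab(1)] by (intro mult_left_le_one_le) auto
    qed (use le[OF ab(2)] s in auto)
    finally show ?thesis unfolding HZ q_def .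
  qed
  note lX = Re_sesq_mfun_limit[OF h cX u u] and lY = Re_sesq_mfun_limit[OF h cY u u] and lZ = Re_sesq_mfun_limit[OF h Z u u]
  show ?thesis
  proof (rule LIMSEQ_le)
    show "(\<lambda>N. \<kappa> * (v * (\<Sum>k<J N. w N k * ?h N k X) + (1 - v) * (\<Sum>k<J N. w N k * ?h N k Y)))
       \<longlonglongrightarrow> \<kappa> * (v * Re (sesq (mfun f X) u u) + (1 - v) * Re (sesq (mfun f Y) u u))"
      by (intro tendsto_mult tendsto_add tendsto_const lX lY)
    show "(\<lambda>N. (1 + t\<^sup>2) * (\<Sum>k<J N. w N k * ?h N k Z)) \<longlonglongrightarrow> (1 + t\<^sup>2) * Re (sesq (mfun f Z) u u)"
      by (intro tendsto_mult tendsto_const lZ)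
    show "\<exists>N0. \<forall>N\<ge>N0. \<kappa> * (v * (\<Sum>k<J N. w N k * ?h N k X) + (1 - v) * (\<Sum>k<J N. w N k * ?h N k Y)) \<le>
       (1 + t\<^sup>2) * (\<Sum>k<J N. w N k * ?h N k Z)"
    proof (intro exI allI impI)
      fix N
      have "\<kappa> * (v * (\<Sum>k<J N. w N k * ?h N k X) + (1 - v) * (\<Sum>k<J N. w N k * ?h N k Y)) =
         (\<Sum>k<J N. w N k * (\<kappa> * (v * ?h N k X + (1 - v) * ?h N k Y)))"
        unfolding sum_distrib_left sum.distrib[symmetric] by (intro sum.cong refl) (simp add: algebra_simps)
      also have "\<dots> \<le> (\<Sum>k<J N. w N k * ((1 + t\<^sup>2) * ?h N k Z))" by (intro sum_mono mult_left_mono termwise d(1))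
      also have "\<dots> = (1 + t\<^sup>2) * (\<Sum>k<J N. w N k * ?h N k Z)" by (simp add: sum_distrib_left mult_ac)
      finally show "\<kappa> * (v * (\<Sum>k<J N. w N k * ?h N k X) + (1 - v) * (\<Sum>k<J N. w N k * ?h N k Y)) \<le> \<dots>" .
    qed
  qed
qed

lemma ReM_one: "ReM (1\<^sub>m n) = 1\<^sub>m n"
proof (rule eq_matI)
  fix i j assume "i < dim_row (1\<^sub>m n)" "j < dim_col (1\<^sub>m n)"
  thus "ReM (1\<^sub>m n) $$ (i,j) = 1\<^sub>m n $$ (i,j)"
    using mat_adjoint_lin(4)[OF one_carrier_mat[of n] one_carrier_mat[of n]] by (simp add: ReM_def)
qed (use ReM_carrier[OF one_carrier_mat[of n]] in auto)

lemma loewner_bounds_iff: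
  assumes A: "A \<in> carrier_mat n n"
  shows "loewner_le (complex_of_real c \<cdot>\<^sub>m 1\<^sub>m n) (ReM A) \<longleftrightarrow> (\<forall>v\<in>carrier_vec n. c * sqn v \<le> Re (sesq A v v))"
    "loewner_le (ReM A) (complex_of_real c \<cdot>\<^sub>m 1\<^sub>m n) \<longleftrightarrow> (\<forall>v\<in>carrier_vec n. Re (sesq A v v) \<le> c * sqn v)"
proof -
  have 1: "complex_of_real 1 \<cdot>\<^sub>m ReM A = ReM A" by (intro eq_matI) auto
  have "sqn v = Re (sesq (1\<^sub>m n) v v)" if "v \<in> carrier_vec n" for v using sesq_one[OF that that] by simp
  thus "loewner_le (complex_of_real c \<cdot>\<^sub>m 1\<^sub>m n) (ReM A) \<longleftrightarrow> (\<forall>v\<in>carrier_vec n. c * sqn v \<le> Re (sesq A v v))"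
    "loewner_le (ReM A) (complex_of_real c \<cdot>\<^sub>m 1\<^sub>m n) \<longleftrightarrow> (\<forall>v\<in>carrier_vec n. Re (sesq A v v) \<le> c * sqn v)"
    using loewner_le_ReM_iff[OF one_carrier_mat A, of c 1] loewner_le_ReM_iff[OF A one_carrier_mat, of 1 c]
    unfolding ReM_one 1 by simp_all
qed

text \<open>Membership in the sector is accretivity of two complex multiples of A, and accretivity
  is preserved by \<Phi>. The lower bound m is accretivity of A - m, transported by
  unitality.\<close>

lemma pos_unital_linear_sect:
  assumes \<Phi>: "pos_unital_linear n k \<Phi>" and A: "sect t n A" and m: "0 < m"
    and lo: "\<And>v. v \<in> carrier_vec n \<Longrightarrow> m * sqn v \<le> Re (sesq A v v)"
  shows "sect t k (\<Phi> A)" "\<And>x. x \<in> carrier_vec k \<Longrightarrow> m * sqn x \<le> Re (sesq (\<Phi> A) x x)"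
proof -
  note cA = sectD(1)[OF A]
  have c: "\<Phi> A \<in> carrier_mat k k" using \<Phi> cA unfolding pos_unital_linear_def by blast
  have smult: "\<Phi> (z \<cdot>\<^sub>m X) = z \<cdot>\<^sub>m \<Phi> X" if "X \<in> carrier_mat n n" for z X
    using \<Phi> that unfolding pos_unital_linear_def by blast
  have lo': "m * sqn x \<le> Re (sesq (\<Phi> A) x x)" if x: "x \<in> carrier_vec k" for x
  proof -
    have m1: "complex_of_real (- m) \<cdot>\<^sub>m 1\<^sub>m n \<in> carrier_mat n n" by simp
    have "0 \<le> Re (sesq (\<Phi> (A + complex_of_real (- m) \<cdot>\<^sub>m 1\<^sub>m n)) x x)"
    proof (rule pos_linear_ReM[OF \<Phi> _ _ x])
      show "0 \<le> Re (sesq (A + complex_of_real (- m) \<cdot>\<^sub>m 1\<^sub>m n) v v)" if v: "v \<in> carrier_vec n" for v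
        unfolding sesq_lin_mat(1)[OF cA m1 v v] sesq_lin_mat(3)[OF one_carrier_mat one_carrier_mat v v] sesq_one[OF v v]
        using lo[OF v] by simp
    qed (use cA in simp)
    moreover have "\<Phi> (A + complex_of_real (- m) \<cdot>\<^sub>m 1\<^sub>m n) = \<Phi> A + complex_of_real (- m) \<cdot>\<^sub>m 1\<^sub>m k"
      using \<Phi> cA m1 smult[OF one_carrier_mat] unfolding pos_unital_linear_def by metis
    moreover have m1': "complex_of_real (- m) \<cdot>\<^sub>m 1\<^sub>m k \<in> carrier_mat k k" by simp
    ultimately show ?thesis
      using sesq_lin_mat(1)[OF c m1' x x] sesq_lin_mat(3)[OF one_carrier_mat one_carrier_mat x x, of "complex_of_real (- m)"] sesq_one[OF x x] by simp
  qed
  have im: "\<bar>Im (sesq (\<Phi> A) x x)\<bar> \<le> t * Re (sesq (\<Phi> A) x x)" if x: "x \<in> carrier_vec k" for x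
  proof -
    \<comment> \<open>Multiplication by t + i e rotates the form so that its real part is t Re - e
      Im; the signs e = 1 and e = -1 give the two sides of the sector.\<close>
    have "0 \<le> t * Re (sesq (\<Phi> A) x x) - e * Im (sesq (\<Phi> A) x x)" if e: "\<bar>e\<bar> = 1" for e :: real
    proof -
      let ?z = "Complex t e"
      have "0 \<le> Re (sesq (\<Phi> (?z \<cdot>\<^sub>m A)) x x)"
      proof (rule pos_linear_ReM[OF \<Phi> _ _ x])
        show "0 \<le> Re (sesq (?z \<cdot>\<^sub>m A) v v)" if v: "v \<in> carrier_vec n" for v
        proof -
          have "e * Im (sesq A v v) \<le> \<bar>e\<bar> * \<bar>Im (sesq A v v)\<bar>" by (simp only: abs_mult[symmetric] abs_ge_self)
          thus ?thesis unfolding sesq_lin_mat(3)[OF cA cA v v] using sectD(2)[OF A v] e by simp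
        qed
      qed (use cA in simp)
      thus ?thesis unfolding smult[OF cA] sesq_lin_mat(3)[OF c c x x] by simp
    qed
    from this[of 1] this[of "-1"] show ?thesis by simp
  qed
  show "sect t k (\<Phi> A)" unfolding sect_def
  proof (intro conjI ballI impI c im)
    fix x :: "complex Matrix.vec" assume x: "x \<in> carrier_vec k" "x \<noteq> 0\<^sub>v k"
    have "0 < m * sqn x" using m sqn_pos[OF x] by simp
    thus "0 < Re (sesq (\<Phi> A) x x)" using lo'[OF x(1)] by linarith
  qed
  show "\<And>x. x \<in> carrier_vec k \<Longrightarrow> m * sqn x \<le> Re (sesq (\<Phi> A) x x)" by (rule lo')
qed

theorem theorem2p14:
  fixes \<theta> m M v :: real and n k :: nat
    and A B :: "complex mat"
    and f g1 g2 :: "complex \<Rightarrow> complex"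
    and \<Phi> :: "complex mat \<Rightarrow> complex mat"
  assumes "0 \<le> \<theta>" and "\<theta> < pi / 2"
    and "A \<in> carrier_mat n n" and "B \<in> carrier_mat n n"
    and "sector \<theta> A" and "sector \<theta> B"
    and "0 < m" and "m \<le> M"
    and "loewner_le (complex_of_real m \<cdot>\<^sub>m 1\<^sub>m n) (ReM A)"
    and "loewner_le (ReM A) (complex_of_real M \<cdot>\<^sub>m 1\<^sub>m n)"
    and "loewner_le (complex_of_real m \<cdot>\<^sub>m 1\<^sub>m n) (ReM B)"
    and "loewner_le (ReM B) (complex_of_real M \<cdot>\<^sub>m 1\<^sub>m n)"
    and "0 \<le> v" and "v \<le> 1"
    and "rep_fun f"
    and "pos_unital_linear n k \<Phi>"
    and "rep_fun g1" and "rep_fun g2"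
    and "\<forall>x::real. x > 0 \<longrightarrow> x / (v * x + (1 - v)) \<le> Re (g1 (complex_of_real x))
                              \<and> Re (g1 (complex_of_real x)) \<le> v + (1 - v) * x"
    and "\<forall>x::real. x > 0 \<longrightarrow> x / (v * x + (1 - v)) \<le> Re (g2 (complex_of_real x))
                              \<and> Re (g2 (complex_of_real x)) \<le> v + (1 - v) * x"
  shows "loewner_le
           (ReM (mmean g1 (mfun f (\<Phi> A)) (mfun f (\<Phi> B))))
           (complex_of_real ((M + m)^2 / (4 * m * M) / (cos \<theta>)^4) \<cdot>\<^sub>m ReM (mfun f (\<Phi> (mmean g2 A B))))"
proof -
  note cA = assms(3) and cB = assms(4) and m = assms(7,8) and v = assms(13,14) and \<Phi> = assms(16)
  define t where "t = tan \<theta>"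
  have cos: "cos \<theta> > 0" using assms(1,2) by (intro cos_gt_zero_pi) auto
  have t: "0 \<le> t" unfolding t_def tan_def using assms(1,2) cos by (intro divide_nonneg_nonneg sin_ge_zero) auto
  have t2: "1 + t\<^sup>2 = 1 / (cos \<theta>)\<^sup>2"
    unfolding t_def tan_def using cos sin_cos_squared_add[of \<theta>] by (simp add: field_simps power_divide)
  \<comment> \<open>Reciprocal of the Kantorovich constant K of the statement.\<close>
  define \<kappa> where "\<kappa> = 4 * m * M / (M + m)\<^sup>2"
  have Mm: "M > 0" "(M + m)\<^sup>2 > 0" using m by auto
  have \<kappa>: "0 < \<kappa>" "\<kappa> \<le> 1"
  proof -
    show "0 < \<kappa>" unfolding \<kappa>_def using m Mm by simp
    have "4 * m * M \<le> (M + m)\<^sup>2" using zero_le_power2[of "M - m"] by (simp add: power2_eq_square algebra_simps)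
    thus "\<kappa> \<le> 1" unfolding \<kappa>_def using Mm by simp
  qed
  have sA: "sect t n A" and sB: "sect t n B"
    unfolding t_def by (rule sector_imp_sect[OF assms(5) cA], rule sector_imp_sect[OF assms(6) cB])
  have lA: "\<And>u. u \<in> carrier_vec n \<Longrightarrow> m * sqn u \<le> Re (sesq A u u)" "\<And>u. u \<in> carrier_vec n \<Longrightarrow> Re (sesq A u u) \<le> M * sqn u"
    using assms(9,10) loewner_bounds_iff[OF cA] by auto
  have lB: "\<And>u. u \<in> carrier_vec n \<Longrightarrow> m * sqn u \<le> Re (sesq B u u)" "\<And>u. u \<in> carrier_vec n \<Longrightarrow> Re (sesq B u u) \<le> M * sqn u"
    using assms(11,12) loewner_bounds_iff[OF cB] by auto
  define X where "X = \<Phi> A"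
  define Y where "Y = \<Phi> B"
  have sX: "sect t k X" unfolding X_def by (rule pos_unital_linear_sect(1)[OF \<Phi> sA m(1) lA(1)])
  have sY: "sect t k Y" unfolding Y_def by (rule pos_unital_linear_sect(1)[OF \<Phi> sB m(1) lB(1)])
  have lX: "m * sqn x \<le> Re (sesq X x x)" if "x \<in> carrier_vec k" for x
    unfolding X_def by (rule pos_unital_linear_sect(2)[OF \<Phi> sA m(1) _ that]) (rule lA(1))
  have lY: "m * sqn x \<le> Re (sesq Y x x)" if "x \<in> carrier_vec k" for x
    unfolding Y_def by (rule pos_unital_linear_sect(2)[OF \<Phi> sB m(1) _ that]) (rule lB(1))
  have cX: "X \<in> carrier_mat k k" "Y \<in> carrier_mat k k" using sX sY unfolding sect_def by auto
  define C where "C = mmean g2 A B"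
  have Cboth: "C \<in> carrier_mat n n \<and> (\<forall>u\<in>carrier_vec n. \<kappa> * (v * Re (sesq A u u) + (1 - v) * Re (sesq B u u)) \<le> Re (sesq C u u))"
    unfolding C_def
  proof (rule mmean_limit[OF assms(18) _ sA sB])
    show "\<And>x::real. x > 0 \<Longrightarrow> Re (g2 (complex_of_real x)) \<le> v + (1 - v) * x" using assms(20) by blast
    fix w s :: "nat \<Rightarrow> nat \<Rightarrow> real" and H :: "nat \<Rightarrow> nat \<Rightarrow> complex mat" and J :: "nat \<Rightarrow> nat"
    assume H: "\<And>N k. 0 \<le> w N k" "\<And>N k. 0 \<le> s N k" "\<And>N k. s N k \<le> 1"
      "\<And>N k. pencil n (s N k) A B (H N k)" and car: "mmean g2 A B \<in> carrier_mat n n"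
      and lim: "\<And>u. u \<in> carrier_vec n \<Longrightarrow> (\<lambda>N. \<Sum>k<J N. w N k * Re (sesq (H N k) u u)) \<longlonglongrightarrow> Re (sesq (mmean g2 A B) u u)"
      and wlim: "\<And>a b. (\<lambda>N. \<Sum>k<J N. w N k * (s N k * a + (1 - s N k) * b)) \<longlonglongrightarrow> v * a + (1 - v) * b"
    have "\<kappa> * (v * Re (sesq A u u) + (1 - v) * Re (sesq B u u)) \<le> Re (sesq (mmean g2 A B) u u)"
      if u: "u \<in> carrier_vec n" for u
    proof (rule LIMSEQ_le[OF tendsto_mult[OF tendsto_const wlim] lim[OF u]])
      show "\<exists>N0. \<forall>N\<ge>N0. \<kappa> * (\<Sum>k<J N. w N k * (s N k * Re (sesq A u u) + (1 - s N k) * Re (sesq B u u))) \<le>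
          (\<Sum>k<J N. w N k * Re (sesq (H N k) u u))"
        unfolding sum_distrib_left
      proof (intro exI allI impI sum_mono)
        fix N k
        have "w N k * (\<kappa> * (s N k * Re (sesq A u u) + (1 - s N k) * Re (sesq B u u))) \<le> w N k * Re (sesq (H N k) u u)"
          unfolding \<kappa>_def by (intro mult_left_mono H(1) pencil_lower[OF H(4,2,3) cA cB m lA lB u])
        thus "\<kappa> * (w N k * (s N k * Re (sesq A u u) + (1 - s N k) * Re (sesq B u u))) \<le> w N k * Re (sesq (H N k) u u)"
          by (simp only: mult.left_commute)
      qed
    qed
    thus "mmean g2 A B \<in> carrier_mat n n \<and> (\<forall>u\<in>carrier_vec n. \<kappa> * (v * Re (sesq A u u) + (1 - v) * Re (sesq B u u))
        \<le> Re (sesq (mmean g2 A B) u u))" using car by blast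
  qed
  have C: "C \<in> carrier_mat n n" using Cboth by blast
  have Clo: "\<kappa> * (v * Re (sesq A u u) + (1 - v) * Re (sesq B u u)) \<le> Re (sesq C u u)" if "u \<in> carrier_vec n" for u
    using Cboth that by blast
  define Z where "Z = \<Phi> C"
  have Z: "Z \<in> carrier_mat k k" unfolding Z_def using \<Phi> C unfolding pos_unital_linear_def by blast
  \<comment> \<open>The lower bound for C says that C - \<kappa> (v A + (1 - v) B) has nonnegative
    real part, a property that \<Phi> preserves by linearity and positivity.\<close>
  have Zlo: "\<kappa> * (v * Re (sesq X x x) + (1 - v) * Re (sesq Y x x)) \<le> Re (sesq Z x x)" if x: "x \<in> carrier_vec k" for x
  proof -
    define a b where "a = complex_of_real (- \<kappa> * v)" and "b = complex_of_real (- \<kappa> * (1 - v))"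
    have ab: "a \<cdot>\<^sub>m A \<in> carrier_mat n n" "b \<cdot>\<^sub>m B \<in> carrier_mat n n" "C + a \<cdot>\<^sub>m A \<in> carrier_mat n n"
      "a \<cdot>\<^sub>m X \<in> carrier_mat k k" "b \<cdot>\<^sub>m Y \<in> carrier_mat k k" "Z + a \<cdot>\<^sub>m X \<in> carrier_mat k k"
      using cA cB cX C Z by auto
    have "0 \<le> Re (sesq (\<Phi> (C + a \<cdot>\<^sub>m A + b \<cdot>\<^sub>m B)) x x)"
    proof (rule pos_linear_ReM[OF \<Phi> _ _ x])
      show "0 \<le> Re (sesq (C + a \<cdot>\<^sub>m A + b \<cdot>\<^sub>m B) u u)" if u: "u \<in> carrier_vec n" for u
        unfolding sesq_lin_mat(1)[OF ab(3,2) u u] sesq_lin_mat(1)[OF C ab(1) u u] sesq_lin_mat(3)[OF cA cA u u] sesq_lin_mat(3)[OF cB cB u u]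
        using Clo[OF u] by (simp add: a_def b_def algebra_simps)
    qed (use ab in simp)
    moreover have "\<Phi> (C + a \<cdot>\<^sub>m A + b \<cdot>\<^sub>m B) = Z + a \<cdot>\<^sub>m X + b \<cdot>\<^sub>m Y"
      unfolding Z_def X_def Y_def using \<Phi> ab C cA cB unfolding pos_unital_linear_def by metis
    moreover have "Re (sesq (Z + a \<cdot>\<^sub>m X + b \<cdot>\<^sub>m Y) x x) =
        Re (sesq Z x x) - \<kappa> * (v * Re (sesq X x x) + (1 - v) * Re (sesq Y x x))"
      unfolding sesq_lin_mat(1)[OF ab(6,5) x x] sesq_lin_mat(1)[OF Z ab(4) x x] sesq_lin_mat(3)[OF cX(1,1) x x] sesq_lin_mat(3)[OF cX(2,2) x x]
      by (simp add: a_def b_def algebra_simps)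
    ultimately show ?thesis by simp
  qed
  \<comment> \<open>The real part of Z is at least \<kappa> m > 0, so its eigenvalues lie in the
    right half-plane and the calculus applies to it.\<close>
  have sZ: "spec Z \<subseteq> slit"
  proof
    fix z assume "z \<in> spec Z"
    then obtain x where x: "x \<in> carrier_vec k" "x \<noteq> 0\<^sub>v k" "Z *\<^sub>v x = z \<cdot>\<^sub>v x" using spec_eigenvalue[OF Z] by blast
    have p: "0 < sqn x" by (rule sqn_pos[OF x(1,2)])
    have "sesq Z x x = z * ip x x" unfolding sesq_def x(3) by (rule ip_smult(1)[OF x(1,1)])
    also have "ip x x = complex_of_real (sqn x)" by (rule ip_self_real[OF x(1)])
    finally have e: "Re (sesq Z x x) = Re z * sqn x" by simp
    have "m * sqn x = v * (m * sqn x) + (1 - v) * (m * sqn x)" by (simp add: algebra_simps)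
    also have "\<dots> \<le> v * Re (sesq X x x) + (1 - v) * Re (sesq Y x x)"
      using v lX[OF x(1)] lY[OF x(1)] by (intro add_mono mult_left_mono) auto
    finally have "\<kappa> * (m * sqn x) \<le> Re (sesq Z x x)"
      using Zlo[OF x(1)] \<kappa> by (meson mult_left_mono less_imp_le order_trans)
    moreover have "0 < \<kappa> * (m * sqn x)" using \<kappa> m p by simp
    ultimately have "0 < Re z * sqn x" unfolding e by linarith
    hence "Re z > 0" using p by (simp add: zero_less_mult_iff)
    thus "z \<in> slit" by (rule Re_pos_in_slit)
  qed
  obtain wf sf Jf where hf: "harm_approx wf sf Jf f" using rep_fun_harm_approx[OF assms(15)] by blast
  have f1: "f 1 = 1" using assms(15) by (simp add: rep_fun_def)
  define F where "F = mfun f X"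
  define G where "G = mfun f Y"
  have sF: "sect t k F" unfolding F_def by (rule mfun_sect[OF hf f1 sX m(1) lX sect_one[OF t]])
  have sG: "sect t k G" unfolding G_def by (rule mfun_sect[OF hf f1 sY m(1) lY sect_one[OF t]])
  define P where "P = mmean g1 F G"
  define R where "R = mfun f Z"
  have R: "R \<in> carrier_mat k k" unfolding R_def using Z by simp
  have Pboth: "P \<in> carrier_mat k k \<and>
    (\<forall>x\<in>carrier_vec k. Re (sesq P x x) \<le> (1 + t\<^sup>2) * (v * Re (sesq F x x) + (1 - v) * Re (sesq G x x)))"
    unfolding P_def
  proof (rule mmean_limit[OF assms(17) _ sF sG])
    show "\<And>x::real. x > 0 \<Longrightarrow> Re (g1 (complex_of_real x)) \<le> v + (1 - v) * x" using assms(19) by blast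
    fix w s :: "nat \<Rightarrow> nat \<Rightarrow> real" and H :: "nat \<Rightarrow> nat \<Rightarrow> complex mat" and J :: "nat \<Rightarrow> nat"
    assume H: "\<And>N j. 0 \<le> w N j" "\<And>N j. 0 \<le> s N j" "\<And>N j. s N j \<le> 1"
      "\<And>N j. pencil k (s N j) F G (H N j)" and car: "mmean g1 F G \<in> carrier_mat k k"
      and lim: "\<And>u. u \<in> carrier_vec k \<Longrightarrow> (\<lambda>N. \<Sum>j<J N. w N j * Re (sesq (H N j) u u)) \<longlonglongrightarrow> Re (sesq (mmean g1 F G) u u)"
      and wlim: "\<And>a b. (\<lambda>N. \<Sum>j<J N. w N j * (s N j * a + (1 - s N j) * b)) \<longlonglongrightarrow> v * a + (1 - v) * b"
    have "Re (sesq (mmean g1 F G) x x) \<le> (1 + t\<^sup>2) * (v * Re (sesq F x x) + (1 - v) * Re (sesq G x x))"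
      if x: "x \<in> carrier_vec k" for x
    proof (rule LIMSEQ_le[OF lim[OF x] tendsto_mult[OF tendsto_const wlim]])
      show "\<exists>N0. \<forall>N\<ge>N0. (\<Sum>j<J N. w N j * Re (sesq (H N j) x x)) \<le>
         (1 + t\<^sup>2) * (\<Sum>j<J N. w N j * (s N j * Re (sesq F x x) + (1 - s N j) * Re (sesq G x x)))"
        unfolding sum_distrib_left
      proof (intro exI allI impI sum_mono)
        fix N j
        \<comment> \<open>The trivial splitting a' = b' = x turns the variational upper bound into
          the arithmetic mean, at the price of one factor sec^2.\<close>
        have "x = complex_of_real (s N j) \<cdot>\<^sub>v x + complex_of_real (1 - s N j) \<cdot>\<^sub>v x"
          using x by (intro eq_vecI) (auto simp: algebra_simps)
        from pencil_upper[OF H(4,2,3) sF sG t x x x this]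
        have "w N j * Re (sesq (H N j) x x) \<le> w N j * ((1 + t\<^sup>2) * (s N j * Re (sesq F x x) + (1 - s N j) * Re (sesq G x x)))"
          by (intro mult_left_mono H(1))
        thus "w N j * Re (sesq (H N j) x x) \<le> (1 + t\<^sup>2) * (w N j * (s N j * Re (sesq F x x) + (1 - s N j) * Re (sesq G x x)))"
          by (simp only: mult.left_commute)
      qed
    qed
    thus "mmean g1 F G \<in> carrier_mat k k \<and> (\<forall>x\<in>carrier_vec k. Re (sesq (mmean g1 F G) x x) \<le>
        (1 + t\<^sup>2) * (v * Re (sesq F x x) + (1 - v) * Re (sesq G x x)))" using car by blast
  qed
  have P: "P \<in> carrier_mat k k" using Pboth by blast
  have Pup: "Re (sesq P x x) \<le> (1 + t\<^sup>2) * (v * Re (sesq F x x) + (1 - v) * Re (sesq G x x))" if "x \<in> carrier_vec k" for x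
    using Pboth that by blast
  define K where "K = (M + m)^2 / (4 * m * M) / (cos \<theta>)^4"
  \<comment> \<open>The square collects the two factors sec^2, one from \<sigma>_1 and one from
    f.\<close>
  have K\<kappa>: "K * \<kappa> = (1 + t\<^sup>2)\<^sup>2"
    unfolding K_def \<kappa>_def t2 using m Mm cos by (simp add: power_divide)
  have main: "Re (sesq P x x) \<le> K * Re (sesq R x x)" if x: "x \<in> carrier_vec k" for x
  proof -
    have "\<kappa> * (v * Re (sesq F x x) + (1 - v) * Re (sesq G x x)) \<le> (1 + t\<^sup>2) * Re (sesq R x x)"
      unfolding F_def G_def R_def
      by (rule mfun_superlinear[OF hf t sX sY Z sZ v _ \<kappa>(2) Zlo x]) (use \<kappa> in auto)
    hence "(1 + t\<^sup>2) * (\<kappa> * (v * Re (sesq F x x) + (1 - v) * Re (sesq G x x))) \<le> (1 + t\<^sup>2) * ((1 + t\<^sup>2) * Re (sesq R x x))"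
      by (intro mult_left_mono) auto
    moreover have "\<kappa> * Re (sesq P x x) \<le> \<kappa> * ((1 + t\<^sup>2) * (v * Re (sesq F x x) + (1 - v) * Re (sesq G x x)))"
      using \<kappa> Pup[OF x] by (intro mult_left_mono) auto
    moreover have "(1 + t\<^sup>2) * (\<kappa> * (v * Re (sesq F x x) + (1 - v) * Re (sesq G x x))) =
        \<kappa> * ((1 + t\<^sup>2) * (v * Re (sesq F x x) + (1 - v) * Re (sesq G x x)))" by (rule mult.left_commute)
    ultimately have "\<kappa> * Re (sesq P x x) \<le> (1 + t\<^sup>2) * ((1 + t\<^sup>2) * Re (sesq R x x))" by linarith
    also have "\<dots> = \<kappa> * (K * Re (sesq R x x))" using K\<kappa> by (simp add: power2_eq_square mult_ac)
    finally show ?thesis using \<kappa>(1) by simp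
  qed
  have "complex_of_real 1 \<cdot>\<^sub>m ReM P = ReM P" by (intro eq_matI) auto
  hence "loewner_le (ReM P) (complex_of_real K \<cdot>\<^sub>m ReM R)"
    using loewner_le_ReM_iff[OF P R, of 1 K] main by simp
  thus ?thesis unfolding P_def R_def F_def G_def X_def Y_def Z_def C_def K_def .
qed

end
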